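(* $$\sum_{k=1}^{\infty} \left( \frac{1}{16} \right)^{k} \binom{2k}{k}^2 \frac{O_{k}^{2}}{(2k-1)^2} = -\frac{8 G}{\pi}-\frac{8 G \ln (2)}{\pi}-\frac{48 \mathcal{G}}{\pi}+\frac{9 \pi^2}{8}+\frac{\pi}{6}+\frac{4 \ln^2(2)}{\pi}+\frac{3 \ln^2(2)}{2}.$$
   Context: $O_k = 1+\frac13+\cdots+\frac{1}{2k-1}$ is the $k$-th odd harmonic number. $G=\sum_{n=1}^\infty \frac{(-1)^{n+1}}{(2n-1)^2}$ is Catalan's constant. $\mathcal{G}=\Im\left(\mathrm{Li}_3\left(\frac{1+i}{2}\right)\right)$, where $\mathrm{Li}_s(z)=\sum_{n\ge1} z^n/n^s$. *)

theory Defs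
  imports "HOL-Analysis.Analysis"
begin

definition odd_harmonic :: "nat \<Rightarrow> real" where
  "odd_harmonic k = (\<Sum>j=1..k. 1 / (2 * real j - 1))"

text \<open>The series over \<open>n \<ge> 1\<close> are written with \<open>Suc n\<close> in place of the index \<open>n\<close>.\<close>

definition catalan_constant :: real where
  "catalan_constant = (\<Sum>n. (-1) ^ (Suc n + 1) / (2 * real (Suc n) - 1) ^ 2)"

text \<open>The defining series converges for \<open>norm z < 1\<close>; there is no analytic continuation
  beyond that disc here, and off the domain of convergence the value is unspecified.\<close>

definition polylog :: "nat \<Rightarrow> complex \<Rightarrow> complex" where
  "polylog s z = (\<Sum>n. z ^ Suc n / of_nat (Suc n) ^ s)"

definition cal_G :: real where
  "cal_G = Im (polylog 3 ((1 + \<i>) / 2))"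

end

theory Submission
  imports Defs "HOL-Real_Asymp.Real_Asymp"
begin

text \<open>
Write \<open>b\<^sub>k = binom(2k, k) / 4\<^sup>k\<close>. Telescoping \<open>4k\<^sup>2 b\<^sub>k\<^sup>2 O\<^sub>k\<^sup>2 / (2k - 1)\<^sup>2\<close> reduces the sum to
\<open>V - 2W\<close>, where \<open>V\<close> is the sum of \<open>b\<^sub>k\<^sup>2 (2O\<^sub>k + 1/(2k + 1)) / (2k + 1)\<close> and \<open>W\<close> the sum of
\<open>b\<^sub>k\<^sup>2 O\<^sub>k\<^sup>2 / (2k - 1)\<close>. In each, one factor is a moment (\<open>b\<^sub>k O\<^sub>k\<close> of \<open>ln (tan t)\<close>, and
\<open>b\<^sub>k / (2k + 1)\<close> of \<open>- cos t ln (tan (t/2))\<close>, against \<open>sin\<^sup>2\<^sup>k t\<close> on \<open>[0, pi/2]\<close>) and the other has an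
elementary generating function at \<open>sin\<^sup>2 t\<close>, so both sums become integrals. \<open>W\<close> has an explicit
antiderivative with dilogarithms. With \<open>x = tan (t/2)\<close>, \<open>V\<close> becomes a combination of integrals of products of
\<open>ln x\<close>, \<open>ln (1 - x)\<close>, \<open>ln (1 + x)\<close>, \<open>ln (1 + x\<^sup>2)\<close> against \<open>dx / (1 + x\<^sup>2)\<close>, together with
the integral of \<open>arctan x ln (1 + x\<^sup>2) / x\<close>. These are related to one another by the substitutions
\<open>(1 - x)/(1 + x)\<close>, \<open>x/(1 \<plusminus> x)\<close>, \<open>1/(1 \<plusminus> x)\<close> and \<open>2x/(1 - x\<^sup>2)\<close>, and to
\<open>Im Li\<^sub>3((1 + i)/2)\<close> by differentiating \<open>Li\<^sub>3(z) - ln z Li\<^sub>2(z) - ln\<^sup>2 z ln(1 - z) / 2\<close> along the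
paths \<open>z = (1 + ix)/2\<close> and \<open>z = 1/(1 + ix)\<close>.
\<close>

subsection \<open>Polylogarithms\<close>

text \<open>Telescoping lowers the square of \<open>2k - 1\<close> to first order; what remains
  factors into a moment and a generating function that are both elementary at \<open>sin t\<close>,
  and the boundary term dies because \<open>central_coeff k * odd_harmonic k\<close> tends to 0. The
  obstacle is that the logarithmic integrals of weight three are not all evaluated one by one. They
  are therefore treated as pairings \<open>ip f g\<close> for the measure
  \<open>dx / (1 + x^2)\<close> on the unit interval, and every substitution becomes a linear
  relation between pairings. The final sum needs \<open>ip la lb\<close> and \<open>ip la lc\<close>
  only through their sum, and that sum can be eliminated. The transcendental input is the imaginary
  part of the trilogarithm at two points: at \<open>i\<close>, where the reflection formula of Gamma
  gives \<open>pi^3 / 32\<close>, and at \<open>(1 + i) / 2\<close>, kept as \<open>cal_G\<close>.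
  The second point lies on the line \<open>Re z = 1/2\<close>, where \<open>1 - z\<close> is the
  conjugate of \<open>z\<close>; this is why the dilogarithms left at the ends of the paths have
  known real parts.\<close>

lemma inverse_squares_sums_real: "(\<lambda>n. 1 / (real n + 1)\<^sup>2) sums (pi\<^sup>2 / 6)"
  using inverse_squares_sums by (simp only: of_nat_power of_nat_add of_nat_1)

lemma polylog_0 [simp]: "polylog s 0 = 0"
  by (simp add: polylog_def)

text \<open>Keeping the factor \<open>norm z\<close> lets one bound serve twice: for convergence on
  the closed disc and for the linear decay at 0 that later beats a logarithm.\<close>

lemma polylog_norm_term_le:
  fixes z :: complex
  assumes "norm z \<le> 1" "s \<ge> 2"
  shows "norm (z ^ Suc n / of_nat (Suc n) ^ s) \<le> norm z * (1 / (real n + 1)\<^sup>2)"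
proof -
  have "norm z ^ Suc n \<le> norm z"
    using assms power_le_one[of "norm z" n] by (simp add: mult_left_le)
  moreover have "(real n + 1)\<^sup>2 \<le> (real n + 1) ^ s"
    using assms by (intro power_increasing) auto
  moreover have "norm (z ^ Suc n / of_nat (Suc n) ^ s) = norm z ^ Suc n / (real n + 1) ^ s"
    by (simp only: norm_divide norm_power norm_of_nat) (simp add: add.commute)
  ultimately show ?thesis
    by (simp add: frac_le del: power_Suc)
qed

lemma polylog_sums:
  assumes "norm z \<le> 1" "s \<ge> 2"
  shows "(\<lambda>n. z ^ Suc n / of_nat (Suc n) ^ s) sums polylog s z"
proof -
  have "summable (\<lambda>n. norm z * (1 / (real n + 1)\<^sup>2))"
    using inverse_squares_sums_real by (intro summable_mult) (simp add: sums_iff)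
  hence "summable (\<lambda>n. z ^ Suc n / of_nat (Suc n) ^ s)"
    by (rule summable_comparison_test'[of _ 0]) (rule polylog_norm_term_le[OF assms])
  thus ?thesis unfolding polylog_def by (rule summable_sums)
qed

lemma norm_polylog_le:
  assumes "norm z \<le> 1" "s \<ge> 2"
  shows "norm (polylog s z) \<le> norm z * (pi\<^sup>2 / 6)"
proof -
  have *: "(\<lambda>n. norm z * (1 / (real n + 1)\<^sup>2)) sums (norm z * (pi\<^sup>2 / 6))"
    using inverse_squares_sums_real by (intro sums_mult)
  have "norm (polylog s z) \<le> (\<Sum>n. norm z * (1 / (real n + 1)\<^sup>2))"
    unfolding polylog_def
    by (rule norm_suminf_le) (use polylog_norm_term_le[OF assms] * in \<open>auto simp: sums_iff\<close>)
  thus ?thesis using * by (simp add: sums_iff)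
qed

lemma continuous_on_polylog:
  assumes "s \<ge> 2"
  shows "continuous_on (cball 0 1) (polylog s)"
proof -
  have "uniform_limit (cball 0 1) (\<lambda>n z. \<Sum>i<n. z ^ Suc i / of_nat (Suc i) ^ s) (polylog s) sequentially"
    unfolding polylog_def
  proof (rule Weierstrass_m_test)
    fix n and z :: complex assume "z \<in> cball 0 1"
    hence "norm z \<le> 1" by simp
    note polylog_norm_term_le[OF this assms, of n]
    also have "norm z * (1 / (real n + 1)\<^sup>2) \<le> 1 / (real n + 1)\<^sup>2"
      using \<open>norm z \<le> 1\<close> by (intro mult_left_le_one_le) auto
    finally show "norm (z ^ Suc n / of_nat (Suc n) ^ s) \<le> 1 / (real n + 1)\<^sup>2" .
  qed (use inverse_squares_sums_real in \<open>simp add: sums_iff\<close>)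
  thus ?thesis
    by (rule uniform_limit_theorem[rotated])
      (auto intro!: always_eventually continuous_on_sum continuous_on_divide continuous_on_power continuous_on_id simp del: of_nat_Suc power_Suc)
qed

lemma continuous_on_polylog' [continuous_intros]:
  assumes "continuous_on A f" "s \<ge> 2" "\<And>x. x \<in> A \<Longrightarrow> norm (f x) \<le> 1"
  shows "continuous_on A (\<lambda>x. polylog s (f x))"
  using continuous_on_compose2[OF continuous_on_polylog[OF assms(2)] assms(1)] assms(3)
  by (auto simp: image_subset_iff)

text \<open>Termwise differentiation turns \<open>1 / n ^ Suc s\<close> into
  \<open>1 / n ^ s\<close> and lowers the power of \<open>z\<close> by one, hence the division by
  \<open>z\<close>.\<close>

lemma polylog_Suc_deriv:
  assumes "norm z < 1" "z \<noteq> 0"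
  shows "(polylog (Suc s) has_field_derivative polylog s z / z) (at z)"
proof -
  \<comment> \<open>The coefficients are indexed by the power of \<open>z\<close> itself, with 0 at
    the constant term, as the rule for differentiating power series expects.\<close>
  define c :: "nat \<Rightarrow> complex" where "c n = (if n = 0 then 0 else 1 / of_nat n ^ Suc s)" for n
  have c_le: "norm (c n) \<le> 1" for n
  proof (cases "n = 0")
    case False
    hence "1 \<le> real n ^ Suc s" by (intro one_le_power) simp
    thus ?thesis using False by (simp add: c_def norm_divide norm_power norm_mult divide_le_eq_1)
  qed (simp add: c_def)
  have sm: "summable (\<lambda>n. c n * w ^ n)" if "norm w < 1" for w
  proof (rule summable_comparison_test')
    show "summable (\<lambda>n. norm w ^ n)" using that by (simp add: summable_geometric)
    show "norm (c n * w ^ n) \<le> norm w ^ n" if "n \<ge> 0" for n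
      using c_le[of n] by (simp add: norm_mult norm_power mult_left_le_one_le)
  qed
  have dc: "diffs c n = 1 / of_nat (Suc n) ^ s" for n
    by (simp add: diffs_def c_def field_simps del: of_nat_Suc)
  have eq: "polylog (Suc s) w = (\<Sum>n. c n * w ^ n)" if "norm w < 1" for w
    using suminf_split_head[OF sm[OF that]]
    by (simp add: polylog_def c_def del: of_nat_Suc power_Suc)
  have "((\<lambda>w. \<Sum>n. c n * w ^ n) has_field_derivative (\<Sum>n. diffs c n * z ^ n)) (at z)"
    by (rule termdiffs_strong'[where K = 1]) (use sm assms in auto)
  also have "(\<Sum>n. diffs c n * z ^ n) = polylog s z / z"
  proof -
    have "summable (\<lambda>n. diffs c n * z ^ n)"
      by (rule termdiff_converges[of _ 1]) (use sm assms in auto)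
    from suminf_divide[OF summable_mult2[OF this, of z], of z] assms(2)
    show ?thesis
      by (simp add: dc polylog_def mult_ac del: of_nat_Suc)
  qed
  finally have "((\<lambda>w. \<Sum>n. c n * w ^ n) has_field_derivative polylog s z / z) (at z)" .
  moreover have "eventually (\<lambda>w. w \<in> ball 0 1) (nhds z)"
    using assms by (intro eventually_nhds_in_open) auto
  hence "eventually (\<lambda>w. polylog (Suc s) w = (\<Sum>n. c n * w ^ n)) (nhds z)"
    by eventually_elim (use eq in auto)
  ultimately show ?thesis
    by (subst DERIV_cong_ev[OF refl _ refl])
qed

lemma polylog_1:
  assumes "norm z < 1"
  shows "polylog (Suc 0) z = - Ln (1 - z)"
proof -
  have "(\<lambda>n. - (z ^ n) / of_nat n) sums Ln (1 - z)"
    using Ln_series'[of "-z"] assms by simp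
  hence "(\<lambda>n. - (z ^ Suc n) / of_nat (Suc n)) sums Ln (1 - z)"
    by (subst sums_Suc_iff) simp
  from sums_minus[OF this] show ?thesis
    by (simp add: polylog_def sums_iff)
qed

lemma polylog_2_deriv:
  assumes "norm z < 1" "z \<noteq> 0"
  shows "(polylog 2 has_field_derivative - Ln (1 - z) / z) (at z)"
  using polylog_Suc_deriv[OF assms, of 1] polylog_1[OF assms(1)] by (simp add: eval_nat_numeral)

lemma polylog_3_deriv:
  assumes "norm z < 1" "z \<noteq> 0"
  shows "(polylog 3 has_field_derivative polylog 2 z / z) (at z)"
  using polylog_Suc_deriv[OF assms, of 2] by (simp add: eval_nat_numeral)

lemmas polylog_deriv_chain =
  polylog_2_deriv[THEN DERIV_chain2] polylog_3_deriv[THEN DERIV_chain2]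

text \<open>The closed unit disc meets the branch cut of \<open>Ln (1 - z)\<close> only at
  \<open>z = 1\<close>.\<close>

lemma one_minus_notin_nonpos_Reals:
  assumes "norm (z::complex) \<le> 1" "z \<noteq> 1"
  shows "1 - z \<notin> \<real>\<^sub>\<le>\<^sub>0"
proof
  assume "1 - z \<in> \<real>\<^sub>\<le>\<^sub>0"
  hence "Re z \<ge> 1" "Im z = 0" by (auto simp: complex_nonpos_Reals_iff)
  moreover have "\<bar>Re z\<bar> \<le> 1" using abs_Re_le_cmod[of z] assms(1) by linarith
  ultimately show False using assms(2) by (auto simp: complex_eq_iff)
qed

text \<open>\<open>M\<close> may be any logarithm of a constant multiple of \<open>z\<close>; below it is a real logarithm on some
  paths and a branch of \<open>ln z\<close> on others.\<close>

lemma trilog_path_deriv: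
  fixes z M :: "complex \<Rightarrow> complex"
  assumes z: "(z has_field_derivative z') (at t)"
    and M: "(M has_field_derivative z' / z t) (at t)"
    and "z t \<noteq> 0" "norm (z t) < 1"
  shows "((\<lambda>t. polylog 3 (z t) - M t * polylog 2 (z t) - (M t)\<^sup>2 * Ln (1 - z t) / 2)
          has_field_derivative (M t)\<^sup>2 * z' / (1 - z t) / 2) (at t)"
proof -
  have n1: "1 - z t \<notin> \<real>\<^sub>\<le>\<^sub>0" using assms by (intro one_minus_notin_nonpos_Reals) auto
  have "1 - z t \<noteq> 0" using n1 by auto
  have "((\<lambda>t. polylog 3 (z t) - M t * polylog 2 (z t) - (M t)\<^sup>2 * Ln (1 - z t) / 2)
      has_field_derivative
        (polylog 2 (z t) / z t * z' - (z' / z t * polylog 2 (z t) + (- Ln (1 - z t) / z t * z') * M t)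
        - (2 * M t * (z' / z t) * Ln (1 - z t) + (- z') / (1 - z t) * (M t)\<^sup>2) / 2)) (at t)"
  proof (intro DERIV_diff DERIV_mult DERIV_cdivide)
    show "((\<lambda>t. polylog 3 (z t)) has_field_derivative polylog 2 (z t) / z t * z') (at t)"
      by (rule polylog_deriv_chain assms)+
    show "((\<lambda>t. polylog 2 (z t)) has_field_derivative - Ln (1 - z t) / z t * z') (at t)"
      by (rule polylog_deriv_chain assms)+
    show "((\<lambda>t. (M t)\<^sup>2) has_field_derivative 2 * M t * (z' / z t)) (at t)"
      by (rule derivative_eq_intros M refl)+ simp
    show "((\<lambda>t. Ln (1 - z t)) has_field_derivative (- z') / (1 - z t)) (at t)"
      by (rule derivative_eq_intros z refl n1)+ (simp add: field_simps)
  qed (fact M)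
  \<comment> \<open>The two \<open>polylog 2\<close> terms cancel, and so do the two terms in
    \<open>M t * Ln (1 - z t)\<close>; only the derivative of the last logarithm survives.\<close>
  thus ?thesis
    by (rule DERIV_cong) (use \<open>1 - z t \<noteq> 0\<close> \<open>z t \<noteq> 0\<close> in \<open>simp add: field_simps power2_eq_square\<close>)
qed

text \<open>Several primitives below are singular expressions at their left endpoint only;
  continuity there is reduced to a one-sided limit.\<close>

lemma continuous_on_Icc_left:
  fixes f :: "real \<Rightarrow> 'a::topological_space"
  assumes "a < b" "continuous_on {a<..b} f" "(f \<longlongrightarrow> f a) (at_right a)"
  shows "continuous_on {a..b} f"
  unfolding continuous_on_def
proof
  fix x assume x: "x \<in> {a..b}"
  show "(f \<longlongrightarrow> f x) (at x within {a..b})"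
  proof (cases "x = a")
    case True
    thus ?thesis using assms by (simp add: at_within_Icc_at_right)
  next
    case False
    have "at x within {a..b} = at x within {a<..b}"
      using x False by (intro at_within_nhd[of _ "{a<..}"]) auto
    moreover have "(f \<longlongrightarrow> f x) (at x within {a<..b})"
      using assms(2) x False by (auto simp: continuous_on_def)
    ultimately show ?thesis by simp
  qed
qed

lemma Ln_eq_Complex_arctan:
  assumes "Re z > 0"
  shows "Ln z = Complex (ln (norm z)) (arctan (Im z / Re z))"
proof -
  have "z \<noteq> 0" using assms by auto
  thus ?thesis
    using Arg_eq_Im_Ln[of z] arg_conv_arctan[OF assms] by (simp add: complex_eq_iff)
qed

lemma norm_Ln_le_abs_ln: "z \<noteq> 0 \<Longrightarrow> norm (Ln z) \<le> \<bar>ln (norm z)\<bar> + pi"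
  using cmod_le[of "Ln z"] mpi_less_Im_Ln[of z] Im_Ln_le_pi[of z] by simp

lemma norm_Ln_one_minus_le:
  assumes "norm z < 1 / 2"
  shows "norm (Ln (1 - z)) \<le> 2 * norm z"
  using norm_Ln_le[of "-z"] assms by simp

text \<open>At 0 the polylogarithm decays linearly, so this boundary term of the primitives vanishes
  in spite of the logarithm.\<close>

lemma Ln_mult_polylog_tendsto_0:
  assumes "norm \<rho> \<le> 1"
  shows "((\<lambda>x. Ln (of_real x) * polylog 2 (\<rho> * of_real x)) \<longlongrightarrow> 0) (at_right 0)"
proof (rule Lim_null_comparison)
  show "((\<lambda>x. \<bar>ln x\<bar> * (x * (pi\<^sup>2 / 6))) \<longlongrightarrow> 0) (at_right 0)" by real_asymp
  have "eventually (\<lambda>x. x \<in> {0<..<1::real}) (at_right 0)"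
    by (intro eventually_at_right_real) auto
  thus "\<forall>\<^sub>F x in at_right 0. norm (Ln (of_real x) * polylog 2 (\<rho> * of_real x)) \<le> \<bar>ln x\<bar> * (x * (pi\<^sup>2 / 6))"
  proof eventually_elim
    case (elim x)
    have "norm (\<rho> * of_real x) \<le> x" using elim assms by (simp add: norm_mult mult_left_le_one_le)
    moreover from this have "norm (polylog 2 (\<rho> * of_real x)) \<le> norm (\<rho> * of_real x) * (pi\<^sup>2 / 6)"
      using elim by (intro norm_polylog_le) auto
    ultimately have "norm (polylog 2 (\<rho> * of_real x)) \<le> x * (pi\<^sup>2 / 6)"
      by (meson mult_right_mono order_trans zero_le_divide_iff zero_le_numeral zero_le_power2)
    thus ?case using elim by (simp add: norm_mult Ln_of_real mult_left_mono)
  qed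
qed

lemma Ln_power_mult_Ln_tendsto_0:
  assumes "norm \<rho> \<le> 1"
  shows "((\<lambda>x. Ln (of_real x) ^ k * Ln (1 - \<rho> * of_real x)) \<longlongrightarrow> 0) (at_right 0)"
proof (rule Lim_null_comparison)
  show "((\<lambda>x::real. \<bar>ln x\<bar> ^ k * (2 * x)) \<longlongrightarrow> 0) (at_right 0)" by real_asymp
  have "eventually (\<lambda>x. x \<in> {0<..<1/2::real}) (at_right 0)"
    by (intro eventually_at_right_real) auto
  thus "\<forall>\<^sub>F x in at_right 0. norm (Ln (of_real x) ^ k * Ln (1 - \<rho> * of_real x)) \<le> \<bar>ln x\<bar> ^ k * (2 * x)"
  proof eventually_elim
    case (elim x)
    have "norm (\<rho> * of_real x) \<le> x" using elim assms by (simp add: norm_mult mult_left_le_one_le)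
    moreover from this have "norm (Ln (1 - \<rho> * of_real x)) \<le> 2 * norm (\<rho> * of_real x)"
      using elim by (intro norm_Ln_one_minus_le) auto
    ultimately have "norm (Ln (1 - \<rho> * of_real x)) \<le> 2 * x" by linarith
    thus ?case using elim by (simp add: norm_mult norm_power Ln_of_real mult_left_mono)
  qed
qed

lemma mult_of_real_norm_less_1:
  assumes "norm (\<rho>::complex) \<le> 1" "x \<in> {0<..<1::real}"
  shows "norm (\<rho> * of_real x) < 1"
proof -
  have "norm \<rho> * x \<le> x" using assms by (intro mult_left_le_one_le) auto
  hence "norm \<rho> * x < 1" using assms(2) unfolding greaterThanLessThan_iff by linarith
  thus ?thesis using assms by (simp add: norm_mult)
qed

lemma one_minus_mult_notin_nonpos_Reals:
  assumes "norm (\<rho>::complex) \<le> 1" "\<rho> \<noteq> 1" "x \<in> {0..1::real}"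
  shows "1 - \<rho> * of_real x \<notin> \<real>\<^sub>\<le>\<^sub>0"
proof (rule one_minus_notin_nonpos_Reals)
  show "norm (\<rho> * of_real x) \<le> 1" using assms by (simp add: norm_mult mult_le_one)
  show "\<rho> * of_real x \<noteq> 1"
  proof (cases "x = 1")
    case False
    hence "norm (\<rho> * of_real x) < 1" using assms
      by (cases "x = 0") (auto intro!: mult_of_real_norm_less_1)
    thus ?thesis by auto
  qed (use assms in auto)
qed

lemma norm_mult_of_real_le_1:
  "norm (\<rho>::complex) \<le> 1 \<Longrightarrow> 0 \<le> x \<Longrightarrow> x \<le> 1 \<Longrightarrow> norm (\<rho> * of_real x) \<le> 1"
  by (simp add: norm_mult mult_le_one)

text \<open>The path is the segment from 0 to \<rho>, with \<open>M t = Ln t\<close>. This is real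
  on the path and vanishes at \<open>t = 1\<close>, so only \<open>polylog 3\<close> survives at the
  upper end.\<close>

lemma has_integral_ln_power2_polylog:
  assumes \<rho>: "norm \<rho> \<le> 1" "\<rho> \<noteq> 1" "\<rho> \<noteq> 0"
  shows "((\<lambda>x. of_real ((ln x)\<^sup>2) * \<rho> / (1 - \<rho> * of_real x)) has_integral 2 * polylog 3 \<rho>) {0..1}"
proof -
  define \<Phi> where "\<Phi> t = polylog 3 (\<rho> * t) - Ln t * polylog 2 (\<rho> * t) - (Ln t)\<^sup>2 * Ln (1 - \<rho> * t) / 2" for t
  have 1: "((\<lambda>x. \<Phi> (of_real x)) has_vector_derivative of_real ((ln x)\<^sup>2) * \<rho> / (1 - \<rho> * of_real x) / 2) (at x)"
    if "x \<in> {0<..<1}" for x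
  proof -
    have "(\<Phi> has_field_derivative (Ln (of_real x))\<^sup>2 * \<rho> / (1 - \<rho> * of_real x) / 2) (at (of_real x))"
      unfolding \<Phi>_def
    proof (rule trilog_path_deriv)
      show "((*) \<rho> has_field_derivative \<rho>) (at (complex_of_real x))"
        by (rule derivative_eq_intros refl)+ simp
      show "(Ln has_field_derivative \<rho> / (\<rho> * of_real x)) (at (of_real x))"
        using that \<rho> by (auto intro!: derivative_eq_intros simp: field_simps)
    qed (use that \<rho> mult_of_real_norm_less_1 in auto)
    from has_vector_derivative_real_field[OF this] show ?thesis
      using that by (simp add: Ln_of_real)
  qed
  have 2: "continuous_on {0..1} (\<lambda>x. \<Phi> (of_real x))"
  proof (rule continuous_on_Icc_left)
    show "continuous_on {0<..1} (\<lambda>x. \<Phi> (of_real x))"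
      unfolding \<Phi>_def
      by (intro continuous_intros norm_mult_of_real_le_1 one_minus_mult_notin_nonpos_Reals)
        (use \<rho> in \<open>auto\<close>)
    have "continuous_on {0..1::real} (\<lambda>x. polylog 3 (\<rho> * of_real x))"
      using \<rho> by (intro continuous_intros norm_mult_of_real_le_1) auto
    hence "((\<lambda>x. polylog 3 (\<rho> * of_real x)) \<longlongrightarrow> polylog 3 (\<rho> * of_real 0)) (at_right 0)"
      unfolding continuous_on_def using at_within_Icc_at_right[of 0 "1::real"] by force
    from tendsto_diff[OF tendsto_diff[OF this Ln_mult_polylog_tendsto_0[OF \<rho>(1)]]
        tendsto_divide[OF Ln_power_mult_Ln_tendsto_0[OF \<rho>(1), of 2] tendsto_const[of 2]]]
    show "((\<lambda>x. \<Phi> (of_real x)) \<longlongrightarrow> \<Phi> (of_real 0)) (at_right 0)"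
      by (simp add: \<Phi>_def)
  qed auto
  have "((\<lambda>x. of_real ((ln x)\<^sup>2) * \<rho> / (1 - \<rho> * of_real x) / 2) has_integral \<Phi> (of_real 1) - \<Phi> (of_real 0)) {0..1}"
    by (intro fundamental_theorem_of_calculus_interior 1 2) auto
  note has_integral_mult_right[OF this, of 2]
  moreover have "2 * (y / 2) = y" for y :: complex by simp
  ultimately show ?thesis by (simp only:) (simp add: \<Phi>_def)
qed

lemma has_integral_ln_polylog:
  assumes \<rho>: "norm \<rho> \<le> 1" "\<rho> \<noteq> 1" "\<rho> \<noteq> 0"
  shows "((\<lambda>x. of_real (ln x) * \<rho> / (1 - \<rho> * of_real x)) has_integral - polylog 2 \<rho>) {0..1}"
proof -
  \<comment> \<open>The exponent 1 is written out to match \<open>Ln_power_mult_Ln_tendsto_0\<close>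
    at \<open>k = 1\<close>.\<close>
  define \<Phi> where "\<Phi> t = - polylog 2 (\<rho> * t) - Ln t ^ 1 * Ln (1 - \<rho> * t)" for t
  have 1: "((\<lambda>x. \<Phi> (of_real x)) has_vector_derivative of_real (ln x) * \<rho> / (1 - \<rho> * of_real x)) (at x)"
    if "x \<in> {0<..<1}" for x
  proof -
    have nz: "1 - \<rho> * of_real x \<notin> \<real>\<^sub>\<le>\<^sub>0"
      using that \<rho> by (intro one_minus_mult_notin_nonpos_Reals) auto
    hence nz': "1 - \<rho> * of_real x \<noteq> 0" by auto
    have "(\<Phi> has_field_derivative
        - (- Ln (1 - \<rho> * of_real x) / (\<rho> * of_real x) * \<rho>)
        - (1 / of_real x * Ln (1 - \<rho> * of_real x) + - \<rho> / (1 - \<rho> * of_real x) * Ln (of_real x))) (at (of_real x))"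
      unfolding \<Phi>_def power_one_right
    proof (intro DERIV_diff DERIV_minus DERIV_mult)
      show "((\<lambda>t. polylog 2 (\<rho> * t)) has_field_derivative - Ln (1 - \<rho> * of_real x) / (\<rho> * of_real x) * \<rho>) (at (of_real x))"
        by (rule polylog_deriv_chain)
          (use \<rho> that mult_of_real_norm_less_1 in \<open>auto intro!: derivative_eq_intros\<close>)
      show "(Ln has_field_derivative 1 / of_real x) (at (of_real x))"
        using that by (auto intro!: derivative_eq_intros simp: field_simps)
      show "((\<lambda>t. Ln (1 - \<rho> * t)) has_field_derivative - \<rho> / (1 - \<rho> * of_real x)) (at (of_real x))"
        by (rule derivative_eq_intros refl nz)+ (simp add: field_simps)
    qed
    hence "(\<Phi> has_field_derivative of_real (ln x) * \<rho> / (1 - \<rho> * of_real x)) (at (of_real x))"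
      by (rule DERIV_cong) (use that \<rho> nz' in \<open>simp add: Ln_of_real field_simps\<close>)
    from has_vector_derivative_real_field[OF this] show ?thesis .
  qed
  have 2: "continuous_on {0..1} (\<lambda>x. \<Phi> (of_real x))"
  proof (rule continuous_on_Icc_left)
    show "continuous_on {0<..1} (\<lambda>x. \<Phi> (of_real x))"
      unfolding \<Phi>_def
      by (intro continuous_intros norm_mult_of_real_le_1 one_minus_mult_notin_nonpos_Reals)
        (use \<rho> in \<open>auto\<close>)
    have "continuous_on {0..1::real} (\<lambda>x. polylog 2 (\<rho> * of_real x))"
      using \<rho> by (intro continuous_intros norm_mult_of_real_le_1) auto
    hence "((\<lambda>x. polylog 2 (\<rho> * of_real x)) \<longlongrightarrow> polylog 2 (\<rho> * of_real 0)) (at_right 0)"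
      unfolding continuous_on_def using at_within_Icc_at_right[of 0 "1::real"] by force
    from tendsto_diff[OF tendsto_minus[OF this] Ln_power_mult_Ln_tendsto_0[OF \<rho>(1), of 1]]
    show "((\<lambda>x. \<Phi> (of_real x)) \<longlongrightarrow> \<Phi> (of_real 0)) (at_right 0)"
      by (simp add: \<Phi>_def)
  qed auto
  have "((\<lambda>x. of_real (ln x) * \<rho> / (1 - \<rho> * of_real x)) has_integral \<Phi> (of_real 1) - \<Phi> (of_real 0)) {0..1}"
    by (intro fundamental_theorem_of_calculus_interior 1 2) auto
  thus ?thesis
    by (simp add: \<Phi>_def polylog_def)
qed

lemma polylog_2_1: "polylog 2 1 = of_real (pi\<^sup>2 / 6)"
proof -
  have "(\<lambda>n. complex_of_real (1 / (real n + 1)\<^sup>2)) sums of_real (pi\<^sup>2 / 6)"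
    using inverse_squares_sums_real by (rule sums_of_real)
  thus ?thesis by (simp add: polylog_def sums_iff add.commute)
qed

text \<open>Euler's reflection formula. The left side has derivative 0 along the segment from 0 to
  \<open>w\<close>, and its constant value is the limit \<open>polylog 2 1\<close> at 0. The two
  norm bounds keep both series convergent on that segment.\<close>

lemma polylog_2_reflection:
  assumes "norm w < 1" "norm (1 - w) < 1"
  shows "polylog 2 w + polylog 2 (1 - w) + Ln w * Ln (1 - w) = of_real (pi\<^sup>2 / 6)"
proof -
  define H where "H t = polylog 2 (w * t) + polylog 2 (1 - w * t) + Ln (w * t) * Ln (1 - w * t)" for t
  have w: "Re w > 0" "w \<noteq> 0" "w \<noteq> 1"
    using abs_Re_le_cmod[of "1 - w"] assms by auto
  have 0: "norm (1 - w * of_real t) < 1" if "t \<in> {0<..1}" for t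
  proof -
    \<comment> \<open>\<open>1 - w t\<close> is a convex combination of 1 and \<open>1 - w\<close>,
      so it stays inside the disc for \<open>t > 0\<close>.\<close>
    have "norm (1 - w * of_real t) = norm (of_real (1 - t) + of_real t * (1 - w))"
      by (simp add: algebra_simps)
    also have "\<dots> \<le> (1 - t) + t * norm (1 - w)"
      using norm_triangle_ineq[of "of_real (1 - t)" "of_real t * (1 - w)"] that
      by (simp add: norm_mult flip: of_real_diff del: of_real_diff)
    also have "\<dots> < 1"
      using that assms mult_strict_left_mono[of "norm (1 - w)" 1 t] by auto
    finally show ?thesis .
  qed
  have nr: "w * of_real t \<notin> \<real>\<^sub>\<le>\<^sub>0" if "t \<in> {0<..1}" for t
    using that w by (auto simp: complex_nonpos_Reals_iff mult_le_0_iff)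
  have nr2: "1 - w * of_real t \<notin> \<real>\<^sub>\<le>\<^sub>0" if "t \<in> {0..1}" for t
    using that w assms by (intro one_minus_mult_notin_nonpos_Reals) auto
  have 1: "((\<lambda>x. H (of_real x)) has_vector_derivative 0) (at x)" if x: "x \<in> {0<..<1}" for x
  proof -
    let ?z = "w * of_real x"
    have nz: "?z \<noteq> 0" "1 - ?z \<noteq> 0" using nr[of x] nr2[of x] x by auto
    have d: "((*) w has_field_derivative w) (at (of_real x))"
      by (rule derivative_eq_intros refl)+ simp
    have d': "((\<lambda>t. 1 - w * t) has_field_derivative - w) (at (of_real x))"
      by (rule derivative_eq_intros refl)+ simp
    have "(H has_field_derivative (- Ln (1 - ?z) / ?z * w + (- Ln (1 - (1 - ?z)) / (1 - ?z)) * (- w)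
        + (inverse ?z * w * Ln (1 - ?z) + inverse (1 - ?z) * (- w) * Ln ?z))) (at (of_real x))"
      unfolding H_def
      by (intro DERIV_add DERIV_mult polylog_deriv_chain(1)[OF _ _ d] polylog_deriv_chain(1)[OF _ _ d']
          DERIV_chain2[OF has_field_derivative_Ln d] DERIV_chain2[OF has_field_derivative_Ln d'])
        (use x nz nr[of x] nr2[of x] 0[of x] assms mult_of_real_norm_less_1[of w x] in auto)
    hence "(H has_field_derivative 0) (at (of_real x))"
      by (rule DERIV_cong) (use nz in \<open>simp add: field_simps\<close>)
    from has_vector_derivative_real_field[OF this] show ?thesis .
  qed
  have 2: "continuous_on {0..1} (\<lambda>x. H (of_real x))"
  proof (rule continuous_on_Icc_left)
    show "continuous_on {0<..1} (\<lambda>x. H (of_real x))"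
      unfolding H_def
      by (intro continuous_intros norm_mult_of_real_le_1 nr nr2 less_imp_le[OF 0])
        (use assms in auto)
    have "continuous_on {0..1::real} (\<lambda>x. polylog 2 (w * of_real x) + polylog 2 (1 - w * of_real x))"
    proof (intro continuous_intros norm_mult_of_real_le_1)
      show "norm (1 - w * of_real t) \<le> 1" if "t \<in> {0..1}" for t
        using 0[of t] that by (cases "t = 0") auto
    qed (use assms in auto)
    hence "((\<lambda>x. polylog 2 (w * of_real x) + polylog 2 (1 - w * of_real x)) \<longlongrightarrow>
       polylog 2 (w * of_real 0) + polylog 2 (1 - w * of_real 0)) (at_right 0)"
      unfolding continuous_on_def using at_within_Icc_at_right[of 0 "1::real"] by force
    moreover have "((\<lambda>x. Ln (w * of_real x) * Ln (1 - w * of_real x)) \<longlongrightarrow> 0) (at_right 0)"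
    proof (rule Lim_null_comparison)
      have "norm w > 0" using w by simp
      thus "((\<lambda>x. (\<bar>ln (norm w * x)\<bar> + pi) * (2 * x)) \<longlongrightarrow> 0) (at_right 0)" by real_asymp
      have "eventually (\<lambda>x. x \<in> {0<..<1/2::real}) (at_right 0)"
        by (intro eventually_at_right_real) auto
      thus "\<forall>\<^sub>F x in at_right 0. norm (Ln (w * of_real x) * Ln (1 - w * of_real x)) \<le> (\<bar>ln (norm w * x)\<bar> + pi) * (2 * x)"
      proof eventually_elim
        case (elim x)
        have n: "norm (w * of_real x) \<le> x" using elim assms by (simp add: norm_mult mult_left_le_one_le)
        with elim have "norm (Ln (1 - w * of_real x)) \<le> 2 * norm (w * of_real x)"
          by (intro norm_Ln_one_minus_le) auto
        with n have "norm (Ln (1 - w * of_real x)) \<le> 2 * x" by linarith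
        moreover have "norm (Ln (w * of_real x)) \<le> \<bar>ln (norm w * x)\<bar> + pi"
          using norm_Ln_le_abs_ln[of "w * of_real x"] elim w by (simp add: norm_mult)
        ultimately show ?case unfolding norm_mult by (intro mult_mono) auto
      qed
    qed
    ultimately show "((\<lambda>x. H (of_real x)) \<longlongrightarrow> H (of_real 0)) (at_right 0)"
      unfolding H_def by (rule tendsto_add[THEN tendsto_eq_rhs]) simp
  qed auto
  have "((\<lambda>x. 0) has_integral H (of_real 1) - H (of_real 0)) {0..1::real}"
    by (intro fundamental_theorem_of_calculus_interior 1 2) auto
  hence "H (of_real 1) = H (of_real 0)" by (simp add: has_integral_0_eq)
  thus ?thesis by (simp add: H_def polylog_2_1)
qed

section \<open>Values at the imaginary unit\<close>

lemma Im_polylog_i_sums: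
  assumes "s \<ge> 2"
  shows "(\<lambda>m. (-1) ^ m / (2 * real m + 1) ^ s) sums Im (polylog s \<i>)"
proof -
  have im: "Im (w / of_nat m ^ s) = Im w / real m ^ s" for w m
    using Im_divide_of_real[of w "real m ^ s"] by simp
  have "(\<lambda>n. Im (\<i> ^ Suc n / of_nat (Suc n) ^ s)) sums Im (polylog s \<i>)"
    using polylog_sums[of \<i> s] assms by (simp add: sums_complex_iff)
  hence "(\<lambda>n. Im (\<i> ^ Suc n) / real (Suc n) ^ s) sums Im (polylog s \<i>)"
    by (simp only: im)
  moreover have "Im (\<i> ^ Suc n) = 0" if "n \<notin> range (\<lambda>m. 2 * m)" for n
  proof -
    have "odd n" using that by (auto elim!: evenE)
    then obtain k where "Suc n = 2 * k" by (metis even_Suc evenE)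
    hence "\<i> ^ Suc n = of_real ((-1) ^ k)" by (simp add: power_mult del: power_Suc)
    thus ?thesis by (simp del: power_Suc)
  qed
  ultimately have "(\<lambda>m. Im (\<i> ^ Suc (2 * m)) / real (Suc (2 * m)) ^ s) sums Im (polylog s \<i>)"
    by (subst sums_mono_reindex[of "\<lambda>m. 2 * m", symmetric, symmetric])
      (auto simp: strict_mono_def simp del: power_Suc of_nat_Suc)
  moreover have "Im (\<i> ^ Suc (2 * m)) = (-1) ^ m" for m
  proof -
    have "\<i> ^ Suc (2 * m) = \<i> * of_real ((-1) ^ m)" by (simp add: power_mult)
    thus ?thesis by (simp del: power_Suc)
  qed
  ultimately show ?thesis by (simp add: add.commute del: power_Suc)
qed

lemma catalan_eq_Im_polylog: "catalan_constant = Im (polylog 2 \<i>)"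
  using Im_polylog_i_sums[of 2]
  by (simp add: catalan_constant_def sums_iff algebra_simps)

text \<open>The Dirichlet beta value at 3. Pairing consecutive terms gives sums over
  \<open>k + 1/4\<close> and \<open>k + 3/4\<close>, that is, \<open>Polygamma 2\<close> at two
  points symmetric about 1/2. Their difference comes from differentiating the logarithm of the
  reflection formula of Gamma three times.\<close>

lemma Im_polylog_3_i: "Im (polylog 3 \<i>) = pi ^ 3 / 32"
proof -
  have lg: "ln_Gamma x + ln_Gamma (1 - x) = ln pi - ln (sin (pi * x))" if "x \<in> {0<..<1}" for x :: real
  proof -
    have s: "sin (pi * x) > 0" using that by (intro sin_gt_zero) auto
    have "complex_of_real (Gamma x * Gamma (1 - x)) = Gamma (of_real x) * Gamma (1 - of_real x)"
      using Gamma_complex_of_real[of x] Gamma_complex_of_real[of "1 - x"] by simp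
    also have "\<dots> = of_real pi / sin (of_real pi * of_real x)"
      by (rule Gamma_reflection_complex)
    also have "\<dots> = of_real (pi / sin (pi * x))"
      using sin_of_real[of "pi * x", where 'a = complex] by simp
    finally have "complex_of_real (Gamma x * Gamma (1 - x)) = of_real (pi / sin (pi * x))" .
    hence "Gamma x * Gamma (1 - x) = pi / sin (pi * x)" by (simp only: of_real_eq_iff)
    hence "ln (Gamma x * Gamma (1 - x)) = ln (pi / sin (pi * x))" by simp
    moreover have "Gamma x > 0" "Gamma (1 - x) > 0" using that by (auto intro: Gamma_real_pos)
    ultimately show ?thesis using that s
      by (simp add: ln_mult ln_div ln_Gamma_real_pos)
  qed
  have ev: "eventually (\<lambda>x. x \<in> {0<..<1}) (nhds x)" if "x \<in> {0<..<1}" for x :: real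
    using that by (intro eventually_nhds_in_open) auto
  have nonint: "x \<notin> \<int>\<^sub>\<le>\<^sub>0" if "x > 0" for x :: real
    using that by (auto elim!: nonpos_Ints_cases)
  have s: "sin (pi * x) > 0" if "x \<in> {0<..<1}" for x using that by (intro sin_gt_zero) auto
  have 0: "Digamma x - Digamma (1 - x) = - pi * cos (pi * x) / sin (pi * x)" if x: "x \<in> {0<..<1}" for x :: real
  proof (rule DERIV_unique)
    show "((\<lambda>x. ln_Gamma x + ln_Gamma (1 - x)) has_field_derivative Digamma x - Digamma (1 - x)) (at x)"
      using x by (auto intro!: derivative_eq_intros)
    have "((\<lambda>x. ln pi - ln (sin (pi * x))) has_field_derivative - pi * cos (pi * x) / sin (pi * x)) (at x)"
      using s[OF x] by (auto intro!: derivative_eq_intros simp: field_simps)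
    thus "((\<lambda>x. ln_Gamma x + ln_Gamma (1 - x)) has_field_derivative - pi * cos (pi * x) / sin (pi * x)) (at x)"
      by (subst DERIV_cong_ev[OF refl eventually_mono[OF ev[OF x] lg] refl])
  qed
  have 1: "Polygamma 1 x + Polygamma 1 (1 - x) = pi\<^sup>2 / (sin (pi * x))\<^sup>2" if x: "x \<in> {0<..<1}" for x :: real
  proof (rule DERIV_unique)
    show "((\<lambda>x. Digamma x - Digamma (1 - x)) has_field_derivative Polygamma 1 x + Polygamma 1 (1 - x)) (at x)"
      using x by (auto intro!: derivative_eq_intros nonint)
    have "((\<lambda>x. - pi * cos (pi * x) / sin (pi * x)) has_field_derivative
        ((- pi * (- sin (pi * x) * pi)) * sin (pi * x) - (- pi * cos (pi * x)) * (cos (pi * x) * pi))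
          / (sin (pi * x) * sin (pi * x))) (at x)"
      using s[OF x] by (auto intro!: derivative_eq_intros simp: field_simps)
    moreover have "(- pi * (- sin (pi * x) * pi)) * sin (pi * x) - (- pi * cos (pi * x)) * (cos (pi * x) * pi)
      = pi\<^sup>2 * ((sin (pi * x))\<^sup>2 + (cos (pi * x))\<^sup>2)" by algebra
    ultimately have "((\<lambda>x. - pi * cos (pi * x) / sin (pi * x)) has_field_derivative pi\<^sup>2 / (sin (pi * x))\<^sup>2) (at x)"
      unfolding sin_cos_squared_add by (simp add: power2_eq_square)
    thus "((\<lambda>x. Digamma x - Digamma (1 - x)) has_field_derivative pi\<^sup>2 / (sin (pi * x))\<^sup>2) (at x)"
      by (subst DERIV_cong_ev[OF refl eventually_mono[OF ev[OF x] 0] refl])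
  qed
  have 2: "Polygamma 2 x - Polygamma 2 (1 - x) = - 2 * pi ^ 3 * cos (pi * x) / sin (pi * x) ^ 3"
    if x: "x \<in> {0<..<1}" for x :: real
  proof (rule DERIV_unique)
    show "((\<lambda>x. Polygamma 1 x + Polygamma 1 (1 - x)) has_field_derivative Polygamma 2 x - Polygamma 2 (1 - x)) (at x)"
      using x by (auto intro!: derivative_eq_intros nonint simp: eval_nat_numeral)
    have "((\<lambda>x. pi\<^sup>2 / (sin (pi * x))\<^sup>2) has_field_derivative - 2 * pi ^ 3 * cos (pi * x) / sin (pi * x) ^ 3) (at x)"
      using s[OF x] by (auto intro!: derivative_eq_intros simp: field_simps eval_nat_numeral)
    thus "((\<lambda>x. Polygamma 1 x + Polygamma 1 (1 - x)) has_field_derivative - 2 * pi ^ 3 * cos (pi * x) / sin (pi * x) ^ 3) (at x)"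
      by (subst DERIV_cong_ev[OF refl eventually_mono[OF ev[OF x] 1] refl])
  qed
  \<comment> \<open>At \<open>x = 1/4\<close> the quotient of the cosine by the cubed sine is
    2.\<close>
  have "sqrt 2 ^ 3 = 2 * sqrt 2" by (simp add: eval_nat_numeral)
  hence P: "Polygamma 2 (1 / 4) - Polygamma 2 (3 / 4) = - 4 * pi ^ 3"
    using 2[of "1 / 4"] by (simp add: cos_45 sin_45 power_divide)
  have "(\<lambda>k. inverse ((1 / 4 + real k) ^ 3)) sums (- Polygamma 2 (1 / 4) / 2)"
       "(\<lambda>k. inverse ((3 / 4 + real k) ^ 3)) sums (- Polygamma 2 (3 / 4) / 2)"
    using Polygamma_LIMSEQ[of "1 / 4 :: real" 2] Polygamma_LIMSEQ[of "3 / 4 :: real" 2]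
    by (simp_all add: eval_nat_numeral)
  note sums_diff[OF this]
  also have "- Polygamma 2 (1 / 4) / 2 - - Polygamma 2 (3 / 4) / 2 = 2 * pi ^ 3"
    using P by (simp add: field_simps)
  finally have "(\<lambda>k. inverse ((1 / 4 + real k) ^ 3) - inverse ((3 / 4 + real k) ^ 3)) sums (2 * pi ^ 3)" .
  from sums_mult[OF this, of "1 / 64"]
  have A: "(\<lambda>k. 1 / 64 * (inverse ((1 / 4 + real k) ^ 3) - inverse ((3 / 4 + real k) ^ 3))) sums (pi ^ 3 / 32)"
    by simp
  have scale: "1 / (4 * a) ^ 3 - 1 / (4 * b) ^ 3 = 1 / 64 * (inverse (a ^ 3) - inverse (b ^ 3))" for a b :: real
    by (simp only: power_mult_distrib divide_inverse inverse_mult_distrib mult_1 right_diff_distrib) simp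
  have "(\<lambda>k. \<Sum>m = k * 2..<k * 2 + 2. (-1) ^ m / (2 * real m + 1) ^ 3) sums Im (polylog 3 \<i>)"
    by (intro sums_group Im_polylog_i_sums) auto
  also have "(\<lambda>k. \<Sum>m = k * 2..<k * 2 + 2. (-1) ^ m / (2 * real m + 1) ^ 3) =
     (\<lambda>k. 1 / 64 * (inverse ((1 / 4 + real k) ^ 3) - inverse ((3 / 4 + real k) ^ 3)))"
  proof
    fix k :: nat
    have "{k * 2..<k * 2 + 2} = {k * 2, k * 2 + 1}" by auto
    hence "(\<Sum>m = k * 2..<k * 2 + 2. (-1) ^ m / (2 * real m + 1) ^ 3) =
        1 / (4 * real k + 1) ^ 3 - 1 / (4 * real k + 3) ^ 3"
      by (simp add: algebra_simps)
    also have "4 * real k + 1 = 4 * (1 / 4 + real k)" by simp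
    also have "4 * real k + 3 = 4 * (3 / 4 + real k)" by simp
    also have "1 / (4 * (1 / 4 + real k)) ^ 3 - 1 / (4 * (3 / 4 + real k)) ^ 3 =
        1 / 64 * (inverse ((1 / 4 + real k) ^ 3) - inverse ((3 / 4 + real k) ^ 3))"
      by (rule scale)
    finally show "(\<Sum>m = k * 2..<k * 2 + 2. (-1) ^ m / (2 * real m + 1) ^ 3) =
      1 / 64 * (inverse ((1 / 4 + real k) ^ 3) - inverse ((3 / 4 + real k) ^ 3))" .
  qed
  finally show ?thesis using A sums_unique2 by blast
qed


subsection \<open>Special values and two logarithmic integrals\<close>

lemma polylog_cnj:
  assumes "norm z \<le> 1" "s \<ge> 2"
  shows "polylog s (cnj z) = cnj (polylog s z)"
proof -
  have "(\<lambda>n. cnj (z ^ Suc n / of_nat (Suc n) ^ s)) sums cnj (polylog s z)"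
    using polylog_sums[OF assms] by (simp only: sums_cnj)
  moreover have "(\<lambda>n. (cnj z) ^ Suc n / of_nat (Suc n) ^ s) sums polylog s (cnj z)"
    using assms by (intro polylog_sums) auto
  ultimately show ?thesis by (simp add: sums_iff)
qed

text \<open>1/2 is the fixed point of the reflection.\<close>

lemma polylog_2_half: "polylog 2 (1 / 2) = of_real (pi\<^sup>2 / 12 - (ln 2)\<^sup>2 / 2)"
proof -
  have "Ln (1 / 2) = of_real (- ln 2)"
    using Ln_of_real[of "1 / 2"] by (simp add: ln_div)
  with polylog_2_reflection[of "1 / 2"] show ?thesis
    by (simp add: power2_eq_square) (simp add: complex_eq_iff)
qed

lemma norm_one_plus_i: "norm (1 + \<i>) = sqrt 2"
  by (simp add: cmod_def)

lemma norm_one_plus_i_mult: "norm (1 + \<i> * of_real x) = sqrt (1 + x\<^sup>2)"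
  by (simp add: cmod_def)

lemma ln_sqrt_2: "ln (sqrt 2) = ln 2 / 2"
  by (simp add: ln_sqrt)

lemma Ln_one_plus_i: "Ln (1 + \<i>) = Complex (ln 2 / 2) (pi / 4)"
  by (subst Ln_eq_Complex_arctan) (simp_all add: norm_one_plus_i ln_sqrt_2)

lemma Ln_half_one_plus_i: "Ln ((1 + \<i>) / 2) = Complex (- ln 2 / 2) (pi / 4)"
  by (subst Ln_eq_Complex_arctan) (simp_all add: norm_divide norm_one_plus_i ln_sqrt_2 ln_div)

text \<open>At this point \<open>1 - z = cnj z\<close>, so the reflection formula reads: twice the
  real part plus \<open>norm (Ln z) ^ 2\<close> equals \<open>pi^2 / 6\<close>.\<close>

lemma Re_polylog_2_half_one_plus_i:
  "Re (polylog 2 ((1 + \<i>) / 2)) = 5 * pi\<^sup>2 / 96 - (ln 2)\<^sup>2 / 8"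
proof -
  let ?z = "(1 + \<i>) / 2"
  have n: "norm ?z < 1"
    using real_sqrt_less_mono[of 2 4] by (simp add: norm_divide norm_one_plus_i)
  have c: "1 - ?z = cnj ?z" by (simp add: complex_eq_iff)
  have "norm (1 - ?z) < 1" using n unfolding c complex_mod_cnj .
  from polylog_2_reflection[OF n this]
  have "polylog 2 ?z + cnj (polylog 2 ?z) + Ln ?z * cnj (Ln ?z) = of_real (pi\<^sup>2 / 6)"
    using n unfolding c by (subst (asm) polylog_cnj; simp add: cnj_Ln complex_nonpos_Reals_iff)
  from arg_cong[OF this, of Re] show ?thesis
    unfolding Ln_half_one_plus_i by (simp add: power2_eq_square field_simps)
qed

lemma Ln_one_plus_i_mult:
  "Ln (1 + \<i> * of_real x) = Complex (ln (1 + x\<^sup>2) / 2) (arctan x)"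
  by (subst Ln_eq_Complex_arctan) (simp_all add: cmod_def ln_sqrt)

text \<open>On the line \<open>Re z = 1/2\<close> one has \<open>1 - z = cnj z\<close>, so the
  derivative of the trilogarithm primitive is expressed by \<open>l x\<close> and
  \<open>arctan x\<close> alone. The path runs from the real point 1/2 to
  \<open>(1 + i) / 2\<close>, where \<open>cal_G\<close> appears.\<close>

lemma has_integral_ln_power2_one_plus_square:
  "((\<lambda>x. (ln (1 + x\<^sup>2) / 2 - ln 2)\<^sup>2 / (1 + x\<^sup>2)) has_integral
     cal_G + ln 2 / 2 * Im (polylog 2 ((1 + \<i>) / 2)) - 7 * pi ^ 3 / 384 + pi * (ln 2)\<^sup>2 / 32) {0..1}"
proof -
  define z where "z = (\<lambda>t. (1 + \<i> * t) / 2)"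
  define \<Phi> where "\<Phi> t = polylog 3 (z t) - Ln (z t) * polylog 2 (z t) - (Ln (z t))\<^sup>2 * Ln (1 - z t) / 2" for t
  define l where "l = (\<lambda>x::real. ln (1 + x\<^sup>2) / 2 - ln 2)"
  \<comment> \<open>The derivative of the first term is
    \<open>(l^2 - arctan^2 - 2 x l arctan) / (2 (1 + x^2))\<close>; the two added terms cancel its
    unwanted parts and complete it to \<open>l^2 / (1 + x^2)\<close>.\<close>
  define K where "K x = Im (\<Phi> (of_real x)) + (l x)\<^sup>2 * arctan x / 2 + arctan x ^ 3 / 6" for x
  have pos: "1 + x\<^sup>2 > 0" for x :: real by (simp add: add_pos_nonneg)
  have pos': "1 + x\<^sup>2 \<noteq> 0" for x :: real using pos[of x] by linarith
  have norm_z: "norm (z (of_real x)) = sqrt (1 + x\<^sup>2) / 2" for x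
    by (simp add: z_def norm_divide norm_one_plus_i_mult)
  have norm_z1: "norm (z (of_real x)) < 1" if "x \<in> {0..1}" for x
  proof -
    have "x\<^sup>2 \<le> 1" using that by (simp add: power_le_one)
    hence "sqrt (1 + x\<^sup>2) < sqrt 4" by (intro real_sqrt_less_mono) simp
    thus ?thesis by (simp add: norm_z)
  qed
  have Ln_z: "Ln (z (of_real x)) = Complex (l x) (arctan x)" for x
    by (subst Ln_eq_Complex_arctan) (simp_all add: norm_z l_def ln_div ln_sqrt pos pos', simp_all add: z_def)
  have z1: "1 - z (of_real x) = cnj (z (of_real x))" for x
    by (simp add: z_def complex_eq_iff)
  have nr: "z (of_real x) \<notin> \<real>\<^sub>\<le>\<^sub>0" "1 - z (of_real x) \<notin> \<real>\<^sub>\<le>\<^sub>0" for x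
    by (simp_all add: z1 complex_nonpos_Reals_iff z_def)
  have 1: "(K has_vector_derivative (l x)\<^sup>2 / (1 + x\<^sup>2)) (at x)" if x: "x \<in> {0<..<1}" for x
  proof -
    have dz: "(z has_field_derivative \<i> / 2) (at t)" for t
      unfolding z_def by (auto intro!: derivative_eq_intros)
    have "(\<Phi> has_field_derivative (Ln (z (of_real x)))\<^sup>2 * (\<i> / 2) / (1 - z (of_real x)) / 2) (at (of_real x))"
      unfolding \<Phi>_def
    proof (rule trilog_path_deriv)
      show "(z has_field_derivative \<i> / 2) (at (of_real x))" by (rule dz)
      show "((\<lambda>t. Ln (z t)) has_field_derivative \<i> / 2 / z (of_real x)) (at (of_real x))"
        using DERIV_chain2[OF has_field_derivative_Ln[OF nr(1)] dz] by (simp add: field_simps)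
    qed (use x nr[of x] norm_z1 in auto)
    from has_field_derivative_Im[OF has_vector_derivative_real_field[OF this]]
    have d\<Phi>: "((\<lambda>x. Im (\<Phi> (of_real x))) has_field_derivative
        Im ((Ln (z (of_real x)))\<^sup>2 * (\<i> / 2) / (1 - z (of_real x)) / 2)) (at x)" .
    have w: "(\<i> / 2) / (1 - z (of_real x)) = Complex (- x / (1 + x\<^sup>2)) (1 / (1 + x\<^sup>2))"
    proof -
      have "1 - z (of_real x) \<noteq> 0" using nr[of x] by auto
      moreover have "Complex (- x / (1 + x\<^sup>2)) (1 / (1 + x\<^sup>2)) * (1 - z (of_real x)) = \<i> / 2"
        using pos[of x] by (simp add: z_def complex_eq_iff field_simps power2_eq_square)
      ultimately show ?thesis by (subst nonzero_divide_eq_eq) (auto simp only:)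
    qed
    have im: "Im ((Ln (z (of_real x)))\<^sup>2 * (\<i> / 2) / (1 - z (of_real x)) / 2) =
       ((l x)\<^sup>2 - (arctan x)\<^sup>2 - 2 * x * l x * arctan x) / (1 + x\<^sup>2) / 2"
    proof -
      have "Im ((Complex a b)\<^sup>2 * Complex (- x / p) (1 / p) / 2) = (a\<^sup>2 - b\<^sup>2 - 2 * x * a * b) / p / 2" for a b p
        by (cases "p = 0") (simp_all add: power2_eq_square field_simps)
      thus ?thesis unfolding times_divide_eq_right[symmetric] w Ln_z by (simp only:)
    qed
    have dl: "(l has_field_derivative x / (1 + x\<^sup>2)) (at x)"
      unfolding l_def using pos[of x] by (auto intro!: derivative_eq_intros simp: field_simps)
    have "(K has_field_derivative
        ((l x)\<^sup>2 - (arctan x)\<^sup>2 - 2 * x * l x * arctan x) / (1 + x\<^sup>2) / 2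
        + (2 * l x * (x / (1 + x\<^sup>2)) * arctan x + inverse (1 + x\<^sup>2) * (l x)\<^sup>2) / 2
        + 3 * (arctan x)\<^sup>2 * inverse (1 + x\<^sup>2) / 6) (at x)"
      unfolding K_def
    proof (intro DERIV_add DERIV_cdivide DERIV_mult)
      show "((\<lambda>x. (l x)\<^sup>2) has_field_derivative 2 * l x * (x / (1 + x\<^sup>2))) (at x)"
        by (rule derivative_eq_intros dl refl)+ simp
      show "((\<lambda>x. arctan x ^ 3) has_field_derivative 3 * (arctan x)\<^sup>2 * inverse (1 + x\<^sup>2)) (at x)"
        by (rule derivative_eq_intros refl)+ simp
    qed (rule d\<Phi>[unfolded im] DERIV_arctan)+
    also have "((l x)\<^sup>2 - (arctan x)\<^sup>2 - 2 * x * l x * arctan x) / (1 + x\<^sup>2) / 2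
        + (2 * l x * (x / (1 + x\<^sup>2)) * arctan x + inverse (1 + x\<^sup>2) * (l x)\<^sup>2) / 2
        + 3 * (arctan x)\<^sup>2 * inverse (1 + x\<^sup>2) / 6 = (l x)\<^sup>2 / (1 + x\<^sup>2)"
      using pos[of x] by (simp add: divide_simps) algebra
    finally show ?thesis by (simp add: has_real_derivative_iff_has_vector_derivative)
  qed
  have 2: "continuous_on {0..1} K"
  proof -
    have "continuous_on {0..1} (\<lambda>x. z (of_real x))"
      unfolding z_def by (intro continuous_intros) auto
    hence "continuous_on {0..1} (\<lambda>x. \<Phi> (of_real x))"
      unfolding \<Phi>_def by (intro continuous_intros) (use nr norm_z1 in \<open>auto intro!: less_imp_le\<close>)
    thus ?thesis unfolding K_def l_def
      by (intro continuous_intros) (use pos in \<open>auto simp: less_le\<close>)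
  qed
  have "((\<lambda>x. (l x)\<^sup>2 / (1 + x\<^sup>2)) has_integral K 1 - K 0) {0..1}"
    by (intro fundamental_theorem_of_calculus_interior 1 2) auto
  \<comment> \<open>At the start every logarithm and polylogarithm is taken at 1/2 and is
    real.\<close>
  moreover have "K 0 = 0"
  proof -
    have r: "z 0 = of_real (1 / 2)" by (simp add: z_def)
    have "Im (polylog s (of_real (1/2))) = 0" if "s \<ge> 2" for s
      using arg_cong[OF polylog_cnj[of "of_real (1/2)" s], of Im] that by simp
    moreover have "Ln (of_real (1 / 2)) = of_real (ln (1 / 2))" by (rule Ln_of_real) simp
    moreover have h: "1 - complex_of_real (1 / 2) = of_real (1 / 2)" by simp
    ultimately have "Im (\<Phi> 0) = 0" unfolding \<Phi>_def r h by (simp del: of_real_divide)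
    thus ?thesis by (simp add: K_def)
  qed
  moreover have "K 1 = cal_G + ln 2 / 2 * Im (polylog 2 ((1 + \<i>) / 2)) - 7 * pi ^ 3 / 384 + pi * (ln 2)\<^sup>2 / 32"
  proof -
    have 1: "z 1 = (1 + \<i>) / 2" by (simp add: z_def)
    have 2: "l 1 = - ln 2 / 2" by (simp add: l_def)
    have c: "1 - (1 + \<i>) / 2 = cnj ((1 + \<i>) / 2)" by (simp add: complex_eq_iff)
    have "Ln (1 - (1 + \<i>) / 2) = cnj (Ln ((1 + \<i>) / 2))"
      unfolding c by (rule cnj_Ln[symmetric]) (simp add: complex_nonpos_Reals_iff)
    hence 3: "Ln (1 - (1 + \<i>) / 2) = Complex (- ln 2 / 2) (- pi / 4)"
      unfolding Ln_half_one_plus_i by (simp add: complex_eq_iff)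
    define P where "P s = polylog s ((1 + \<i>) / 2)" for s
    have RP: "Re (P 2) = 5 * pi\<^sup>2 / 96 - (ln 2)\<^sup>2 / 8"
      unfolding P_def by (rule Re_polylog_2_half_one_plus_i)
    show ?thesis
      unfolding K_def \<Phi>_def of_real_1 1 2 3 Ln_half_one_plus_i cal_G_def P_def[symmetric]
      by (simp add: RP power2_eq_square power3_eq_cube field_simps)
  qed
  ultimately show ?thesis by (simp add: l_def)
qed

text \<open>The path \<open>z = 1 / (1 + i x)\<close> runs from 1 to the conjugate of
  \<open>(1 + i) / 2\<close>, and \<open>1 - z = i x z\<close> brings \<open>1 / x\<close> into the
  derivative. The integrand arises because the square of \<open>ln (1 + i x)\<close> has imaginary
  part \<open>ln (1 + x^2) * arctan x\<close>.\<close>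

lemma has_integral_ln_arctan:
  "((\<lambda>x. ln (1 + x\<^sup>2) * arctan x / x) has_integral
     2 * cal_G + ln 2 * Im (polylog 2 ((1 + \<i>) / 2)) + pi * (ln 2)\<^sup>2 / 16 - 3 * pi ^ 3 / 64) {0..1}"
proof -
  define m where "m = (\<lambda>t. Ln (1 + \<i> * t))"
  define z where "z = (\<lambda>t. inverse (1 + \<i> * t))"
  \<comment> \<open>The path formula yields \<open>- m^2 / (2 x w)\<close> with
    \<open>w = 1 + i x\<close>. Since \<open>1 / (x w) = 1 / x - i / w\<close>, subtracting the cube
    removes the part with \<open>1 / w\<close>.\<close>
  define \<Phi> where "\<Phi> t = polylog 3 (z t) - (- m t) * polylog 2 (z t) - (- m t)\<^sup>2 * Ln (1 - z t) / 2 - m t ^ 3 / 6" for t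
  have pos: "1 + x\<^sup>2 > 0" for x :: real by (simp add: add_pos_nonneg)
  have nr: "1 + \<i> * of_real x \<notin> \<real>\<^sub>\<le>\<^sub>0" for x
    by (simp add: complex_nonpos_Reals_iff)
  have nz: "1 + \<i> * of_real x \<noteq> 0" for x using nr[of x] by auto
  have m: "m (of_real x) = Complex (ln (1 + x\<^sup>2) / 2) (arctan x)" for x
    unfolding m_def by (rule Ln_one_plus_i_mult)
  have norm_z: "norm (z (of_real x)) = 1 / sqrt (1 + x\<^sup>2)" for x
    by (simp only: z_def norm_divide norm_one norm_one_plus_i_mult inverse_eq_divide)
  have z1: "1 - z (of_real x) = \<i> * of_real x * z (of_real x)" for x
    using nz[of x] by (simp add: z_def field_simps)
  have norm_z1: "norm (z (of_real x)) < 1" if "x > 0" for x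
  proof -
    have "sqrt 1 < sqrt (1 + x\<^sup>2)" using that by (intro real_sqrt_less_mono) simp
    hence "1 < sqrt (1 + x\<^sup>2)" by simp
    thus ?thesis unfolding norm_z by (subst divide_less_eq_1_pos) linarith+
  qed
  have nr1: "1 - z (of_real x) \<notin> \<real>\<^sub>\<le>\<^sub>0" if "x > 0" for x
    using norm_z1[OF that] by (intro one_minus_notin_nonpos_Reals) auto
  have 1: "((\<lambda>x. \<Phi> (of_real x)) has_vector_derivative - (m (of_real x))\<^sup>2 / (2 * of_real x)) (at x)"
    if x: "x \<in> {0<..<1}" for x
  proof -
    let ?w = "1 + \<i> * complex_of_real x"
    have dw: "((\<lambda>t. 1 + \<i> * t) has_field_derivative \<i>) (at (of_real x))"
      by (auto intro!: derivative_eq_intros)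
    have dm: "(m has_field_derivative \<i> / ?w) (at (of_real x))"
      unfolding m_def using DERIV_chain2[OF has_field_derivative_Ln[OF nr] dw] by (simp add: field_simps)
    have dz: "(z has_field_derivative - \<i> / ?w\<^sup>2) (at (of_real x))"
      unfolding z_def using nz[of x] by (auto intro!: derivative_eq_intros simp: field_simps power2_eq_square)
    have "- \<i> / w\<^sup>2 / inverse w = - (\<i> / w)" for w
      by (cases "w = 0") (simp_all add: field_simps power2_eq_square)
    hence z'z: "- \<i> / ?w\<^sup>2 / z (of_real x) = - (\<i> / ?w)"
      unfolding z_def by blast
    have "(\<Phi> has_field_derivative ((- m (of_real x))\<^sup>2 * (- \<i> / ?w\<^sup>2) / (1 - z (of_real x)) / 2
        - 3 * (m (of_real x))\<^sup>2 * (\<i> / ?w) / 6)) (at (of_real x))"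
      unfolding \<Phi>_def
    proof (intro DERIV_diff DERIV_cdivide trilog_path_deriv dz)
      show "((\<lambda>t. - m t) has_field_derivative - \<i> / ?w\<^sup>2 / z (of_real x)) (at (of_real x))"
        unfolding z'z by (intro DERIV_minus dm)
      show "((\<lambda>t. m t ^ 3) has_field_derivative 3 * (m (of_real x))\<^sup>2 * (\<i> / ?w)) (at (of_real x))"
        by (rule derivative_eq_intros dm refl)+ simp
    qed (use x norm_z1 nz[of x] in \<open>auto simp: z_def\<close>)
    hence "(\<Phi> has_field_derivative - (m (of_real x))\<^sup>2 / (2 * of_real x)) (at (of_real x))"
    proof (rule DERIV_cong)
      have "- \<i> / w\<^sup>2 / (\<i> * of_real x * inverse w) = - 1 / (of_real x * w)" for w
        using x by (cases "w = 0") (simp_all add: field_simps power2_eq_square)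
      hence "- \<i> / ?w\<^sup>2 / (1 - z (of_real x)) = - 1 / (of_real x * ?w)"
        unfolding z1 unfolding z_def by blast
      moreover have "- 1 / (of_real x * w) / 2 - 3 * (\<i> / w) / 6 = - (?w / w) / (2 * of_real x)"
        if "w \<noteq> 0" for w using x that by (simp add: field_simps)
      from this[OF nz[of x]] have "- 1 / (of_real x * ?w) / 2 - 3 * (\<i> / ?w) / 6 = - 1 / (2 * of_real x)"
        unfolding divide_self[OF nz[of x]] .
      moreover have "(- M)\<^sup>2 * A / B / 2 - 3 * M\<^sup>2 * C / 6 = M\<^sup>2 * (A / B / 2 - 3 * C / 6)" for M A B C :: complex
        by (simp add: right_diff_distrib)
      ultimately show "(- m (of_real x))\<^sup>2 * (- \<i> / ?w\<^sup>2) / (1 - z (of_real x)) / 2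
        - 3 * (m (of_real x))\<^sup>2 * (\<i> / ?w) / 6 = - (m (of_real x))\<^sup>2 / (2 * of_real x)"
        by (simp only:) simp
    qed
    from has_vector_derivative_real_field[OF this] show ?thesis .
  qed
  have 2: "continuous_on {0..1} (\<lambda>x. \<Phi> (of_real x))"
  proof (rule continuous_on_Icc_left)
    have cm: "continuous_on A (\<lambda>x. m (of_real x))" for A
      unfolding m_def by (intro continuous_intros) (use nr in auto)
    have cz: "continuous_on A (\<lambda>x. z (of_real x))" for A
      unfolding z_def by (intro continuous_intros) (use nz in auto)
    have nz1: "norm (z (of_real x)) \<le> 1" if "x \<ge> 0" for x
      using norm_z1[of x] that by (cases "x = 0") (auto simp: z_def)
    show "continuous_on {0<..1} (\<lambda>x. \<Phi> (of_real x))"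
      unfolding \<Phi>_def by (intro continuous_intros cm cz nr1 nz1) auto
    have "continuous_on {0..1::real} (\<lambda>x. polylog 3 (z (of_real x)) - (- m (of_real x)) * polylog 2 (z (of_real x)) - m (of_real x) ^ 3 / 6)"
      by (intro continuous_intros cm cz nz1) auto
    hence A: "((\<lambda>x. polylog 3 (z (of_real x)) - (- m (of_real x)) * polylog 2 (z (of_real x)) - m (of_real x) ^ 3 / 6) \<longlongrightarrow>
       polylog 3 (z (of_real 0)) - (- m (of_real 0)) * polylog 2 (z (of_real 0)) - m (of_real 0) ^ 3 / 6) (at_right 0)"
      unfolding continuous_on_def using at_within_Icc_at_right[of 0 "1::real"] by force
    \<comment> \<open>Here \<open>z\<close> tends to 1 and \<open>Ln (1 - z)\<close> diverges like
      \<open>ln x\<close>; the factor \<open>m^2\<close>, of order \<open>x^2\<close>,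
      compensates.\<close>
    have B: "((\<lambda>x. (- m (of_real x))\<^sup>2 * Ln (1 - z (of_real x)) / 2) \<longlongrightarrow> 0) (at_right 0)"
    proof (rule Lim_null_comparison)
      show "((\<lambda>x::real. (2 * x)\<^sup>2 * (\<bar>ln (x * (1 / sqrt (1 + x\<^sup>2)))\<bar> + pi) / 2) \<longlongrightarrow> 0) (at_right 0)"
        by real_asymp
      have "eventually (\<lambda>x. x \<in> {0<..<1/2::real}) (at_right 0)"
        by (intro eventually_at_right_real) auto
      thus "\<forall>\<^sub>F x in at_right 0. norm ((- m (of_real x))\<^sup>2 * Ln (1 - z (of_real x)) / 2) \<le> (2 * x)\<^sup>2 * (\<bar>ln (x * (1 / sqrt (1 + x\<^sup>2)))\<bar> + pi) / 2"
      proof eventually_elim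
        case (elim x)
        have "norm (m (of_real x)) \<le> 2 * x"
          using norm_Ln_le[of "\<i> * of_real x"] elim by (simp add: m_def norm_mult)
        hence "norm ((- m (of_real x))\<^sup>2) \<le> (2 * x)\<^sup>2"
          unfolding norm_power norm_minus_cancel by (intro power_mono) auto
        moreover have "norm (1 - z (of_real x)) = x * (1 / sqrt (1 + x\<^sup>2))"
          unfolding z1 norm_mult norm_z using elim by simp
        hence "norm (Ln (1 - z (of_real x))) \<le> \<bar>ln (x * (1 / sqrt (1 + x\<^sup>2)))\<bar> + pi"
          using norm_Ln_le_abs_ln[of "1 - z (of_real x)"] nr1[of x] elim by force
        ultimately show ?case
          unfolding norm_divide norm_mult norm_numeral by (intro divide_right_mono mult_mono) auto
      qed
    qed
    show "((\<lambda>x. \<Phi> (of_real x)) \<longlongrightarrow> \<Phi> (of_real 0)) (at_right 0)"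
      using tendsto_diff[OF A B] by (simp add: \<Phi>_def m_def algebra_simps)
  qed auto
  have "((\<lambda>x. - (m (of_real x))\<^sup>2 / (2 * of_real x)) has_integral \<Phi> (of_real 1) - \<Phi> (of_real 0)) {0..1}"
    by (intro fundamental_theorem_of_calculus_interior 1 2) auto
  note has_integral_mult_right[OF has_integral_Im[OF this], of "-2"]
  moreover have "Im (M\<^sup>2 / (2 * of_real x)) = Im (M\<^sup>2) / (2 * x)" for M :: complex and x :: real
    using Im_divide_of_real[of "M\<^sup>2" "2 * x"] by simp
  hence "-2 * Im (- (m (of_real x))\<^sup>2 / (2 * of_real x)) = ln (1 + x\<^sup>2) * arctan x / x" for x
    by (simp add: m power2_eq_square)
  ultimately have int: "((\<lambda>x. ln (1 + x\<^sup>2) * arctan x / x) has_integral -2 * (Im (\<Phi> 1) - Im (\<Phi> 0))) {0..1}"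
    by (simp only: minus_complex.simps of_real_1 of_real_0)
  have "Im (\<Phi> 0) = 0"
    using arg_cong[OF polylog_cnj[of 1 3], of Im] by (simp add: \<Phi>_def z_def m_def)
  moreover have "Im (\<Phi> 1) = - cal_G + pi / 4 * (5 * pi\<^sup>2 / 96 - (ln 2)\<^sup>2 / 8) - ln 2 / 2 * Im (polylog 2 ((1 + \<i>) / 2))
     - Im ((Complex (ln 2 / 2) (pi / 4))\<^sup>2 * Complex (- ln 2 / 2) (pi / 4)) / 2 - Im (Complex (ln 2 / 2) (pi / 4) ^ 3) / 6"
  proof -
    have n: "norm ((1 + \<i>) / 2) \<le> 1"
      using real_sqrt_less_mono[of 2 4] by (simp add: norm_divide norm_one_plus_i)
    have 1: "z 1 = cnj ((1 + \<i>) / 2)" by (simp add: z_def complex_eq_iff)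
    have 2: "1 - cnj ((1 + \<i>) / 2) = (1 + \<i>) / 2" by (simp add: complex_eq_iff)
    have 3: "m 1 = Complex (ln 2 / 2) (pi / 4)" by (simp add: m_def Ln_one_plus_i)
    have 4: "polylog s (cnj ((1 + \<i>) / 2)) = cnj (polylog s ((1 + \<i>) / 2))" if "s \<ge> 2" for s
      using n that by (rule polylog_cnj)
    show ?thesis
      unfolding \<Phi>_def 1 2 3 Ln_half_one_plus_i cal_G_def
      using Re_polylog_2_half_one_plus_i by (simp add: 4 del: complex_cnj_divide complex_cnj_add)
  qed
  moreover define P where "P = polylog 2 ((1 + \<i>) / 2)"
  ultimately show ?thesis
    unfolding P_def[symmetric]
    by (intro has_integral_eq_rhs[OF int]) (simp add: power2_eq_square power3_eq_cube field_simps)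
qed


subsection \<open>A weighted inner product on the unit interval\<close>

text \<open>An explicit inverse \<open>r\<close> reduces injectivity and the image to pointwise
  checks. Absolute integrability is asked of the pulled-back function \<phi> and transferred to
  \<open>H\<close>.\<close>

lemma has_integral_change_of_variables_Ioo:
  fixes g g' H \<phi> :: "real \<Rightarrow> real"
  assumes der: "\<And>x. x \<in> {a<..<b} \<Longrightarrow> (g has_field_derivative g' x) (at x)"
    and inv: "\<And>x. x \<in> {a<..<b} \<Longrightarrow> g x \<in> T \<and> r (g x) = x"
      "\<And>y. y \<in> T \<Longrightarrow> r y \<in> {a<..<b} \<and> g (r y) = y"
    and eq: "\<And>x. x \<in> {a<..<b} \<Longrightarrow> \<bar>g' x\<bar> * H (g x) = \<phi> x"
    and int: "\<phi> absolutely_integrable_on {a<..<b}"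
  shows "(H has_integral integral {a<..<b} \<phi>) T" "H absolutely_integrable_on T"
proof -
  have img: "g ` {a<..<b} = T" using inv by force
  have "inj_on g {a<..<b}" by (rule inj_on_inverseI[of _ r]) (use inv in auto)
  note cv = has_absolute_integral_change_of_variables_1'[of "{a<..<b}" g g' H, OF _ _ this]
  have "(\<lambda>x. \<bar>g' x\<bar> * H (g x)) absolutely_integrable_on {a<..<b}"
    using int by (rule absolutely_integrable_spike[of _ _ "{}"]) (auto simp: eq)
  moreover have "integral {a<..<b} (\<lambda>x. \<bar>g' x\<bar> * H (g x)) = integral {a<..<b} \<phi>"
    by (intro integral_cong eq)
  ultimately have "H absolutely_integrable_on T \<and> integral T H = integral {a<..<b} \<phi>"
    using cv[of "integral {a<..<b} \<phi>"] img der by (auto intro: has_field_derivative_at_within)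
  thus "(H has_integral integral {a<..<b} \<phi>) T" "H absolutely_integrable_on T"
    using set_lebesgue_integral_eq_integral(1) by (metis integrable_integral)+
qed

text \<open>The L^2 space of the weight \<open>1 / (1 + x^2)\<close> on the unit interval.
  Measurability is listed separately because that of \<open>f^2\<close> does not give that of
  \<open>f\<close>, and products of two such functions have to be integrable.\<close>

definition sq_int :: "(real \<Rightarrow> real) \<Rightarrow> bool" where
  "sq_int f \<longleftrightarrow> f \<in> borel_measurable borel \<and>
     (\<lambda>x. (f x)\<^sup>2 / (1 + x\<^sup>2)) absolutely_integrable_on {0<..<1}"

definition ip :: "(real \<Rightarrow> real) \<Rightarrow> (real \<Rightarrow> real) \<Rightarrow> real" where
  "ip f g = integral {0<..<1} (\<lambda>x. f x * g x / (1 + x\<^sup>2))"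

text \<open>By \<open>2 |f g| \<le> f^2 + g^2\<close>, square integrability of each single logarithm
  covers all products that occur.\<close>

lemma sq_int_mult:
  assumes "sq_int f" "sq_int g"
  shows "(\<lambda>x. f x * g x / (1 + x\<^sup>2)) absolutely_integrable_on {0<..<1}"
proof (rule measurable_bounded_by_integrable_imp_absolutely_integrable)
  have [measurable]: "f \<in> borel_measurable borel" "g \<in> borel_measurable borel"
    using assms by (auto simp: sq_int_def)
  show "(\<lambda>x. f x * g x / (1 + x\<^sup>2)) \<in> borel_measurable (lebesgue_on {0<..<1})"
    by (intro measurable_restrict_space1 measurable_completion) measurable
  show "(\<lambda>x. (f x)\<^sup>2 / (1 + x\<^sup>2) + (g x)\<^sup>2 / (1 + x\<^sup>2)) integrable_on {0<..<1}"
    using assms by (intro integrable_add) (auto simp: sq_int_def absolutely_integrable_on_def)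
  show "norm (f x * g x / (1 + x\<^sup>2)) \<le> (f x)\<^sup>2 / (1 + x\<^sup>2) + (g x)\<^sup>2 / (1 + x\<^sup>2)" for x
  proof -
    have "\<bar>f x * g x\<bar> \<le> (f x)\<^sup>2 + (g x)\<^sup>2"
      using sum_squares_bound[of "f x" "g x"] sum_squares_bound[of "f x" "- g x"]
        zero_le_power2[of "f x"] zero_le_power2[of "g x"] unfolding power2_minus abs_le_iff
      by (simp only: mult_minus_right mult.assoc) linarith
    hence "\<bar>f x * g x\<bar> / (1 + x\<^sup>2) \<le> ((f x)\<^sup>2 + (g x)\<^sup>2) / (1 + x\<^sup>2)"
      by (intro divide_right_mono) auto
    thus ?thesis by (simp add: add_divide_distrib)
  qed
qed auto

lemma sq_int_add [intro]:
  assumes "sq_int f" "sq_int g"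
  shows "sq_int (\<lambda>x. f x + g x)"
proof -
  have "(\<lambda>x. f x * f x / (1 + x\<^sup>2) + (2 * (f x * g x / (1 + x\<^sup>2)) + g x * g x / (1 + x\<^sup>2))) absolutely_integrable_on {0<..<1}"
    by (intro set_integral_add set_integrable_mult_right sq_int_mult assms)
  also have "(\<lambda>x. f x * f x / (1 + x\<^sup>2) + (2 * (f x * g x / (1 + x\<^sup>2)) + g x * g x / (1 + x\<^sup>2))) = (\<lambda>x. (f x + g x)\<^sup>2 / (1 + x\<^sup>2))"
    by (simp add: fun_eq_iff power2_eq_square add_divide_distrib[symmetric] algebra_simps)
  finally show ?thesis using assms by (auto simp: sq_int_def)
qed

lemma sq_int_cmult [intro]:
  assumes "sq_int f"
  shows "sq_int (\<lambda>x. c * f x)"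
  using assms set_integrable_mult_right[of "c\<^sup>2" lebesgue "{0<..<1}" "\<lambda>x. (f x)\<^sup>2 / (1 + x\<^sup>2)"]
  by (auto simp: sq_int_def power_mult_distrib)

lemma sq_int_diff [intro]:
  assumes "sq_int f" "sq_int g"
  shows "sq_int (\<lambda>x. f x - g x)"
  using sq_int_add[OF assms(1) sq_int_cmult[OF assms(2), of "-1"]] by simp

lemma sq_int_continuous:
  assumes "f \<in> borel_measurable borel" "continuous_on {0..1} f"
  shows "sq_int f"
proof -
  have "(\<lambda>x. (f x)\<^sup>2 / (1 + x\<^sup>2)) absolutely_integrable_on {0..1}"
    by (intro absolutely_integrable_continuous_real continuous_intros assms)
      (auto simp: add_nonneg_eq_0_iff)
  hence "(\<lambda>x. (f x)\<^sup>2 / (1 + x\<^sup>2)) absolutely_integrable_on {0<..<1}"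
    by (rule set_integrable_subset) auto
  thus ?thesis using assms by (simp add: sq_int_def)
qed

lemma sq_int_has_integral:
  assumes "f \<in> borel_measurable borel" "((\<lambda>x. (f x)\<^sup>2 / (1 + x\<^sup>2)) has_integral I) {0..1}"
  shows "sq_int f" "ip f f = I"
proof -
  have *: "((\<lambda>x. (f x)\<^sup>2 / (1 + x\<^sup>2)) has_integral I) {0<..<1}"
    using assms(2) by (simp add: has_integral_Icc_iff_Ioo)
  have "(\<lambda>x. (f x)\<^sup>2 / (1 + x\<^sup>2)) absolutely_integrable_on {0<..<1}"
    by (rule nonnegative_absolutely_integrable_1) (use * in \<open>auto simp: integrable_on_def\<close>)
  thus "sq_int f" "ip f f = I"
    using assms * by (auto simp: sq_int_def ip_def power2_eq_square integral_unique)
qed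

lemma ip_integrable: "sq_int f \<Longrightarrow> sq_int g \<Longrightarrow> (\<lambda>x. f x * g x / (1 + x\<^sup>2)) integrable_on {0<..<1}"
  using sq_int_mult set_lebesgue_integral_eq_integral(1) by blast

lemma ip_has_integral:
  "sq_int f \<Longrightarrow> sq_int g \<Longrightarrow> ((\<lambda>x. f x * g x / (1 + x\<^sup>2)) has_integral ip f g) {0<..<1}"
  unfolding ip_def by (intro integrable_integral ip_integrable)

lemma ip_commute: "ip f g = ip g f"
  by (simp add: ip_def mult.commute)

lemma ip_add_left [simp]:
  "sq_int f \<Longrightarrow> sq_int g \<Longrightarrow> sq_int h \<Longrightarrow> ip (\<lambda>x. f x + g x) h = ip f h + ip g h"
  unfolding ip_def
  by (subst integral_add[symmetric]) (auto intro: ip_integrable simp: add_divide_distrib distrib_right)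

lemma ip_diff_left [simp]:
  "sq_int f \<Longrightarrow> sq_int g \<Longrightarrow> sq_int h \<Longrightarrow> ip (\<lambda>x. f x - g x) h = ip f h - ip g h"
  unfolding ip_def
  by (subst integral_diff[symmetric]) (auto intro: ip_integrable simp: diff_divide_distrib left_diff_distrib)

lemma ip_cmult_left [simp]: "ip (\<lambda>x. c * f x) h = c * ip f h"
  unfolding ip_def by (subst integral_mult_right[symmetric]) (simp add: mult.assoc)

lemma ip_add_right [simp]:
  "sq_int f \<Longrightarrow> sq_int g \<Longrightarrow> sq_int h \<Longrightarrow> ip h (\<lambda>x. f x + g x) = ip h f + ip h g"
  unfolding ip_commute[of h] by (rule ip_add_left)

lemma ip_diff_right [simp]:
  "sq_int f \<Longrightarrow> sq_int g \<Longrightarrow> sq_int h \<Longrightarrow> ip h (\<lambda>x. f x - g x) = ip h f - ip h g"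
  unfolding ip_commute[of h] by (rule ip_diff_left)

lemma ip_cmult_right [simp]: "ip h (\<lambda>x. c * f x) = c * ip h f"
  unfolding ip_commute[of h] by (rule ip_cmult_left)

text \<open>The direction is outwards from the unit interval: an integral over \<open>T\<close> is
  recognised as a pairing by pulling it back along \<sigma>.\<close>

lemma ip_subst:
  assumes der: "\<And>x. x \<in> {0<..<1} \<Longrightarrow> (\<sigma> has_field_derivative \<sigma>' x) (at x)"
    and inv: "\<And>x. x \<in> {0<..<1} \<Longrightarrow> \<sigma> x \<in> T \<and> r (\<sigma> x) = x"
      "\<And>y. y \<in> T \<Longrightarrow> r y \<in> {0<..<1} \<and> \<sigma> (r y) = y"
    and eq: "\<And>x. x \<in> {0<..<1} \<Longrightarrow> \<bar>\<sigma>' x\<bar> * H (\<sigma> x) = f x * g x / (1 + x\<^sup>2)"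
    and "sq_int f" "sq_int g"
  shows "(H has_integral ip f g) T"
  unfolding ip_def
  by (rule has_integral_change_of_variables_Ioo(1)[where g = \<sigma> and g' = \<sigma>' and r = r])
    (use assms sq_int_mult in auto)

text \<open>The map sends \<open>arctan x\<close> to \<open>pi/4 - arctan x\<close>; hence it is its
  own inverse and preserves \<open>dx / (1 + x^2)\<close>.\<close>

lemma ip_involution:
  assumes "sq_int f" "sq_int g" "sq_int f'" "sq_int g'"
    "\<And>x. x \<in> {0<..<1} \<Longrightarrow> f ((1 - x) / (1 + x)) = f' x"
    "\<And>x. x \<in> {0<..<1} \<Longrightarrow> g ((1 - x) / (1 + x)) = g' x"
  shows "ip f g = ip f' g'"
proof (rule has_integral_unique)
  show "((\<lambda>x. f x * g x / (1 + x\<^sup>2)) has_integral ip f g) {0<..<1}"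
    by (intro ip_has_integral assms)
  show "((\<lambda>x. f x * g x / (1 + x\<^sup>2)) has_integral ip f' g') {0<..<1}"
  proof (rule ip_subst[where \<sigma> = "\<lambda>x. (1 - x) / (1 + x)" and r = "\<lambda>x. (1 - x) / (1 + x)" and \<sigma>' = "\<lambda>x. - 2 / (1 + x)\<^sup>2"])
    fix x :: real assume x: "x \<in> {0<..<1}"
    show "((\<lambda>x. (1 - x) / (1 + x)) has_field_derivative - 2 / (1 + x)\<^sup>2) (at x)"
      using x by (auto intro!: derivative_eq_intros simp: field_simps power2_eq_square)
    have "1 + ((1 - x) / (1 + x))\<^sup>2 = 2 * (1 + x\<^sup>2) / (1 + x)\<^sup>2"
    proof -
      have "1 + ((1 - x) / (1 + x))\<^sup>2 = ((1 + x)\<^sup>2 + (1 - x)\<^sup>2) / (1 + x)\<^sup>2"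
        using x by (simp add: power_divide add_divide_distrib)
      also have "(1 + x)\<^sup>2 + (1 - x)\<^sup>2 = 2 * (1 + x\<^sup>2)"
        by (simp add: power2_eq_square algebra_simps)
      finally show ?thesis .
    qed
    moreover have "2 / p * (y / (2 * q / p)) = y / q" if "p \<noteq> 0" for p q y :: real
      using that by simp
    moreover have "(1 + x)\<^sup>2 \<noteq> 0" using x by simp
    ultimately have "2 / (1 + x)\<^sup>2 * (f' x * g' x / (1 + ((1 - x) / (1 + x))\<^sup>2)) = f' x * g' x / (1 + x\<^sup>2)"
      by (simp only:)
    thus "\<bar>- 2 / (1 + x)\<^sup>2\<bar> * (f ((1 - x) / (1 + x)) * g ((1 - x) / (1 + x)) / (1 + ((1 - x) / (1 + x))\<^sup>2)) = f' x * g' x / (1 + x\<^sup>2)"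
      using assms x by simp
  qed (use assms in \<open>auto simp: field_simps\<close>)
qed


subsection \<open>Logarithmic integrals\<close>

lemma has_integral_ln_i:
  "((\<lambda>x. ln x / (1 + x\<^sup>2)) has_integral - catalan_constant) {0..1}"
  "((\<lambda>x. (ln x)\<^sup>2 / (1 + x\<^sup>2)) has_integral pi ^ 3 / 16) {0..1}"
proof -
  have im: "Im (of_real y * \<i> / (1 - \<i> * of_real x)) = y / (1 + x\<^sup>2)" for x y
    by (simp add: Im_divide)
  have ne: "norm \<i> \<le> 1" "\<i> \<noteq> 1" "\<i> \<noteq> 0" by (auto simp: complex_eq_iff)
  show "((\<lambda>x. ln x / (1 + x\<^sup>2)) has_integral - catalan_constant) {0..1}"
    using has_integral_Im[OF has_integral_ln_polylog[OF ne]]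
    by (simp only: im catalan_eq_Im_polylog uminus_complex.simps)
  show "((\<lambda>x. (ln x)\<^sup>2 / (1 + x\<^sup>2)) has_integral pi ^ 3 / 16) {0..1}"
    using has_integral_Im[OF has_integral_ln_power2_polylog[OF ne]]
    unfolding im by (rule has_integral_eq_rhs) (simp add: Im_polylog_3_i)
qed

lemma has_integral_reflect_01:
  fixes f :: "real \<Rightarrow> real"
  assumes "(f has_integral I) {0..1}"
  shows "((\<lambda>x. f (1 - x)) has_integral I) {0..1}"
proof -
  have "(f has_integral I) (cbox 0 1)" using assms by simp
  from has_integral_affinity[OF this, of "-1" 1]
  have "((\<lambda>x. f (1 - x)) has_integral I) ((\<lambda>x. 1 - x) ` {0..1})" by simp
  also have "(\<lambda>x. 1 - x) ` {0..1::real} = {0..1}"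
    by (simp add: image_diff_atLeastAtMost)
  finally show ?thesis .
qed

text \<open>The kernel belonging to \<open>(1 + i) / 2\<close> has imaginary part
  \<open>1 / (1 + (1 - x)^2)\<close>, so reflecting the interval produces the standard weight. In
  the second value \<open>cal_G\<close> becomes a pairing.\<close>

lemma has_integral_ln_one_minus:
  "((\<lambda>x. ln (1 - x) / (1 + x\<^sup>2)) has_integral - Im (polylog 2 ((1 + \<i>) / 2))) {0..1}"
  "((\<lambda>x. (ln (1 - x))\<^sup>2 / (1 + x\<^sup>2)) has_integral 2 * cal_G) {0..1}"
proof -
  let ?z = "(1 + \<i>) / 2"
  have im: "Im (of_real y * ?z / (1 - ?z * of_real x)) = y / (1 + (1 - x)\<^sup>2)" for x y
  proof -
    have "Re (1 - ?z * of_real x) = 1 - x / 2" "Im (1 - ?z * of_real x) = - (x / 2)"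
      "Re (of_real y * ?z) = y / 2" "Im (of_real y * ?z) = y / 2" by simp_all
    hence "Im (of_real y * ?z / (1 - ?z * of_real x)) =
        (y / 2 * (1 - x / 2) + y / 2 * (x / 2)) / ((1 - x / 2)\<^sup>2 + (x / 2)\<^sup>2)"
      unfolding Im_divide by (simp only: mult_minus_right diff_minus_eq_add power2_minus)
    also have "y / 2 * (1 - x / 2) + y / 2 * (x / 2) = y / 2"
      by (simp add: algebra_simps)
    also have "(1 - x / 2)\<^sup>2 + (x / 2)\<^sup>2 = (1 + (1 - x)\<^sup>2) / 2"
      by (simp add: power2_eq_square field_simps)
    finally show ?thesis by simp
  qed
  have ne: "norm ?z \<le> 1" "?z \<noteq> 1" "?z \<noteq> 0"
    using real_sqrt_less_mono[of 2 4] by (simp_all add: norm_divide norm_one_plus_i complex_eq_iff)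
  show "((\<lambda>x. ln (1 - x) / (1 + x\<^sup>2)) has_integral - Im (polylog 2 ?z)) {0..1}"
    using has_integral_reflect_01[OF has_integral_Im[OF has_integral_ln_polylog[OF ne]]]
    unfolding im by simp
  show "((\<lambda>x. (ln (1 - x))\<^sup>2 / (1 + x\<^sup>2)) has_integral 2 * cal_G) {0..1}"
    using has_integral_reflect_01[OF has_integral_Im[OF has_integral_ln_power2_polylog[OF ne]]]
    unfolding im by (simp add: cal_G_def)
qed

lemma has_integral_Un_cofinite:
  fixes f :: "real \<Rightarrow> real"
  assumes "(f has_integral I) S" "(f has_integral J) T" "S \<inter> T = {}" "finite (U - (S \<union> T))" "S \<union> T \<subseteq> U"
  shows "(f has_integral I + J) U"
proof -
  have "(f has_integral I + J) (S \<union> T)"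
    using assms by (intro has_integral_Un) auto
  moreover have "{x \<in> S \<union> T - U. f x \<noteq> 0} = {}" using assms(5) by blast
  hence "negligible {x \<in> S \<union> T - U. f x \<noteq> 0}" by (simp only: negligible_empty)
  moreover have "negligible {x \<in> U - (S \<union> T). f x \<noteq> 0}"
    by (rule negligible_subset[OF negligible_finite[OF assms(4)]]) blast
  ultimately show ?thesis
    using has_integral_spike_set_eq[of "S \<union> T" U f "I + J"] by blast
qed

text \<open>Abbreviations rather than constants, so that the linearity rules for \<open>ip\<close>
  act on the logarithms themselves.\<close>

abbreviation (input) "la \<equiv> \<lambda>x::real. ln x"
abbreviation (input) "lb \<equiv> \<lambda>x::real. ln (1 - x)"
abbreviation (input) "lc \<equiv> \<lambda>x::real. ln (1 + x)"
abbreviation (input) "ld \<equiv> \<lambda>x::real. ln (1 + x\<^sup>2)"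
abbreviation (input) "l1 \<equiv> \<lambda>x::real. 1 :: real"

lemma sq_int_logs [simp]:
  "sq_int la" "sq_int lb" "sq_int lc" "sq_int ld" "sq_int (\<lambda>x. c)"
proof -
  show "sq_int la" by (rule sq_int_has_integral(1)[OF _ has_integral_ln_i(2)]) measurable
  show "sq_int lb" by (rule sq_int_has_integral(1)[OF _ has_integral_ln_one_minus(2)]) measurable
  show "sq_int lc" by (rule sq_int_continuous) (auto intro!: continuous_intros)
  show "sq_int ld" by (rule sq_int_continuous) (auto intro!: continuous_intros simp: add_nonneg_eq_0_iff)
  show "sq_int (\<lambda>x. c)" by (rule sq_int_continuous) auto
qed

lemmas [simp] = sq_int_add sq_int_diff sq_int_cmult

text \<open>\<open>NO_MATCH\<close> keeps this rule and the next two from looping at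
  \<open>l1\<close>. Together they bring every pairing with a constant to the form
  \<open>c * ip l1 f\<close>.\<close>

lemma ip_const_left [simp]: "NO_MATCH 1 c \<Longrightarrow> ip (\<lambda>x. c) f = c * ip l1 f"
  using ip_cmult_left[of c l1 f] by simp

lemma ip_const_right [simp]: "NO_MATCH 1 c \<Longrightarrow> ip f (\<lambda>x. c) = c * ip l1 f"
  using ip_cmult_right[of f c l1] by (simp add: ip_commute)

lemma ip_l1_right [simp]: "NO_MATCH (\<lambda>x::real. 1::real) f \<Longrightarrow> ip f l1 = ip l1 f"
  by (rule ip_commute)

lemma ip_values:
  "ip l1 l1 = pi / 4" "ip l1 la = - catalan_constant" "ip la la = pi ^ 3 / 16"
  "ip l1 lb = - Im (polylog 2 ((1 + \<i>) / 2))" "ip lb lb = 2 * cal_G"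
proof -
  have "((\<lambda>x. 1 / (1 + x\<^sup>2)) has_integral arctan 1 - arctan 0) {0..1::real}"
    by (rule fundamental_theorem_of_calculus)
      (auto intro!: derivative_eq_intros simp: inverse_eq_divide simp flip: has_real_derivative_iff_has_vector_derivative)
  thus "ip l1 l1 = pi / 4"
    unfolding ip_def by (intro integral_unique) (simp add: has_integral_Icc_iff_Ioo)
  show "ip l1 la = - catalan_constant" "ip l1 lb = - Im (polylog 2 ((1 + \<i>) / 2))"
    using has_integral_ln_i(1) has_integral_ln_one_minus(1)
    unfolding ip_def by (auto intro!: integral_unique simp: has_integral_Icc_iff_Ioo)
  show "ip la la = pi ^ 3 / 16"
    by (rule sq_int_has_integral(2)[OF _ has_integral_ln_i(2)]) measurable
  show "ip lb lb = 2 * cal_G"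
    by (rule sq_int_has_integral(2)[OF _ has_integral_ln_one_minus(2)]) measurable
qed

lemma log_involution:
  fixes x :: real
  assumes "x \<in> {0<..<1}"
  defines "y \<equiv> (1 - x) / (1 + x)"
  shows "ln y = ln (1 - x) - ln (1 + x)" "ln (1 - y) = ln 2 + ln x - ln (1 + x)" "ln (1 + y) = ln 2 - ln (1 + x)"
proof -
  have "1 - y = 2 * x / (1 + x)" "1 + y = 2 / (1 + x)" using assms by (auto simp: field_simps)
  thus "ln y = ln (1 - x) - ln (1 + x)" "ln (1 - y) = ln 2 + ln x - ln (1 + x)" "ln (1 + y) = ln 2 - ln (1 + x)"
    using assms by (simp_all add: ln_div ln_mult)
qed

text \<open>The involution sends \<open>la\<close> to \<open>lb - lc\<close>, \<open>lb\<close> to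
  \<open>ln 2 + la - lc\<close> and \<open>lc\<close> to \<open>ln 2 - lc\<close>. The relations
  come from applying it to \<open>la\<close> with \<open>la\<close>, to \<open>la\<close> with
  \<open>lb\<close> (where \<open>ip la lb\<close> itself cancels), and to \<open>l1\<close> with
  \<open>la\<close> and with \<open>lc\<close>.\<close>

lemma ip_involution_values:
  "ip lb lb - 2 * ip lb lc + ip lc lc = ip la la"
  "ip lb lc + ip la lc - ip lc lc = ln 2 * ip l1 la"
  "ip l1 lb = ln 2 * pi / 8 + ip l1 la"
proof -
  have "ip la la = ip (\<lambda>x. ln (1 - x) - ln (1 + x)) (\<lambda>x. ln (1 - x) - ln (1 + x))"
    by (rule ip_involution) (auto simp: log_involution)
  thus "ip lb lb - 2 * ip lb lc + ip lc lc = ip la la"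
    by (simp add: ip_commute[of lc lb])
  have 1: "ip l1 la = ip l1 (\<lambda>x. ln (1 - x) - ln (1 + x))"
    by (rule ip_involution) (auto simp: log_involution)
  have 2: "ip l1 lc = ip l1 (\<lambda>x. ln 2 - ln (1 + x))"
    by (rule ip_involution) (auto simp: log_involution)
  have "ip la lb = ip (\<lambda>x. ln (1 - x) - ln (1 + x)) (\<lambda>x. ln 2 + ln x - ln (1 + x))"
    by (rule ip_involution) (auto simp: log_involution)
  hence 3: "ip la lb = ln 2 * ip l1 lb + (ip la lb - ip lb lc) - (ln 2 * ip l1 lc + (ip la lc - ip lc lc))"
    by (simp add: ip_commute[of lc la] ip_commute[of lc lb] ip_commute[of lb la])
  have 1: "ip l1 la = ip l1 lb - ip l1 lc" using 1 by simp
  with 3 show "ip lb lc + ip la lc - ip lc lc = ln 2 * ip l1 la"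
    by (simp only: right_diff_distrib)
  note 2
  also have "ip l1 (\<lambda>x. ln 2 - ln (1 + x)) = ln 2 * pi / 4 - ip l1 lc"
    by (simp add: ip_values)
  finally show "ip l1 lb = ln 2 * pi / 8 + ip l1 la"
    using 1 by linarith
qed

text \<open>The integral of \<open>lb\<close> is known both as this dilogarithm and, by the
  involution, through Catalan's constant.\<close>

lemma Im_polylog_2_half_one_plus_i:
  "Im (polylog 2 ((1 + \<i>) / 2)) = catalan_constant - ln 2 * pi / 8"
  using ip_involution_values(3) unfolding ip_values by linarith

section \<open>Rational substitutions onto the half line\<close>

text \<open>The denominator is one factor of
  \<open>4 y^4 + 1 = (2 y^2 - 2 y + 1) (2 y^2 + 2 y + 1)\<close>. Comparing the integrals of
  \<open>(ln y)^2\<close> for both factors and for the product gives the relation that brings in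
  \<open>ip la lb\<close>.\<close>

lemma has_integral_ln_power2_quadratic_plus:
  "((\<lambda>y. (ln y)\<^sup>2 / (2 * y\<^sup>2 + 2 * y + 1)) has_integral
     ip (\<lambda>x. ln x - ln (1 - x)) (\<lambda>x. ln x - ln (1 - x))) {0<..}"
proof (rule ip_subst[where \<sigma> = "\<lambda>x. x / (1 - x)" and \<sigma>' = "\<lambda>x. 1 / (1 - x)\<^sup>2" and r = "\<lambda>y. y / (1 + y)"])
  fix x :: real assume x: "x \<in> {0<..<1}"
  show "((\<lambda>x. x / (1 - x)) has_field_derivative 1 / (1 - x)\<^sup>2) (at x)"
    using x by (auto intro!: derivative_eq_intros simp: power2_eq_square)
  have "2 * (x / (1 - x))\<^sup>2 + 2 * (x / (1 - x)) + 1 = (1 + x\<^sup>2) / (1 - x)\<^sup>2"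
    using x by (simp add: divide_simps) (simp add: power2_eq_square algebra_simps)
  thus "\<bar>1 / (1 - x)\<^sup>2\<bar> * ((ln (x / (1 - x)))\<^sup>2 / (2 * (x / (1 - x))\<^sup>2 + 2 * (x / (1 - x)) + 1)) =
      (ln x - ln (1 - x)) * (ln x - ln (1 - x)) / (1 + x\<^sup>2)"
    using x by (simp add: ln_div power2_eq_square)
qed (auto simp: field_simps)

lemma quadratic_minus_scale:
  fixes x :: real
  assumes "1 + s * x \<noteq> 0" "s\<^sup>2 = 1"
  shows "2 * (1 / (1 + s * x))\<^sup>2 - 2 * (1 / (1 + s * x)) + 1 = (1 + x\<^sup>2) / (1 + s * x)\<^sup>2"
proof -
  have "2 * (1 / w)\<^sup>2 - 2 * (1 / w) + 1 = (w\<^sup>2 - 2 * w + 2) / w\<^sup>2" if "w \<noteq> 0" for w :: real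
    using that by (simp add: power2_eq_square field_simps)
  moreover have "(1 + s * x)\<^sup>2 - 2 * (1 + s * x) + 2 = 1 + s\<^sup>2 * x\<^sup>2"
    by (simp add: power2_eq_square algebra_simps)
  ultimately show ?thesis using assms by simp
qed

lemma sq_int_uminus [simp]: "sq_int f \<Longrightarrow> sq_int (\<lambda>x. - f x)"
  using sq_int_cmult[of f "-1"] by simp

lemma ip_uminus [simp]: "ip (\<lambda>x. - f x) g = - ip f g" "ip f (\<lambda>x. - g x) = - ip f g"
  using ip_cmult_left[of "-1" f g] ip_cmult_right[of f "-1" g] by simp_all

lemma sq_int_divide [simp]: "sq_int f \<Longrightarrow> sq_int (\<lambda>x. f x / c)"
  using sq_int_cmult[of f "1 / c"] by simp

lemma ip_divide [simp]: "ip (\<lambda>x. f x / c) g = ip f g / c" "ip f (\<lambda>x. g x / c) = ip f g / c"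
  using ip_cmult_left[of "1 / c" f g] ip_cmult_right[of f "1 / c" g] by simp_all

lemma sq_int_lc': "sq_int (\<lambda>x. ln (x + 1))"
  using sq_int_logs(3) by (simp add: add.commute)

text \<open>The pieces below 1/2, from 1/2 to 1 and beyond 1 are parametrised by
  \<open>x / (1 + x)\<close>, \<open>1 / (1 + x)\<close> and \<open>1 / (1 - x)\<close>. Each time
  the quadratic becomes \<open>1 + x^2\<close> times the Jacobian, so the standard weight
  appears.\<close>

lemma has_integral_ln_power2_quadratic_minus:
  "((\<lambda>y. (ln y)\<^sup>2 / (2 * y\<^sup>2 - 2 * y + 1)) has_integral
     ip (\<lambda>x. ln x - ln (1 + x)) (\<lambda>x. ln x - ln (1 + x)) + ip lc lc + ip lb lb) {0<..}"
proof -
  let ?H = "\<lambda>y::real. (ln y)\<^sup>2 / (2 * y\<^sup>2 - 2 * y + 1)"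
  have 1: "(?H has_integral ip (\<lambda>x. ln x - ln (1 + x)) (\<lambda>x. ln x - ln (1 + x))) {0<..<1/2}"
  proof (rule ip_subst[where \<sigma> = "\<lambda>x. x / (1 + x)" and \<sigma>' = "\<lambda>x. 1 / (1 + x)\<^sup>2" and r = "\<lambda>y. y / (1 - y)"])
    fix x :: real assume x: "x \<in> {0<..<1}"
    show "((\<lambda>x. x / (1 + x)) has_field_derivative 1 / (1 + x)\<^sup>2) (at x)"
      using x by (auto intro!: derivative_eq_intros simp: power2_eq_square)
    have "2 * (x / (1 + x))\<^sup>2 - 2 * (x / (1 + x)) + 1 = (1 + x\<^sup>2) / (1 + x)\<^sup>2"
      using x by (simp add: divide_simps) (simp add: power2_eq_square algebra_simps)
    thus "\<bar>1 / (1 + x)\<^sup>2\<bar> * ?H (x / (1 + x)) =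
        (ln x - ln (1 + x)) * (ln x - ln (1 + x)) / (1 + x\<^sup>2)"
      using x by (simp add: ln_div power2_eq_square)
  qed (auto simp: field_simps sq_int_lc')
  have 2: "(?H has_integral ip lc lc) {1/2<..<1}"
  proof (rule ip_subst[where \<sigma> = "\<lambda>x. 1 / (1 + x)" and \<sigma>' = "\<lambda>x. - 1 / (1 + x)\<^sup>2" and r = "\<lambda>y. 1 / y - 1"])
    fix x :: real assume x: "x \<in> {0<..<1}"
    show "((\<lambda>x. 1 / (1 + x)) has_field_derivative - 1 / (1 + x)\<^sup>2) (at x)"
      using x by (auto intro!: derivative_eq_intros simp: power2_eq_square)
    show "\<bar>- 1 / (1 + x)\<^sup>2\<bar> * ?H (1 / (1 + x)) = ln (1 + x) * ln (1 + x) / (1 + x\<^sup>2)"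
      using x quadratic_minus_scale[of 1 x] by (simp add: ln_div power2_eq_square)
  qed (auto simp: field_simps sq_int_lc')
  have 3: "(?H has_integral ip lb lb) {1<..}"
  proof (rule ip_subst[where \<sigma> = "\<lambda>x. 1 / (1 - x)" and \<sigma>' = "\<lambda>x. 1 / (1 - x)\<^sup>2" and r = "\<lambda>y. 1 - 1 / y"])
    fix x :: real assume x: "x \<in> {0<..<1}"
    show "((\<lambda>x. 1 / (1 - x)) has_field_derivative 1 / (1 - x)\<^sup>2) (at x)"
      using x by (auto intro!: derivative_eq_intros simp: power2_eq_square)
    show "\<bar>1 / (1 - x)\<^sup>2\<bar> * ?H (1 / (1 - x)) = ln (1 - x) * ln (1 - x) / (1 + x\<^sup>2)"
      using x quadratic_minus_scale[of "-1" x] by (simp add: ln_div power2_eq_square)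
  qed (auto simp: field_simps sq_int_lc')
  have 12: "(?H has_integral ip (\<lambda>x. ln x - ln (1 + x)) (\<lambda>x. ln x - ln (1 + x)) + ip lc lc) {0<..<1}"
    by (rule has_integral_Un_cofinite[OF 1 2]) (auto intro: finite_subset[of _ "{1/2}"])
  show ?thesis
    by (rule has_integral_Un_cofinite[OF 12 3]) (auto intro: finite_subset[of _ "{1}"])
qed

text \<open>With \<open>2 y^2 = x\<close> below \<open>sqrt (1/2)\<close> and
  \<open>2 y^2 = 1 / x\<close> above it, \<open>4 y^4\<close> becomes \<open>x^2\<close> or its
  inverse, and only pairings of \<open>la\<close> and \<open>l1\<close> remain.\<close>

lemma has_integral_ln_power2_quartic:
  "((\<lambda>y. (ln y)\<^sup>2 * (4 * y) / (4 * y ^ 4 + 1)) has_integral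
     (ip (\<lambda>x. ln x - ln 2) (\<lambda>x. ln x - ln 2) + ip (\<lambda>x. ln x + ln 2) (\<lambda>x. ln x + ln 2)) / 4) {0<..}"
proof -
  let ?H = "\<lambda>y::real. (ln y)\<^sup>2 * (4 * y) / (4 * y ^ 4 + 1)"
  have sq4: "sqrt t ^ 4 = t\<^sup>2" if "t \<ge> 0" for t
  proof -
    have "sqrt t ^ 4 = ((sqrt t)\<^sup>2)\<^sup>2" by simp
    thus ?thesis using that by (simp del: power_even_eq)
  qed
  have 1: "(?H has_integral ip (\<lambda>x. 1 / 2 * (ln x - ln 2)) (\<lambda>x. 1 / 2 * (ln x - ln 2))) {0<..<sqrt (1 / 2)}"
  proof (rule ip_subst[where \<sigma> = "\<lambda>x. sqrt (x / 2)" and \<sigma>' = "\<lambda>x. 1 / (4 * sqrt (x / 2))" and r = "\<lambda>y. 2 * y\<^sup>2"])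
    fix x :: real assume x: "x \<in> {0<..<1}"
    have "inverse s / 2 * (1 / 2) = 1 / (4 * s)" for s :: real
      by (simp add: inverse_eq_divide)
    moreover have "((\<lambda>x. sqrt (x / 2)) has_field_derivative inverse (sqrt (x / 2)) / 2 * (1 / 2)) (at x)"
      by (rule DERIV_chain2[OF DERIV_real_sqrt]) (use x in \<open>auto intro!: derivative_eq_intros\<close>)
    ultimately show "((\<lambda>x. sqrt (x / 2)) has_field_derivative 1 / (4 * sqrt (x / 2))) (at x)"
      by (simp only:)
    have l: "ln (sqrt (x / 2)) = 1 / 2 * (ln x - ln 2)" using x by (simp add: ln_sqrt ln_div)
    have q: "4 * sqrt (x / 2) ^ 4 + 1 = 1 + x\<^sup>2" using x by (subst sq4) (auto simp: power_divide)
    have gen: "\<bar>1 / (4 * s)\<bar> * (l\<^sup>2 * (4 * s) / q) = l * l / q" if "s > 0" for s l q :: real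
      using that by (simp add: power2_eq_square)
    have "sqrt (x / 2) > 0" using x by simp
    from gen[OF this] show "\<bar>1 / (4 * sqrt (x / 2))\<bar> * ?H (sqrt (x / 2)) =
        (1 / 2 * (ln x - ln 2)) * (1 / 2 * (ln x - ln 2)) / (1 + x\<^sup>2)"
      unfolding l q .
  next
    fix y :: real assume y: "y \<in> {0<..<sqrt (1 / 2)}"
    hence "y\<^sup>2 < (sqrt (1 / 2))\<^sup>2" by (intro power_strict_mono) auto
    thus "2 * y\<^sup>2 \<in> {0<..<1} \<and> sqrt (2 * y\<^sup>2 / 2) = y" using y by simp
  qed (intro sq_int_cmult sq_int_diff sq_int_logs | force)+
  have 2: "(?H has_integral ip (\<lambda>x. (- 1 / 2) * (ln x + ln 2)) (\<lambda>x. (- 1 / 2) * (ln x + ln 2))) {sqrt (1 / 2)<..}"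
  proof (rule ip_subst[where \<sigma> = "\<lambda>x. sqrt (1 / (2 * x))" and \<sigma>' = "\<lambda>x. - 1 / (4 * sqrt (1 / (2 * x)) * x\<^sup>2)" and r = "\<lambda>y. 1 / (2 * y\<^sup>2)"])
    fix x :: real assume x: "x \<in> {0<..<1}"
    have "inverse s / 2 * (- 1 / (2 * p)) = - 1 / (4 * s * p)" for s p :: real
      by (simp add: inverse_eq_divide)
    moreover have "((\<lambda>x. sqrt (1 / (2 * x))) has_field_derivative inverse (sqrt (1 / (2 * x))) / 2 * (- 1 / (2 * x\<^sup>2))) (at x)"
      by (rule DERIV_chain2[OF DERIV_real_sqrt])
        (use x in \<open>auto intro!: derivative_eq_intros simp: power2_eq_square\<close>)
    ultimately show "((\<lambda>x. sqrt (1 / (2 * x))) has_field_derivative - 1 / (4 * sqrt (1 / (2 * x)) * x\<^sup>2)) (at x)"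
      by (simp only:)
    have l: "ln (sqrt (1 / (2 * x))) = (- 1 / 2) * (ln x + ln 2)"
      using x by (simp add: ln_sqrt ln_div ln_mult field_simps)
    have q: "4 * sqrt (1 / (2 * x)) ^ 4 + 1 = (1 + x\<^sup>2) / x\<^sup>2"
      using x by (subst sq4) (auto simp: power_divide field_simps power_mult_distrib)
    have gen: "\<bar>- 1 / (4 * s * p)\<bar> * (l\<^sup>2 * (4 * s) / (q / p)) = l * l / q" if "s > 0" "p > 0" for s l p q :: real
      using that by (simp add: power2_eq_square)
    have "sqrt (1 / (2 * x)) > 0" "x\<^sup>2 > 0" using x by simp_all
    from gen[OF this] show "\<bar>- 1 / (4 * sqrt (1 / (2 * x)) * x\<^sup>2)\<bar> * ?H (sqrt (1 / (2 * x))) =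
        ((- 1 / 2) * (ln x + ln 2)) * ((- 1 / 2) * (ln x + ln 2)) / (1 + x\<^sup>2)"
      unfolding l q .
    show "sqrt (1 / (2 * x)) \<in> {sqrt (1 / 2)<..} \<and> 1 / (2 * (sqrt (1 / (2 * x)))\<^sup>2) = x"
      using x by (auto simp: field_simps)
  next
    fix y :: real assume y: "y \<in> {sqrt (1 / 2)<..}"
    have "sqrt (1 / 2) > (0::real)" by simp
    hence y0: "y > 0" using y by (meson greaterThan_iff less_trans)
    have "(sqrt (1 / 2))\<^sup>2 < y\<^sup>2" using y by (intro power_strict_mono) auto
    thus "1 / (2 * y\<^sup>2) \<in> {0<..<1} \<and> sqrt (1 / (2 * (1 / (2 * y\<^sup>2)))) = y"
      using y0 by (simp add: field_simps real_sqrt_divide)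
  qed (intro sq_int_cmult sq_int_add sq_int_logs | force)+
  have "(?H has_integral ip (\<lambda>x. 1 / 2 * (ln x - ln 2)) (\<lambda>x. 1 / 2 * (ln x - ln 2)) +
      ip (\<lambda>x. (- 1 / 2) * (ln x + ln 2)) (\<lambda>x. (- 1 / 2) * (ln x + ln 2))) {0<..}"
  proof (rule has_integral_Un_cofinite[OF 1 2])
    show "finite ({0<..} - ({0<..<sqrt (1 / 2)} \<union> {sqrt (1 / 2)<..}))"
      by (rule finite_subset[of _ "{sqrt (1 / 2)}"]) auto
    have "sqrt (1 / 2) > (0::real)" by simp
    thus "{0<..<sqrt (1 / 2)} \<union> {sqrt (1 / 2)<..} \<subseteq> {0<..}" by (auto simp del: real_sqrt_gt_0_iff)
  qed auto
  moreover have "(X + Y) / 4 = 1 / 2 * (1 / 2 * X) + - 1 / 2 * (- 1 / 2 * Y)" for X Y :: real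
    by (simp add: field_simps)
  ultimately show ?thesis by (simp only: ip_cmult_left ip_cmult_right)
qed

text \<open>The pairings with \<open>lc\<close> are not found one by one. Eliminating
  \<open>ip lb lc\<close> and \<open>ip lc lc\<close> by the involution relations leaves \<open>5/4
  * ip la la - ip lb lb + pi * (ln 2)^2 / 16 + 2 * ln 2 * ip l1 la\<close>, where everything is
  known.\<close>

lemma ip_la_lb_lc:
  "ip la lb + ip la lc = 5 / 64 * pi ^ 3 - 2 * cal_G + pi * (ln 2)\<^sup>2 / 16 - 2 * ln 2 * catalan_constant"
proof -
  have "((\<lambda>y. (ln y)\<^sup>2 * (4 * y) / (4 * y ^ 4 + 1)) has_integral
      ip (\<lambda>x. ln x - ln (1 + x)) (\<lambda>x. ln x - ln (1 + x)) + ip lc lc + ip lb lb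
      - ip (\<lambda>x. ln x - ln (1 - x)) (\<lambda>x. ln x - ln (1 - x))) {0<..}"
  proof (rule has_integral_eq[OF _ has_integral_diff[OF has_integral_ln_power2_quadratic_minus has_integral_ln_power2_quadratic_plus]])
    fix y :: real assume "y \<in> {0<..}"
    hence p: "2 * y\<^sup>2 + 2 * y + 1 > 0" by (simp add: add_pos_pos)
    have "2 * y\<^sup>2 - 2 * y + 1 = y\<^sup>2 + (y - 1)\<^sup>2" by (simp add: power2_eq_square algebra_simps)
    moreover have "y\<^sup>2 > 0" "(y - 1)\<^sup>2 \<ge> 0" using \<open>y \<in> _\<close> by auto
    ultimately have "2 * y\<^sup>2 - 2 * y + 1 > 0" by linarith
    moreover have "l / p - l / q = l * (q - p) / (p * q)" if "p > 0" "q > 0" for l p q :: real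
      using that by (simp add: field_simps)
    moreover have "(2 * y\<^sup>2 - 2 * y + 1) * (2 * y\<^sup>2 + 2 * y + 1) = 4 * y ^ 4 + 1"
      by (simp add: algebra_simps eval_nat_numeral)
    ultimately show "(ln y)\<^sup>2 / (2 * y\<^sup>2 - 2 * y + 1) - (ln y)\<^sup>2 / (2 * y\<^sup>2 + 2 * y + 1) = (ln y)\<^sup>2 * (4 * y) / (4 * y ^ 4 + 1)"
      using p by simp
  qed
  from has_integral_unique[OF this has_integral_ln_power2_quartic]
  have "ip lc lc + ip lb lb - 2 * ip la lc + ip lc lc - (ip lb lb - 2 * ip la lb) = (2 * ip la la + 2 * (ln 2)\<^sup>2 * (pi / 4)) / 4"
    by (simp add: ip_commute[of lc la] ip_commute[of lb la] ip_values power2_eq_square)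
  thus ?thesis
    using ip_involution_values(1,2) unfolding ip_values
    by (simp add: algebra_simps)
qed

section \<open>Doubling the angle\<close>

text \<open>For \<open>x = tan u\<close> the map \<open>2 x / (1 - x^2)\<close> is
  \<open>tan (2 u)\<close>. It carries the unit interval onto the half line and doubles
  \<open>dx / (1 + x^2)\<close>, which is the factor 2 before \<open>H\<close>. The half line is
  then cut at 1 and its outer piece folded back by \<open>1 / y\<close>.\<close>

lemma ip_duplication:
  assumes "sq_int f" "sq_int g" "sq_int h" "sq_int f'" "sq_int g'" "sq_int h'"
    and "\<And>x. x \<in> {0<..<1} \<Longrightarrow> 2 * H (2 * x / (1 - x\<^sup>2)) = f x * f' x"
    and "\<And>x. x \<in> {0<..<1} \<Longrightarrow> H x = g x * g' x"
    and "\<And>x. x \<in> {0<..<1} \<Longrightarrow> H (1 / x) = h x * h' x"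
  shows "ip f f' = ip g g' + ip h h'"
proof (rule has_integral_unique)
  show "((\<lambda>y. H y / (1 + y\<^sup>2)) has_integral ip f f') {0<..}"
  proof (rule ip_subst[where \<sigma> = "\<lambda>x. 2 * x / (1 - x\<^sup>2)" and \<sigma>' = "\<lambda>x. 2 * (1 + x\<^sup>2) / (1 - x\<^sup>2)\<^sup>2"
        and r = "\<lambda>y. (sqrt (1 + y\<^sup>2) - 1) / y"])
    fix x :: real assume x: "x \<in> {0<..<1}"
    hence x2: "x\<^sup>2 < 1" by (simp add: power_less_one_iff)
    show "((\<lambda>x. 2 * x / (1 - x\<^sup>2)) has_field_derivative 2 * (1 + x\<^sup>2) / (1 - x\<^sup>2)\<^sup>2) (at x)"
      using x x2 by (auto intro!: derivative_eq_intros simp: power2_eq_square algebra_simps)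
    have sq: "1 + (2 * x / (1 - x\<^sup>2))\<^sup>2 = ((1 + x\<^sup>2) / (1 - x\<^sup>2))\<^sup>2"
      using x2 by (simp add: divide_simps) (simp add: power2_eq_square algebra_simps)
    have "2 * q / p\<^sup>2 * (y / (q / p)\<^sup>2) = 2 * y / q" if "p > 0" "q > 0" for p q y :: real
      using that by (simp add: power2_eq_square)
    from this[of "1 - x\<^sup>2" "1 + x\<^sup>2" "H (2 * x / (1 - x\<^sup>2))"] x2 assms(7)[OF x]
    show "\<bar>2 * (1 + x\<^sup>2) / (1 - x\<^sup>2)\<^sup>2\<bar> * (H (2 * x / (1 - x\<^sup>2)) / (1 + (2 * x / (1 - x\<^sup>2))\<^sup>2)) = f x * f' x / (1 + x\<^sup>2)"
      unfolding sq by (simp add: add_pos_nonneg abs_of_nonneg)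
    have "sqrt (1 + (2 * x / (1 - x\<^sup>2))\<^sup>2) = (1 + x\<^sup>2) / (1 - x\<^sup>2)"
      unfolding sq using x2 by (simp add: abs_of_nonneg)
    thus "2 * x / (1 - x\<^sup>2) \<in> {0<..} \<and> (sqrt (1 + (2 * x / (1 - x\<^sup>2))\<^sup>2) - 1) / (2 * x / (1 - x\<^sup>2)) = x"
      using x x2 by (simp add: field_simps power2_eq_square)
  next
    fix y :: real assume y: "y \<in> {0<..}"
    \<comment> \<open>\<open>(s - 1) / y\<close> is the tangent of half the angle whose tangent is
      \<open>y\<close>.\<close>
    define s where "s = sqrt (1 + y\<^sup>2)"
    have s2: "s\<^sup>2 = 1 + y\<^sup>2" unfolding s_def by simp
    have s1: "s > 1" using y real_sqrt_less_mono[of 1 "1 + y\<^sup>2"] by (simp add: s_def)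
    have "s\<^sup>2 < (1 + y)\<^sup>2" unfolding s2 using y by (simp add: power2_eq_square algebra_simps)
    hence s3: "s < 1 + y" using y by (simp add: power2_less_imp_less)
    have e: "1 - ((s - 1) / y)\<^sup>2 = 2 * (s - 1) / y\<^sup>2"
      using y s2 by (simp add: divide_simps) (simp add: power2_eq_square algebra_simps)
    have "2 * ((s - 1) / y) / (2 * (s - 1) / y\<^sup>2) = y"
      using y s1 by (simp add: power2_eq_square)
    thus "(sqrt (1 + y\<^sup>2) - 1) / y \<in> {0<..<1} \<and>
      2 * ((sqrt (1 + y\<^sup>2) - 1) / y) / (1 - ((sqrt (1 + y\<^sup>2) - 1) / y)\<^sup>2) = y"
      unfolding s_def[symmetric] e using y s1 s3 by (simp only:) (simp add: divide_less_eq_1)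
  qed (use assms in auto)
  have 1: "((\<lambda>y. H y / (1 + y\<^sup>2)) has_integral ip g g') {0<..<1}"
    by (rule has_integral_eq[OF _ ip_has_integral]) (use assms in auto)
  have 2: "((\<lambda>y. H y / (1 + y\<^sup>2)) has_integral ip h h') {1<..}"
  proof (rule ip_subst[where \<sigma> = "\<lambda>x. 1 / x" and \<sigma>' = "\<lambda>x. - 1 / x\<^sup>2" and r = "\<lambda>y. 1 / y"])
    fix x :: real assume x: "x \<in> {0<..<1}"
    show "((\<lambda>x. 1 / x) has_field_derivative - 1 / x\<^sup>2) (at x)"
      using x by (auto intro!: derivative_eq_intros simp: power2_eq_square)
    have "1 + (1 / x)\<^sup>2 = (1 + x\<^sup>2) / x\<^sup>2" using x by (simp add: field_simps power2_eq_square)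
    thus "\<bar>- 1 / x\<^sup>2\<bar> * (H (1 / x) / (1 + (1 / x)\<^sup>2)) = h x * h' x / (1 + x\<^sup>2)"
      using x assms(9)[OF x] by simp
  qed (use assms in auto)
  show "((\<lambda>y. H y / (1 + y\<^sup>2)) has_integral ip g g' + ip h h') {0<..}"
    by (rule has_integral_Un_cofinite[OF 1 2]) (auto intro: finite_subset[of _ "{1}"])
qed

text \<open>For \<open>y = tan u\<close> the function \<open>H y\<close> is
  \<open>2 * ln (sin u)\<close>, and \<open>H1\<close> is the duplication formula of the sine.
  Doubling applied to \<open>H\<close> gives the first value, applied to its square the
  second.\<close>

lemma ip_ld_values:
  "ip l1 ld = pi * ln 2 / 2 - catalan_constant"
  "ip la ld = ip ld ld / 2 - pi * (ln 2)\<^sup>2 / 2 + pi ^ 3 / 48"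
proof -
  define H where "H y = ln (y\<^sup>2 / (1 + y\<^sup>2))" for y :: real
  have H1: "H (2 * x / (1 - x\<^sup>2)) = 2 * (ln 2 + ln x - ln (1 + x\<^sup>2))" if x: "x \<in> {0<..<1}" for x
  proof -
    have x2: "x\<^sup>2 < 1" using x by (simp add: power_less_one_iff)
    have "(2 * x / (1 - x\<^sup>2))\<^sup>2 / (1 + (2 * x / (1 - x\<^sup>2))\<^sup>2) = (2 * x / (1 + x\<^sup>2))\<^sup>2"
      using x2 x by (simp add: divide_simps add_nonneg_eq_0_iff) (simp add: power2_eq_square algebra_simps)
    moreover have "1 + x\<^sup>2 > 0" by (simp add: add_pos_nonneg)
    ultimately show ?thesis unfolding H_def using x by (simp add: ln_realpow ln_div ln_mult)
  qed
  have H2: "H x = 2 * ln x - ln (1 + x\<^sup>2)" "H (1 / x) = - ln (1 + x\<^sup>2)" if x: "x \<in> {0<..<1}" for x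
  proof -
    have pos: "1 + x\<^sup>2 > 0" "1 + x\<^sup>2 \<noteq> 0" using x by (simp_all add: add_pos_nonneg add_nonneg_eq_0_iff)
    show "H x = 2 * ln x - ln (1 + x\<^sup>2)"
      unfolding H_def using x pos by (simp add: ln_realpow ln_div less_imp_neq[symmetric])
    have "(1 / x)\<^sup>2 / (1 + (1 / x)\<^sup>2) = 1 / (1 + x\<^sup>2)"
      using x by (simp add: field_simps)
    thus "H (1 / x) = - ln (1 + x\<^sup>2)"
      unfolding H_def using pos by (simp add: ln_div)
  qed
  have "ip (\<lambda>x. 4 * (ln 2 + ln x - ln (1 + x\<^sup>2))) l1 = ip (\<lambda>x. 2 * ln x - ln (1 + x\<^sup>2)) l1 + ip (\<lambda>x. (-1) * ln (1 + x\<^sup>2)) l1"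
    by (rule ip_duplication[where H = H]) (auto simp: H1 H2)
  hence "4 * (ln 2 * ip l1 l1 + ip l1 la - ip l1 ld) = (2 * ip l1 la - ip l1 ld) - ip l1 ld"
    by simp
  thus d: "ip l1 ld = pi * ln 2 / 2 - catalan_constant"
    by (simp add: ip_values field_simps)
  \<comment> \<open>The 8 is the factor 2 of the doubling times the square of the 2 in
    \<open>H1\<close>.\<close>
  have "ip (\<lambda>x. 8 * (ln 2 + ln x - ln (1 + x\<^sup>2))) (\<lambda>x. ln 2 + ln x - ln (1 + x\<^sup>2)) =
      ip (\<lambda>x. 2 * ln x - ln (1 + x\<^sup>2)) (\<lambda>x. 2 * ln x - ln (1 + x\<^sup>2)) + ip (\<lambda>x. (-1) * ln (1 + x\<^sup>2)) (\<lambda>x. (-1) * ln (1 + x\<^sup>2))"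
    by (rule ip_duplication[where H = "\<lambda>y. H y * H y"]) ((simp add: H1 H2; fail) | (simp add: H1 H2, algebra))+
  hence "8 * (ln 2 * (ln 2 * ip l1 l1 + ip l1 la - ip l1 ld) + (ln 2 * ip l1 la + ip la la - ip la ld)
        - (ln 2 * ip l1 ld + ip la ld - ip ld ld))
      = 2 * (2 * ip la la - ip la ld) - (2 * ip la ld - ip ld ld) + ip ld ld"
    by (simp add: ip_commute[of ld la] distrib_left right_diff_distrib)
  thus "ip la ld = ip ld ld / 2 - pi * (ln 2)\<^sup>2 / 2 + pi ^ 3 / 48"
    unfolding d ip_values by (simp add: algebra_simps power2_eq_square)
qed

text \<open>Integration by parts: \<open>T\<close> vanishes at both ends of the unit interval, so
  its derivative integrates to 0, and the other parts of that derivative are pairings or the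
  integral in \<open>has_integral_ln_arctan\<close>.\<close>

lemma has_integral_arctan_ln:
  "((\<lambda>x. arctan x * ln x * (1 / x - 2 * x / (1 + x\<^sup>2))) has_integral
     ip la ld + (2 * cal_G + ln 2 * (catalan_constant - ln 2 * pi / 8) + pi * (ln 2)\<^sup>2 / 16 - 3 * pi ^ 3 / 64)
     - ip la la / 2) {0<..<1}"
proof -
  define T where "T = (\<lambda>x::real. arctan x * (ln x)\<^sup>2 / 2 - arctan x * ln x * ln (1 + x\<^sup>2))"
  have pos: "1 + x\<^sup>2 > 0" for x :: real by (simp add: add_pos_nonneg)
  have 1: "(T has_vector_derivative
      (ln x * ln x / (1 + x\<^sup>2) / 2 - ln x * ln (1 + x\<^sup>2) / (1 + x\<^sup>2) - ln (1 + x\<^sup>2) * arctan x / x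
       + arctan x * ln x * (1 / x - 2 * x / (1 + x\<^sup>2)))) (at x)" if x: "x \<in> {0<..<1}" for x
  proof -
    have "(T has_field_derivative
        (inverse (1 + x\<^sup>2) * (ln x)\<^sup>2 + 2 * ln x * (1 / x) * arctan x) / 2 -
        ((inverse (1 + x\<^sup>2) * ln x + 1 / x * arctan x) * ln (1 + x\<^sup>2) + (2 * x / (1 + x\<^sup>2)) * (arctan x * ln x))) (at x)"
      unfolding T_def
    proof (intro DERIV_diff DERIV_cdivide DERIV_mult DERIV_arctan)
      show "(ln has_field_derivative 1 / x) (at x)"
        using x by (auto intro!: derivative_eq_intros)
      show "((\<lambda>x. (ln x)\<^sup>2) has_field_derivative 2 * ln x * (1 / x)) (at x)"
        using x by (auto intro!: derivative_eq_intros)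
      show "((\<lambda>x. ln (1 + x\<^sup>2)) has_field_derivative 2 * x / (1 + x\<^sup>2)) (at x)"
        using pos[of x] by (auto intro!: derivative_eq_intros)
    qed
    moreover have "(inverse p * l\<^sup>2 + 2 * l * (1 / x) * t) / 2 - ((inverse p * l + 1 / x * t) * d + (2 * x / p) * (t * l))
      = l * l / p / 2 - l * d / p - d * t / x + t * l * (1 / x - 2 * x / p)" if "p > 0" for p l t d :: real
      using that x by (simp add: field_simps power2_eq_square)
    note this[OF pos[of x]]
    ultimately show ?thesis by (simp only: has_real_derivative_iff_has_vector_derivative)
  qed
  have 2: "continuous_on {0..1} T"
  proof (rule continuous_on_Icc_left)
    show "continuous_on {0<..1} T"
      unfolding T_def using pos by (intro continuous_intros) (auto simp: less_imp_neq[symmetric])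
    have "(T \<longlongrightarrow> 0) (at_right 0)" unfolding T_def by real_asymp
    thus "(T \<longlongrightarrow> T 0) (at_right 0)" by (simp add: T_def)
  qed auto
  have "((\<lambda>x. ln x * ln x / (1 + x\<^sup>2) / 2 - ln x * ln (1 + x\<^sup>2) / (1 + x\<^sup>2) - ln (1 + x\<^sup>2) * arctan x / x
       + arctan x * ln x * (1 / x - 2 * x / (1 + x\<^sup>2))) has_integral T 1 - T 0) {0..1}"
    by (intro fundamental_theorem_of_calculus_interior 1 2) auto
  hence A: "((\<lambda>x. ln x * ln x / (1 + x\<^sup>2) / 2 - ln x * ln (1 + x\<^sup>2) / (1 + x\<^sup>2) - ln (1 + x\<^sup>2) * arctan x / x
       + arctan x * ln x * (1 / x - 2 * x / (1 + x\<^sup>2))) has_integral 0) {0<..<1}"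
    by (simp add: T_def has_integral_Icc_iff_Ioo)
  have B: "((\<lambda>x. ln (1 + x\<^sup>2) * arctan x / x) has_integral
     2 * cal_G + ln 2 * Im (polylog 2 ((1 + \<i>) / 2)) + pi * (ln 2)\<^sup>2 / 16 - 3 * pi ^ 3 / 64) {0<..<1}"
    using has_integral_ln_arctan by (simp only: has_integral_Icc_iff_Ioo)
  have C: "((\<lambda>x. ln x * ln x / (1 + x\<^sup>2) / 2 - ln x * ln (1 + x\<^sup>2) / (1 + x\<^sup>2)) has_integral ip la la / 2 - ip la ld) {0<..<1}"
    by (intro has_integral_diff has_integral_divide ip_has_integral sq_int_logs)
  from has_integral_diff[OF A has_integral_diff[OF C B]]
  show ?thesis unfolding Im_polylog_2_half_one_plus_i
    by (simp add: algebra_simps)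
qed

text \<open>Expands the pairing of \<open>ld / 2 - ln 2\<close> with itself, known from the path on
  the line \<open>Re z = 1/2\<close>.\<close>

lemma ip_ld_ld:
  "ip ld ld = 4 * (cal_G + ln 2 / 2 * (catalan_constant - ln 2 * pi / 8) - 7 * pi ^ 3 / 384 + pi * (ln 2)\<^sup>2 / 32)
     + 4 * ln 2 * (pi * ln 2 / 2 - catalan_constant) - pi * (ln 2)\<^sup>2"
proof -
  have "ip (\<lambda>x. 1 / 2 * ln (1 + x\<^sup>2) - ln 2) (\<lambda>x. 1 / 2 * ln (1 + x\<^sup>2) - ln 2) =
      cal_G + ln 2 / 2 * (catalan_constant - ln 2 * pi / 8) - 7 * pi ^ 3 / 384 + pi * (ln 2)\<^sup>2 / 32"
    using has_integral_ln_power2_one_plus_square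
    unfolding ip_def Im_polylog_2_half_one_plus_i
    by (intro integral_unique) (simp add: has_integral_Icc_iff_Ioo power2_eq_square)
  moreover have "ip (\<lambda>x. 1 / 2 * ln (1 + x\<^sup>2) - ln 2) (\<lambda>x. 1 / 2 * ln (1 + x\<^sup>2) - ln 2) =
      1 / 2 * (1 / 2 * ip ld ld - ln 2 * ip l1 ld) - ln 2 * (1 / 2 * ip l1 ld - ln 2 * ip l1 l1)"
    by (simp add: right_diff_distrib diff_divide_distrib)
  ultimately show ?thesis
    unfolding ip_ld_values(1) ip_values by (simp add: power2_eq_square field_simps)
qed

text \<open>The coefficient of \<open>cal_G\<close> collects -8 from
  \<open>4 * (ip la lb + ip la lc)\<close>, -12 from \<open>- 6 * ip la ld\<close> and -4 from the
  integral of \<open>ln (1 + x^2) * arctan x / x\<close>.\<close>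

lemma has_integral_ln_arctan_combination:
  "((\<lambda>x. ln x * (4 * (ln (1 - x) + ln (1 + x) - ln (1 + x\<^sup>2)) - 2 * arctan x * (1 - x\<^sup>2) / x) / (1 + x\<^sup>2)) has_integral
     9 * pi ^ 3 / 16 + 3 * pi * (ln 2)\<^sup>2 / 4 - 4 * ln 2 * catalan_constant - 24 * cal_G) {0<..<1}"
proof -
  have "((\<lambda>x. ln x * (4 * (ln (1 - x) + ln (1 + x) - ln (1 + x\<^sup>2))) / (1 + x\<^sup>2)
          - 2 * (arctan x * ln x * (1 / x - 2 * x / (1 + x\<^sup>2)))) has_integral
      ip la (\<lambda>x. 4 * (ln (1 - x) + ln (1 + x) - ln (1 + x\<^sup>2)))
      - 2 * (ip la ld + (2 * cal_G + ln 2 * (catalan_constant - ln 2 * pi / 8) + pi * (ln 2)\<^sup>2 / 16 - 3 * pi ^ 3 / 64)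
     - ip la la / 2)) {0<..<1}"
    by (intro has_integral_diff has_integral_mult_right has_integral_arctan_ln ip_has_integral) simp_all
  also have "ip la (\<lambda>x. 4 * (ln (1 - x) + ln (1 + x) - ln (1 + x\<^sup>2))) = 4 * ((ip la lb + ip la lc) - ip la ld)"
    by simp
  also have "4 * (ip la lb + ip la lc - ip la ld)
      - 2 * (ip la ld + (2 * cal_G + ln 2 * (catalan_constant - ln 2 * pi / 8) + pi * (ln 2)\<^sup>2 / 16 - 3 * pi ^ 3 / 64)
     - ip la la / 2) = 9 * pi ^ 3 / 16 + 3 * pi * (ln 2)\<^sup>2 / 4 - 4 * ln 2 * catalan_constant - 24 * cal_G"
    unfolding ip_la_lb_lc ip_ld_values(2) ip_ld_ld ip_values
    by (simp add: power2_eq_square field_simps)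
  finally show ?thesis
  proof (rule has_integral_eq[rotated])
    fix x :: real assume x: "x \<in> {0<..<1}"
    have "1 + x\<^sup>2 > 0" by (simp add: add_pos_nonneg)
    hence "1 / x - 2 * x / (1 + x\<^sup>2) = (1 - x\<^sup>2) / x / (1 + x\<^sup>2)"
      using x by (simp add: field_simps power2_eq_square)
    moreover have "l * D / p - 2 * (t * l * (B / x / p)) = l * (D - 2 * t * B / x) / p" for l D p t B :: real
      by (simp add: diff_divide_distrib right_diff_distrib mult_ac)
    ultimately show "ln x * (4 * (ln (1 - x) + ln (1 + x) - ln (1 + x\<^sup>2))) / (1 + x\<^sup>2)
          - 2 * (arctan x * ln x * (1 / x - 2 * x / (1 + x\<^sup>2))) =
      ln x * (4 * (ln (1 - x) + ln (1 + x) - ln (1 + x\<^sup>2)) - 2 * arctan x * (1 - x\<^sup>2) / x) / (1 + x\<^sup>2)"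
      by (simp only:)
  qed
qed

text \<open>Substitution \<open>t = 2 * arctan x\<close>. The integrand on the unit interval is
  nonnegative, hence absolutely integrable; the absolute value of \<open>F\<close> will dominate the
  summation.\<close>

lemma has_integral_ln_tan_half:
  defines "F \<equiv> \<lambda>t. - ln (tan (t / 2)) * (- 2 * ln (cos t) + t * cos t / sin t)"
  shows "(F has_integral 9 * pi ^ 3 / 16 + 3 * pi * (ln 2)\<^sup>2 / 4 - 4 * ln 2 * catalan_constant - 24 * cal_G) {0<..<pi/2}"
    and "F absolutely_integrable_on {0<..<pi/2}"
proof -
  define \<phi> where "\<phi> = (\<lambda>x. ln x * (4 * (ln (1 - x) + ln (1 + x) - ln (1 + x\<^sup>2)) - 2 * arctan x * (1 - x\<^sup>2) / x) / (1 + x\<^sup>2))"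
  have pos: "1 + x\<^sup>2 > 0" for x :: real by (simp add: add_pos_nonneg)
  have int: "\<phi> absolutely_integrable_on {0<..<1}"
  proof (rule nonnegative_absolutely_integrable_1)
    show "\<phi> integrable_on {0<..<1}" using has_integral_ln_arctan_combination unfolding \<phi>_def by blast
    fix x :: real assume x: "x \<in> {0<..<1}"
    have x2: "x\<^sup>2 < 1" using x by (simp add: power_less_one_iff)
    have "ln (1 - x) + ln (1 + x) = ln (1 - x\<^sup>2)"
      using x by (subst ln_mult_pos[symmetric]) (auto simp: power2_eq_square algebra_simps)
    also have "\<dots> \<le> ln (1 + x\<^sup>2)" using x2 pos[of x] by (subst ln_le_cancel_iff) auto
    finally have "4 * (ln (1 - x) + ln (1 + x) - ln (1 + x\<^sup>2)) \<le> 0" by simp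
    moreover have "2 * arctan x * (1 - x\<^sup>2) / x \<ge> 0" using x x2 by simp
    ultimately show "\<phi> x \<ge> 0"
      unfolding \<phi>_def using x pos[of x] by (intro divide_nonneg_pos mult_nonpos_nonpos) auto
  qed
  have eq: "\<bar>2 / (1 + x\<^sup>2)\<bar> * F (2 * arctan x) = \<phi> x" if x: "x \<in> {0<..<1}" for x
  proof -
    have x2: "x\<^sup>2 < 1" using x by (simp add: power_less_one_iff)
    have sq: "(sqrt (1 + x\<^sup>2))\<^sup>2 = 1 + x\<^sup>2" using pos[of x] by simp
    have c: "cos (2 * arctan x) = (1 - x\<^sup>2) / (1 + x\<^sup>2)"
      unfolding cos_double cos_arctan sin_arctan power_divide sq by (simp add: diff_divide_distrib)
    have s: "sin (2 * arctan x) = 2 * x / (1 + x\<^sup>2)"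
      unfolding sin_double cos_arctan sin_arctan using sq by (simp add: power2_eq_square)
    have l: "ln ((1 - x\<^sup>2) / (1 + x\<^sup>2)) = ln (1 - x) + ln (1 + x) - ln (1 + x\<^sup>2)"
    proof -
      have "1 - x\<^sup>2 = (1 - x) * (1 + x)" by (simp add: power2_eq_square algebra_simps)
      thus ?thesis using x x2 pos[of x] by (simp add: ln_div ln_mult_pos)
    qed
    have t: "tan (2 * arctan x / 2) = x" by (simp add: tan_arctan)
    have "2 * t * (q / p) / (2 * x / p) = t * q / x" if "p > 0" for t p q :: real
      using that by simp
    note q = this[OF pos[of x]]
    have "\<bar>2 / p\<bar> * (- l * (- 2 * D + t * B / x)) = l * (4 * D - 2 * t * B / x) / p" if "p > 0" for l p t B D :: real
      using that x by (simp add: field_simps)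
    note gen = this[OF pos[of x]]
    show ?thesis
      unfolding F_def \<phi>_def c s t l q by (rule gen)
  qed
  have r: "2 * arctan x \<in> {0<..<pi/2} \<and> tan (2 * arctan x / 2) = x" if "x \<in> {0<..<1}" for x
    using that arctan_less_pi4_pos[of x] by (simp add: tan_arctan)
  have r': "tan (t / 2) \<in> {0<..<1} \<and> 2 * arctan (tan (t / 2)) = t" if t: "t \<in> {0<..<pi/2}" for t
  proof -
    have "tan (t / 2) > 0" using t by (intro tan_gt_zero) auto
    moreover have "tan (t / 2) < tan (pi / 4)" using t by (intro tan_monotone) auto
    moreover have "arctan (tan (t / 2)) = t / 2" using t by (intro arctan_tan) auto
    ultimately show ?thesis by (simp add: tan_45)
  qed
  have der: "((\<lambda>x. 2 * arctan x) has_field_derivative 2 / (1 + x\<^sup>2)) (at x)" for x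
    by (auto intro!: derivative_eq_intros simp: inverse_eq_divide)
  note cv = has_integral_change_of_variables_Ioo[where g = "\<lambda>x. 2 * arctan x" and g' = "\<lambda>x. 2 / (1 + x\<^sup>2)"
      and r = "\<lambda>t. tan (t / 2)" and T = "{0<..<pi/2}", OF der r r' eq int]
  show "F absolutely_integrable_on {0<..<pi/2}" using cv(2) by blast
  have "integral {0<..<1} \<phi> = 9 * pi ^ 3 / 16 + 3 * pi * (ln 2)\<^sup>2 / 4 - 4 * ln 2 * catalan_constant - 24 * cal_G"
    using has_integral_ln_arctan_combination unfolding \<phi>_def by (rule integral_unique)
  thus "(F has_integral 9 * pi ^ 3 / 16 + 3 * pi * (ln 2)\<^sup>2 / 4 - 4 * ln 2 * catalan_constant - 24 * cal_G) {0<..<pi/2}"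
    using cv(1) by simp
qed


subsection \<open>Integrals over the quarter period\<close>

text \<open>Adding the series at 1 and at -1 leaves twice the terms of even index, which is half of
  \<open>polylog 2 1\<close>.\<close>

lemma polylog_2_minus_1: "polylog 2 (-1) = - of_real (pi\<^sup>2 / 12)"
proof -
  have s1: "(\<lambda>n. 1 / of_nat (Suc n) ^ 2) sums polylog 2 1"
    using polylog_sums[of 1 2] by simp
  have s2: "(\<lambda>n. (-1) ^ Suc n / of_nat (Suc n) ^ 2) sums polylog 2 (-1)"
    using polylog_sums[of "-1" 2] by simp
  define f :: "nat \<Rightarrow> complex" where "f n = 1 / of_nat (Suc n) ^ 2 + (-1) ^ Suc n / of_nat (Suc n) ^ 2" for n
  have f: "f sums (polylog 2 1 + polylog 2 (-1))"
    unfolding f_def by (rule sums_add[OF s1 s2])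
  have "(\<lambda>n. f (2 * n + 1)) sums (polylog 2 1 + polylog 2 (-1))"
  proof (subst sums_mono_reindex)
    show "strict_mono (\<lambda>n::nat. 2 * n + 1)" by (auto simp: strict_mono_def)
    show "f n = 0" if "n \<notin> range (\<lambda>n. 2 * n + 1)" for n
    proof -
      have "even n" using that by (metis oddE rangeI)
      thus ?thesis by (simp add: f_def)
    qed
  qed (rule f)
  moreover have "f (2 * n + 1) = 1 / 2 * (1 / of_nat (Suc n) ^ 2)" for n
  proof -
    have "complex_of_nat (Suc (2 * n + 1)) = 2 * of_nat (Suc n)" by simp
    moreover have "(-1 :: complex) ^ Suc (2 * n + 1) = 1" by simp
    ultimately have "f (2 * n + 1) = 2 / (2 * of_nat (Suc n)) ^ 2"
      unfolding f_def by (simp only:) simp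
    thus ?thesis unfolding power_mult_distrib by simp
  qed
  ultimately have "(\<lambda>n. 1 / 2 * (1 / of_nat (Suc n) ^ 2)) sums (polylog 2 1 + polylog 2 (-1))"
    by simp
  from sums_unique2[OF sums_mult[OF s1, of "1/2"] this] polylog_2_1
  show ?thesis by (simp add: field_simps add_eq_0_iff)
qed

text \<open>The real part of the complex function serves as the real dilogarithm inside
  primitives.\<close>

lemma Re_polylog_2_deriv:
  assumes "(f has_field_derivative f') (at x)" "\<bar>f x\<bar> < 1" "f x \<noteq> 0"
  shows "((\<lambda>x. Re (polylog 2 (of_real (f x)))) has_field_derivative - ln (1 - f x) / f x * f') (at x)"
proof -
  have "((\<lambda>x. Re (polylog 2 (of_real x))) has_field_derivative Re (- Ln (1 - of_real (f x)) / of_real (f x))) (at (f x))"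
    by (rule has_field_derivative_Re[OF has_vector_derivative_real_field[OF polylog_2_deriv]]) (use assms in auto)
  also have "Re (- Ln (1 - of_real (f x)) / of_real (f x)) = - ln (1 - f x) / f x"
  proof -
    have "Ln (1 - of_real (f x)) = of_real (ln (1 - f x))"
      using Ln_of_real[of "1 - f x"] assms by simp
    thus ?thesis by (simp flip: of_real_divide of_real_minus)
  qed
  finally show ?thesis by (rule DERIV_chain2) (rule assms)
qed

text \<open>The primitive is twice the inverse tangent integral at \<open>tan (t/2)\<close>: the
  imaginary part of \<open>polylog 2\<close> at \<open>i x\<close> has derivative
  \<open>arctan x / x\<close>.\<close>

lemma has_integral_theta_over_sin:
  "((\<lambda>t. t / sin t) has_integral 2 * catalan_constant) {0..pi/2}"
proof -
  define B where "B = (\<lambda>t. 2 * Im (polylog 2 (\<i> * of_real (tan (t / 2)))))"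
  have "(B has_vector_derivative t / sin t) (at t)" if t: "t \<in> {0<..<pi/2}" for t
  proof -
    define x where "x = tan (t / 2)"
    have cpos: "cos (t / 2) > 0" "sin (t / 2) > 0" using t by (auto intro!: cos_gt_zero sin_gt_zero)
    have x0: "x > 0" unfolding x_def using t by (intro tan_gt_zero) auto
    have "x < tan (pi / 4)" unfolding x_def using t by (intro tan_monotone) auto
    hence x1: "x < 1" by (simp add: tan_45)
    have "((\<lambda>z. polylog 2 (\<i> * z)) has_field_derivative - Ln (1 - \<i> * of_real x) / (\<i> * of_real x) * \<i>) (at (of_real x))"
      by (rule polylog_deriv_chain) (use x0 x1 in \<open>auto intro!: derivative_eq_intros simp: norm_mult\<close>)
    from has_field_derivative_Im[OF has_vector_derivative_real_field[OF this]]
    have "((\<lambda>x. Im (polylog 2 (\<i> * of_real x))) has_field_derivative Im (- Ln (1 - \<i> * of_real x) / (\<i> * of_real x) * \<i>)) (at x)" .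
    also have "- Ln (1 - \<i> * of_real x) / (\<i> * of_real x) * \<i> = - Ln (1 - \<i> * of_real x) / of_real x" by simp
    also have "Im \<dots> = arctan x / x"
      using Ln_one_plus_i_mult[of "-x"] by (simp add: arctan_minus)
    finally have d: "((\<lambda>x. Im (polylog 2 (\<i> * of_real x))) has_field_derivative arctan x / x) (at (tan (t / 2)))"
      by (simp add: x_def)
    have "((\<lambda>t. tan (t / 2)) has_field_derivative inverse ((cos (t / 2))\<^sup>2) * (1 / 2)) (at t)"
      by (rule DERIV_chain2[OF DERIV_tan]) (use cpos in \<open>auto intro!: derivative_eq_intros\<close>)
    from DERIV_cmult[OF DERIV_chain2[OF d this], of 2]
    have "(B has_field_derivative 2 * (arctan x / x * (inverse ((cos (t / 2))\<^sup>2) * (1 / 2)))) (at t)"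
      unfolding B_def .
    moreover have "arctan x = t / 2" unfolding x_def using t by (intro arctan_tan) auto
    moreover have "2 * (t / 2 / (S / C) * (inverse (C\<^sup>2) * (1 / 2))) = t / (2 * S * C)" if "S > 0" "C > 0" for S C
      using that by (simp add: field_simps power2_eq_square)
    from this[OF cpos(2,1)] have "2 * (t / 2 / x * (inverse ((cos (t / 2))\<^sup>2) * (1 / 2))) = t / sin t"
      using sin_double[of "t / 2"] unfolding x_def tan_def by (simp only:) simp
    ultimately show ?thesis
      by (simp only: has_real_derivative_iff_has_vector_derivative)
  qed
  moreover have "continuous_on {0..pi/2} B"
  proof -
    have "cos (t / 2) \<noteq> 0" if "t \<in> {0..pi/2}" for t
    proof -
      have "0 \<le> t" "t \<le> pi / 2" using that by auto
      hence "- (pi / 2) < t / 2" "t / 2 < pi / 2" using pi_gt_zero by linarith+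
      hence "cos (t / 2) > 0" by (rule cos_gt_zero_pi)
      thus ?thesis by simp
    qed
    hence "continuous_on {0..pi/2} (\<lambda>t. tan (t / 2))"
      by (intro continuous_on_tan continuous_intros) auto
    moreover have "norm (\<i> * of_real (tan (t / 2))) \<le> 1" if t: "t \<in> {0..pi/2}" for t
    proof -
      have b: "- (pi / 2) < t / 2" "t / 2 \<le> pi / 4" "0 \<le> t / 2" "t / 2 < pi / 2" using t pi_gt_zero by (simp only: atLeastAtMost_iff, linarith)+
      from b have "tan (t / 2) \<le> tan (pi / 4)" by (intro tan_mono_le) auto
      moreover have "tan (t / 2) \<ge> 0" using b by (intro tan_pos_pi2_le) auto
      ultimately show ?thesis by (simp add: norm_mult tan_45)
    qed
    ultimately show ?thesis unfolding B_def
      by (intro continuous_on_mult continuous_on_const continuous_on_Im continuous_on_polylog' continuous_on_of_real) auto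
  qed
  ultimately have "((\<lambda>t. t / sin t) has_integral B (pi / 2) - B 0) {0..pi/2}"
    by (intro fundamental_theorem_of_calculus_interior) auto
  thus ?thesis by (simp add: B_def tan_45 catalan_eq_Im_polylog)
qed

lemma has_integral_theta_sin_ln_tan:
  "((\<lambda>t. t * sin t * ln (tan t)) has_integral 2 * catalan_constant - ln 2) {0..pi/2}"
proof -
  \<comment> \<open>\<open>sin t - t cos t\<close> is a primitive of \<open>t sin t\<close>. In the
    coefficient of \<open>ln (cos t)\<close> it is lowered by 1 to vanish at \<open>pi/2\<close>,
    where that logarithm diverges; \<open>ln (1 + sin t)\<close> takes up the resulting
    \<open>(1 - sin t) / cos t\<close>.\<close>
  define A where "A = (\<lambda>t::real. (sin t - t * cos t) * ln (sin t) - (sin t - t * cos t - 1) * ln (cos t) - ln (1 + sin t))"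
  have "(A has_vector_derivative t * sin t * ln (tan t) - t / sin t) (at t)" if t: "t \<in> {0<..<pi/2}" for t
  proof -
    have pos: "sin t > 0" "cos t > 0" using t by (auto intro!: cos_gt_zero sin_gt_zero)
    have "(A has_field_derivative
        (t * sin t) * ln (sin t) + (cos t / sin t) * (sin t - t * cos t)
        - ((t * sin t) * ln (cos t) + (- sin t / cos t) * (sin t - t * cos t - 1))
        - cos t / (1 + sin t)) (at t)"
      unfolding A_def using pos
      by (intro DERIV_diff DERIV_mult) (auto intro!: derivative_eq_intros)
    moreover have "c / (1 + s) = (1 - s) / c" if "s > 0" "c > 0" "s\<^sup>2 + c\<^sup>2 = 1" for s c :: real
      using that by (simp add: field_simps power2_eq_square)
    from this[OF pos] have "cos t / (1 + sin t) = (1 - sin t) / cos t" by simp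
    moreover have "(t * s) * ls + (c / s) * (s - t * c) - ((t * s) * lc + (- s / c) * (s - t * c - 1)) - (1 - s) / c
        = t * s * (ls - lc) - t / s" if "s > 0" "c > 0" "s\<^sup>2 + c\<^sup>2 = 1" for s c ls lc :: real
    proof -
      have c2: "c * c = 1 - s * s" using that(3) by (simp add: power2_eq_square)
      have "(c / s) * (s - t * c) - (- s / c) * (s - t * c - 1) - (1 - s) / c
          = c - t * (c * c) / s + (s * s - 1) / c - s * t"
        using that by (simp add: field_simps)
      also have "(s * s - 1) / c = - c" using c2 that by (simp add: field_simps)
      also have "c - t * (c * c) / s + - c - s * t = - t / s"
        unfolding c2 using that by (simp add: field_simps)
      finally show ?thesis by (simp add: algebra_simps)
    qed
    note this[OF pos]
    moreover have "ln (tan t) = ln (sin t) - ln (cos t)" unfolding tan_def using pos by (simp add: ln_div)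
    ultimately show ?thesis by (simp add: has_real_derivative_iff_has_vector_derivative)
  qed
  moreover have "continuous_on {0..pi/2} A"
  proof (rule continuous_on_IccI)
    have "(A \<longlongrightarrow> 0) (at_right 0)" unfolding A_def by real_asymp
    thus "(A \<longlongrightarrow> A 0) (at_right 0)" by (simp add: A_def)
    have "(A \<longlongrightarrow> - ln 2) (at_left (pi / 2))" unfolding A_def by real_asymp
    thus "(A \<longlongrightarrow> A (pi / 2)) (at_left (pi / 2))" by (simp add: A_def)
    show "(A \<longlongrightarrow> A t) (at t)" if "0 < t" "t < pi / 2" for t
    proof -
      have "sin t > 0" "cos t > 0" using that by (auto intro!: cos_gt_zero sin_gt_zero)
      hence "isCont A t" unfolding A_def by (intro continuous_intros) auto
      thus ?thesis by (simp add: isCont_def)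
    qed
  qed auto
  ultimately have "((\<lambda>t. t * sin t * ln (tan t) - t / sin t) has_integral A (pi / 2) - A 0) {0..pi/2}"
    by (intro fundamental_theorem_of_calculus_interior) auto
  from has_integral_add[OF this has_integral_theta_over_sin] show ?thesis
    by (simp add: A_def)
qed

text \<open>In \<open>s = sin t\<close> the integrand is \<open>L * (ln s - L)\<close> with
  \<open>L = ln (1 - s^2) / 2\<close>. Its primitive is an elementary part \<open>E\<close> plus a
  combination \<open>P\<close> of three dilogarithms.\<close>

lemma has_integral_cos_ln_cos_ln_tan:
  "((\<lambda>t. cos t * ln (cos t) * ln (tan t)) has_integral ln 2 - pi\<^sup>2 / 24 - (ln 2)\<^sup>2) {0..pi/2}"
proof -
  define r where "r = (\<lambda>x. Re (polylog 2 (of_real x)))"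
  define P where "P = (\<lambda>s::real. r (1 - s) / 2 + r (- s) / 2 - r ((1 - s) / 2))"
  \<comment> \<open>The first bracket multiplies \<open>L\<close> by a primitive of
    \<open>ln s - L\<close>; its constant \<open>ln 2\<close> makes that primitive vanish at
    \<open>s = 1\<close>, where \<open>L\<close> diverges. The rest comes from integrating by
    parts.\<close>
  define E where "E = (\<lambda>s::real. (ln (1 - s) + ln (1 + s)) / 2 *
      (s * ln s + (1 - s) * (ln (1 - s) + ln (1 + s)) / 2 - ln (1 + s) + ln 2)
    - s * ln s + ln s * ln (1 + s) / 2 + ((s + 1) * ln (1 + s) - (1 - s) * ln (1 - s)) / 2
    - (ln (1 + s))\<^sup>2 / 4 - (ln (1 + s) - ln 2) * ln (1 - s) / 2 + (ln (1 + s) - ln 2)\<^sup>2 / 4)"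
  have dP: "(P has_field_derivative ln s / (1 - s) / 2 - ln (1 + s) / s / 2 - (ln (1 + s) - ln 2) / (1 - s)) (at s)"
    if s: "s \<in> {0<..<1}" for s
  proof -
    have h: "1 - (1 - s) / 2 = (1 + s) / 2" by (simp add: field_simps)
    have "(P has_field_derivative
        (- ln (1 - (1 - s)) / (1 - s) * (- 1)) / 2 + (- ln (1 - (- s)) / (- s) * (- 1)) / 2
        - (- ln (1 - (1 - s) / 2) / ((1 - s) / 2) * (- 1 / 2))) (at s)"
      unfolding P_def r_def
      by (intro DERIV_diff DERIV_add DERIV_cdivide Re_polylog_2_deriv)
        (use s in \<open>auto intro!: derivative_eq_intros\<close>)
    moreover have "(- a / q * (- 1)) / 2 + (- c / (- s) * (- 1)) / 2 - (- d / (q / 2) * (- 1 / 2)) =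
        a / q / 2 - c / s / 2 - d / q" for a c d q :: real by simp
    moreover have "ln ((1 + s) / 2) = ln (1 + s) - ln 2" "1 - (1 - s) = s" "1 - - s = 1 + s"
      using s by (simp_all add: ln_div)
    ultimately show ?thesis unfolding h by (simp only:)
  qed
  have dE: "(E has_field_derivative (ln (1 - s) + ln (1 + s)) / 2 * (ln s - (ln (1 - s) + ln (1 + s)) / 2)
      - (ln s / (1 - s) / 2 - ln (1 + s) / s / 2 - (ln (1 + s) - ln 2) / (1 - s))) (at s)"
    if s: "s \<in> {0<..<1}" for s
  proof -
    \<comment> \<open>With logarithms and reciprocals as symbols, the derivative identity becomes
      polynomial algebra modulo the relations \<open>e\<close>.\<close>
    define a b c where abc: "a = ln s" "b = ln (1 - s)" "c = ln (1 + s)"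
    define p q r where pqr: "p = 1 / (1 - s)" "q = 1 / (1 + s)" "r = 1 / s"
    have da: "(ln has_field_derivative r) (at s)" using s by (auto intro!: derivative_eq_intros simp: pqr)
    have db: "((\<lambda>s. ln (1 - s)) has_field_derivative - p) (at s)"
      using s by (auto intro!: derivative_eq_intros simp: pqr)
    have dc: "((\<lambda>s. ln (1 + s)) has_field_derivative q) (at s)"
      using s by (auto intro!: derivative_eq_intros simp: pqr)
    have "(E has_field_derivative
       ((- p + q) / 2 * (s * a + (1 - s) * (b + c) / 2 - c + ln 2)
        + ((1 * a + r * s) + ((0 - 1) * (b + c) + (- p + q) * (1 - s)) / 2 - q + 0) * ((b + c) / 2)
        - (1 * a + r * s) + (r * c + q * a) / 2
        + (((1 + 0) * c + q * (s + 1)) - ((0 - 1) * b + - p * (1 - s))) / 2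
        - (2 * c * q) / 4
        - ((q - 0) * b + - p * (c - ln 2)) / 2 + (2 * (c - ln 2) * q) / 4)) (at s)"
      unfolding E_def abc
    proof (intro DERIV_diff DERIV_add DERIV_cdivide DERIV_mult da db dc DERIV_const DERIV_ident)
      show "((\<lambda>s. (ln (1 + s))\<^sup>2) has_field_derivative 2 * ln (1 + s) * q) (at s)"
        by (rule derivative_eq_intros dc refl)+ simp
      have "((\<lambda>s. ln (1 + s) - ln 2) has_field_derivative q) (at s)"
        using DERIV_diff[OF dc DERIV_const[of "ln 2"]] by simp
      thus "((\<lambda>s. (ln (1 + s) - ln 2)\<^sup>2) has_field_derivative 2 * (ln (1 + s) - ln 2) * q) (at s)"
        by (rule derivative_eq_intros refl)+ simp
    qed
    thus ?thesis unfolding abc[symmetric]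
    proof (rule DERIV_cong)
      have e: "p * (1 - s) = 1" "q * (1 + s) = 1" "r * s = 1" using s by (auto simp: pqr)
      have d: "a / (1 - s) = a * p" "c / s = c * r" "(c - ln 2) / (1 - s) = (c - ln 2) * p"
        by (simp_all add: pqr)
      have ps: "p * s = p - 1" "q * s = 1 - q" using e by (simp_all add: algebra_simps)
      have t0: "(- p + q) * s = 2 - p - q" "(- p + q) * (1 - s) = 2 * q - 2"
        using ps by (simp_all add: algebra_simps)
      have "(- p + q) / 2 * (s * a + (1 - s) * (b + c) / 2 - c + ln 2) =
          ((- p + q) * s) * a / 2 + ((- p + q) * (1 - s)) * (b + c) / 4 + (- p + q) * (ln 2 - c) / 2"
        by (simp add: field_simps)
      hence t1: "(- p + q) / 2 * (s * a + (1 - s) * (b + c) / 2 - c + ln 2) =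
          (2 - p - q) * a / 2 + (2 * q - 2) * (b + c) / 4 + (- p + q) * (ln 2 - c) / 2"
        unfolding t0 .
      have t2: "q * (s + 1) = 1" "- p * (1 - s) = - 1" using e by (simp_all add: algebra_simps)
      show "(- p + q) / 2 * (s * a + (1 - s) * (b + c) / 2 - c + ln 2)
        + ((1 * a + r * s) + ((0 - 1) * (b + c) + (- p + q) * (1 - s)) / 2 - q + 0) * ((b + c) / 2)
        - (1 * a + r * s) + (r * c + q * a) / 2
        + (((1 + 0) * c + q * (s + 1)) - ((0 - 1) * b + - p * (1 - s))) / 2
        - (2 * c * q) / 4
        - ((q - 0) * b + - p * (c - ln 2)) / 2 + (2 * (c - ln 2) * q) / 4 =
        (b + c) / 2 * (a - (b + c) / 2) - (a / (1 - s) / 2 - c / s / 2 - (c - ln 2) / (1 - s))"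
        unfolding d t1 t0 t2 e(3) by (simp add: field_simps)
    qed
  qed
  have "((\<lambda>t. P (sin t) + E (sin t)) has_vector_derivative cos t * ln (cos t) * ln (tan t)) (at t)"
    if t: "t \<in> {0<..<pi/2}" for t
  proof -
    have pos: "sin t > 0" "cos t > 0" using t by (auto intro!: cos_gt_zero sin_gt_zero)
    have "sin t < sin (pi / 2)" using t by (intro sin_monotone_2pi) auto
    hence s: "sin t \<in> {0<..<1}" using pos by simp
    have "(1 - sin t) * (1 + sin t) = (cos t)\<^sup>2"
      using sin_cos_squared_add[of t] by (simp add: power2_eq_square algebra_simps)
    hence "ln ((1 - sin t) * (1 + sin t)) = 2 * ln (cos t)" using pos by (simp add: ln_realpow)
    hence l: "ln (1 - sin t) + ln (1 + sin t) = 2 * ln (cos t)" using s by (simp add: ln_mult_pos)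
    have "ln (tan t) = ln (sin t) - ln (cos t)" unfolding tan_def using pos by (simp add: ln_div)
    moreover have "((\<lambda>s. P s + E s) has_field_derivative (ln (1 - sin t) + ln (1 + sin t)) / 2 * (ln (sin t) - (ln (1 - sin t) + ln (1 + sin t)) / 2)) (at (sin t))"
      using DERIV_add[OF dP[OF s] dE[OF s]] by simp
    from DERIV_chain2[OF this DERIV_sin] 
    have "((\<lambda>t. P (sin t) + E (sin t)) has_field_derivative ln (cos t) * (ln (sin t) - ln (cos t)) * cos t) (at t)"
      unfolding l by simp
    ultimately show ?thesis
      by (simp add: has_real_derivative_iff_has_vector_derivative mult_ac)
  qed
  moreover have "continuous_on {0..pi/2} (\<lambda>t. P (sin t) + E (sin t))"
  proof -
    have "norm (1 - complex_of_real x) = \<bar>1 - x\<bar>" for x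
      by (metis norm_of_real of_real_1 of_real_diff)
    hence "continuous_on {0..1} P"
      unfolding P_def r_def by (intro continuous_intros) (auto simp: norm_divide)
    moreover have "continuous_on {0..1} E"
    \<comment> \<open>Every logarithm singular at an endpoint carries a factor 0 there, so the
      values of \<open>E\<close> at 0 and 1 agree with its limits.\<close>
    proof (rule continuous_on_IccI)
      have "(E \<longlongrightarrow> (ln 2)\<^sup>2 / 4) (at_right 0)" unfolding E_def by real_asymp
      thus "(E \<longlongrightarrow> E 0) (at_right 0)" by (simp add: E_def)
      have "(E \<longlongrightarrow> ln 2 - (ln 2)\<^sup>2 / 4) (at_left 1)" unfolding E_def by real_asymp
      thus "(E \<longlongrightarrow> E 1) (at_left 1)" by (simp add: E_def)
      show "(E \<longlongrightarrow> E s) (at s)" if "0 < s" "s < 1" for s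
        using DERIV_isCont[OF dE[of s]] that by (simp add: isCont_def)
    qed auto
    ultimately have "continuous_on {0..1} (\<lambda>s. P s + E s)" by (rule continuous_on_add)
    thus ?thesis
      by (rule continuous_on_compose2) (auto intro!: continuous_intros sin_ge_zero)
  qed
  ultimately have "((\<lambda>t. cos t * ln (cos t) * ln (tan t)) has_integral
      (P (sin (pi / 2)) + E (sin (pi / 2))) - (P (sin 0) + E (sin 0))) {0..pi/2}"
    by (intro fundamental_theorem_of_calculus_interior) auto
  moreover have "r 1 = pi\<^sup>2 / 6" "r (- 1) = - (pi\<^sup>2 / 12)" "r (1 / 2) = pi\<^sup>2 / 12 - (ln 2)\<^sup>2 / 2" "r 0 = 0"
    using arg_cong[OF polylog_2_half, of Re] by (simp_all add: r_def polylog_2_1 polylog_2_minus_1)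
  hence "P 1 = - pi\<^sup>2 / 24" "P 0 = (ln 2)\<^sup>2 / 2" by (simp_all add: P_def)
  ultimately show ?thesis by (simp add: E_def)
qed

text \<open>The plain \<open>ln 2\<close> cancels between the two integrals.\<close>

lemma has_integral_ln_tan_combination:
  "((\<lambda>t. ln (tan t) * (cos t * ln (cos t) + t * sin t)) has_integral
     2 * catalan_constant - pi\<^sup>2 / 24 - (ln 2)\<^sup>2) {0..pi/2}"
  using has_integral_add[OF has_integral_cos_ln_cos_ln_tan has_integral_theta_sin_ln_tan]
  by (simp add: algebra_simps)


subsection \<open>Generating functions\<close>

definition central_coeff :: "nat \<Rightarrow> real" where
  "central_coeff k = real ((2 * k) choose k) / 4 ^ k"

lemma central_coeff_0 [simp]: "central_coeff 0 = 1"
  by (simp add: central_coeff_def)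

lemma central_coeff_Suc: "central_coeff (Suc k) = (2 * real k + 1) / (2 * real k + 2) * central_coeff k"
proof -
  have "real (Suc k) * real ((2 * Suc k) choose Suc k) = 2 * (2 * real k + 1) * real ((2 * k) choose k)"
  proof -
    have "Suc k * ((2 * Suc k) choose Suc k) = Suc (2 * k + 1) * ((2 * k + 1) choose k)"
      using Suc_times_binomial[of k "2 * k + 1"] by simp
    also have "(2 * k + 1) choose k = (2 * k + 1) choose (Suc k)"
      using binomial_symmetric[of k "2 * k + 1"] by simp
    also have "Suc (2 * k + 1) * \<dots> = 2 * (Suc k * (Suc (2 * k) choose (Suc k)))" by simp
    also have "Suc k * (Suc (2 * k) choose (Suc k)) = Suc (2 * k) * ((2 * k) choose k)"
      by (rule Suc_times_binomial)
    finally have "Suc k * ((2 * Suc k) choose Suc k) = 2 * (Suc (2 * k) * ((2 * k) choose k))" .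
    from arg_cong[OF this, of real] show ?thesis by (simp only: of_nat_mult of_nat_Suc of_nat_numeral) simp
  qed
  moreover have "x / 4 ^ Suc k = (2 * real k + 1) / (2 * real k + 2) * (y / 4 ^ k)"
    if "real (Suc k) * x = 2 * (2 * real k + 1) * y" for x y
  proof -
    have "x / (4 * P) = m / (2 * n) * (y / P)" if "n * x = 2 * m * y" "n > 0" for m n P :: real
    proof -
      have "x = 2 * m * y / n" using that by (simp add: field_simps)
      thus ?thesis by simp
    qed
    from this[OF that, of "4 ^ k"] show ?thesis by simp
  qed
  ultimately show ?thesis unfolding central_coeff_def by blast
qed

lemma central_coeff_pos: "central_coeff k > 0"
  by (simp add: central_coeff_def)

lemma central_coeff_le_1: "central_coeff k \<le> 1"
proof (induction k)
  case (Suc k)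
  have "(2 * real k + 1) / (2 * real k + 2) * central_coeff k \<le> 1 * 1"
    using Suc central_coeff_pos[of k] by (intro mult_mono) auto
  thus ?case by (simp add: central_coeff_Suc)
qed simp

lemma odd_harmonic_0 [simp]: "odd_harmonic 0 = 0"
  by (simp add: odd_harmonic_def)

lemma odd_harmonic_Suc: "odd_harmonic (Suc k) = odd_harmonic k + 1 / (2 * real k + 1)"
  by (simp add: odd_harmonic_def)

lemma odd_harmonic_nonneg: "odd_harmonic k \<ge> 0"
  by (induction k) (simp_all add: odd_harmonic_Suc)

lemma odd_harmonic_le: "odd_harmonic k \<le> real k"
proof (induction k)
  case (Suc k)
  have "1 / (2 * real k + 1) \<le> 1" by simp
  thus ?case using Suc unfolding odd_harmonic_Suc of_nat_Suc by linarith
qed simp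

section \<open>Power series identified by first-order equations\<close>

text \<open>The linear coefficient bound is the common hypothesis of what follows: generous enough
  for \<open>central_coeff k * odd_harmonic k\<close>, and sufficient for convergence when
  \<open>|y| < 1\<close>.\<close>

lemma summable_powser_le:
  fixes y :: real
  assumes "\<bar>y\<bar> < 1" "\<And>k. \<bar>c k\<bar> \<le> real (Suc k)"
  shows "summable (\<lambda>k. c k * y ^ k)"
proof (rule summable_comparison_test')
  show "summable (\<lambda>k. real (Suc k) * \<bar>y\<bar> ^ k)"
    using geometric_deriv_sums[of "\<bar>y\<bar>"] assms(1) by (simp add: sums_iff)
  show "norm (c k * y ^ k) \<le> real (Suc k) * \<bar>y\<bar> ^ k" for k
    using assms(2)[of k] by (simp add: abs_mult power_abs mult_right_mono)
qed

lemma powser_deriv: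
  fixes c :: "nat \<Rightarrow> real" and y :: real
  assumes "\<bar>y\<bar> < 1" "\<And>k. \<bar>c k\<bar> \<le> real (Suc k)"
  obtains f' where "((\<lambda>y. \<Sum>k. c k * y ^ k) has_field_derivative f') (at y)"
    "(\<lambda>k. real (Suc k) * c (Suc k) * y ^ k) sums f'"
    "(\<lambda>k. real k * c k * y ^ k) sums (y * f')"
proof -
  define f' where "f' = (\<Sum>k. diffs c k * y ^ k)"
  have sm: "summable (\<lambda>k. c k * x ^ k)" if "norm x < 1" for x
    using summable_powser_le[of x c] that assms(2) by simp
  have "((\<lambda>y. \<Sum>k. c k * y ^ k) has_field_derivative f') (at y)"
    unfolding f'_def by (rule termdiffs_strong'[where K = 1]) (use sm assms in auto)
  moreover have "summable (\<lambda>k. diffs c k * y ^ k)"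
    by (rule termdiff_converges[of _ 1]) (use sm assms in auto)
  hence s: "(\<lambda>k. real (Suc k) * c (Suc k) * y ^ k) sums f'"
    unfolding f'_def by (simp add: diffs_def summable_sums)
  moreover have "(\<lambda>k. real (Suc k) * c (Suc k) * y ^ Suc k) sums (y * f')"
    using sums_mult[OF s, of y] by (simp add: mult_ac)
  hence "(\<lambda>k. real k * c k * y ^ k) sums (y * f')"
    by (subst (asm) sums_Suc_iff) simp
  ultimately show ?thesis using that by blast
qed

text \<open>For the sum \<open>f\<close> the recurrence says \<open>(1 - y) f' = f / 2 + D\<close>,
  and \<open>sqrt (1 - y)\<close> is the integrating factor.\<close>

lemma powser_ode:
  fixes c d :: "nat \<Rightarrow> real"
  assumes y: "\<bar>y\<bar> < 1" and c: "\<And>k. \<bar>c k\<bar> \<le> real (Suc k)"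
    and rec: "\<And>k. real (Suc k) * c (Suc k) = (real k + 1 / 2) * c k + d k"
    and d: "(\<lambda>k. d k * y ^ k) sums D"
  shows "((\<lambda>y. sqrt (1 - y) * (\<Sum>k. c k * y ^ k)) has_field_derivative D / sqrt (1 - y)) (at y)"
proof -
  obtain f' where f': "((\<lambda>y. \<Sum>k. c k * y ^ k) has_field_derivative f') (at y)"
    "(\<lambda>k. real (Suc k) * c (Suc k) * y ^ k) sums f'"
    "(\<lambda>k. real k * c k * y ^ k) sums (y * f')"
    using powser_deriv[OF y c] by blast
  define f where "f = (\<Sum>k. c k * y ^ k)"
  have f: "(\<lambda>k. c k * y ^ k) sums f"
    unfolding f_def by (intro summable_sums summable_powser_le y c)
  have "(\<lambda>k. real k * c k * y ^ k + 1 / 2 * (c k * y ^ k) + d k * y ^ k) sums (y * f' + 1 / 2 * f + D)"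
    by (intro sums_add sums_mult f' f d)
  also have "(\<lambda>k. real k * c k * y ^ k + 1 / 2 * (c k * y ^ k) + d k * y ^ k) = (\<lambda>k. real (Suc k) * c (Suc k) * y ^ k)"
    unfolding rec by (simp add: fun_eq_iff algebra_simps)
  finally have ode: "f' = y * f' + f / 2 + D"
    using f'(2) by (simp add: sums_iff)
  have s: "sqrt (1 - y) > 0" "(sqrt (1 - y))\<^sup>2 = 1 - y" using y by auto
  have "((\<lambda>y. sqrt (1 - y)) has_field_derivative - 1 / (2 * sqrt (1 - y))) (at y)"
    using y by (auto intro!: derivative_eq_intros simp: field_simps)
  from DERIV_mult[OF this f'(1)]
  have "((\<lambda>y. sqrt (1 - y) * (\<Sum>k. c k * y ^ k)) has_field_derivative
      - 1 / (2 * sqrt (1 - y)) * f + f' * sqrt (1 - y)) (at y)" by (simp add: f_def)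
  moreover have "- 1 / (2 * sqrt (1 - y)) * f + f' * sqrt (1 - y) = ((sqrt (1 - y))\<^sup>2 * f' - f / 2) / sqrt (1 - y)"
    using s(1) by (simp add: field_simps power2_eq_square)
  moreover have "(sqrt (1 - y))\<^sup>2 * f' - f / 2 = D" unfolding s(2) using ode by (simp add: algebra_simps)
  ultimately show ?thesis by simp
qed

lemma powser_ode_unique:
  fixes c d :: "nat \<Rightarrow> real"
  assumes y: "0 \<le> y" "y < 1" and c: "\<And>k. \<bar>c k\<bar> \<le> real (Suc k)"
    and rec: "\<And>k. real (Suc k) * c (Suc k) = (real k + 1 / 2) * c k + d k"
    and d: "\<And>y. \<bar>y\<bar> < 1 \<Longrightarrow> (\<lambda>k. d k * y ^ k) sums D y"
    and E: "\<And>y. 0 \<le> y \<Longrightarrow> y < 1 \<Longrightarrow> (E has_field_derivative D y / sqrt (1 - y)) (at y)"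
    and E0: "E 0 = c 0"
  shows "(\<lambda>k. c k * y ^ k) sums (E y / sqrt (1 - y))"
proof -
  define F where "F y = sqrt (1 - y) * (\<Sum>k. c k * y ^ k) - E y" for y
  have dF: "(F has_field_derivative 0) (at x)" if "0 \<le> x" "x < 1" for x
    using DERIV_diff[OF powser_ode[of x c d "D x"] E[of x]] that c rec d unfolding F_def by auto
  have "F y = F 0"
  proof (cases "y = 0")
    case False
    show ?thesis
    proof (rule DERIV_isconst_end[where f = F and a = 0 and b = y])
      show "0 < y" using False y by simp
      have "isCont F x" if "x \<in> {0..y}" for x
        using dF[of x] that y by (auto intro: DERIV_isCont)
      thus "continuous_on {0..y} F" by (intro continuous_at_imp_continuous_on) auto
    qed (use dF y in auto)
  qed auto
  moreover have "F 0 = 0"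
    using suminf_finite[of "{0}" "\<lambda>k. c k * 0 ^ k"] by (simp add: F_def E0)
  ultimately have "sqrt (1 - y) * (\<Sum>k. c k * y ^ k) = E y" by (simp add: F_def)
  hence "(\<Sum>k. c k * y ^ k) = E y / sqrt (1 - y)" using y by (simp add: field_simps)
  moreover have "summable (\<lambda>k. c k * y ^ k)" using y c by (intro summable_powser_le) auto
  ultimately show ?thesis by (simp add: sums_iff)
qed

lemma central_coeff_bound: "\<bar>central_coeff k\<bar> \<le> real (Suc k)"
  using central_coeff_le_1[of k] central_coeff_pos[of k] by simp

lemma central_coeff_odd_harmonic_bound: "\<bar>central_coeff k * odd_harmonic k\<bar> \<le> real (Suc k)"
proof -
  have "central_coeff k * odd_harmonic k \<le> 1 * real k"
    using central_coeff_le_1[of k] central_coeff_pos[of k] odd_harmonic_le[of k] odd_harmonic_nonneg[of k]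
    by (intro mult_mono) auto
  thus ?thesis
    using central_coeff_pos[of k] odd_harmonic_nonneg[of k] by simp
qed

lemma central_coeff_sums:
  assumes "0 \<le> y" "y < 1"
  shows "(\<lambda>k. central_coeff k * y ^ k) sums (1 / sqrt (1 - y))"
proof (rule powser_ode_unique[where d = "\<lambda>_. 0" and D = "\<lambda>_. 0"])
  show "real (Suc k) * central_coeff (Suc k) = (real k + 1 / 2) * central_coeff k + 0" for k
    by (simp add: central_coeff_Suc field_simps)
qed (use assms central_coeff_bound in auto)

text \<open>Since \<open>central_coeff (Suc k) / (2 k + 1) = central_coeff k / (2 k + 2)\<close>,
  the increment of \<open>odd_harmonic\<close> adds \<open>central_coeff k / 2\<close> to the
  recurrence: the equation is driven by half the series of \<open>central_coeff\<close>.\<close>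

lemma central_coeff_odd_harmonic_sums:
  assumes "0 \<le> y" "y < 1"
  shows "(\<lambda>k. central_coeff k * odd_harmonic k * y ^ k) sums (- ln (1 - y) / 2 / sqrt (1 - y))"
proof (rule powser_ode_unique[where d = "\<lambda>k. 1 / 2 * central_coeff k" and D = "\<lambda>y. 1 / 2 * (\<Sum>k. central_coeff k * y ^ k)"])
  show "real (Suc k) * (central_coeff (Suc k) * odd_harmonic (Suc k)) =
      (real k + 1 / 2) * (central_coeff k * odd_harmonic k) + 1 / 2 * central_coeff k" for k
  proof -
    have "(m + 1) / 2 * (m / (m + 1) * b * (h + 1 / m)) = m / 2 * (b * h) + 1 / 2 * b" if "m > 0" for m b h :: real
    proof -
      have "n / 2 * (m / n * b * (h + 1 / m)) = m / 2 * b * h + 1 / 2 * b" if "n > 0" for n :: real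
        using that \<open>m > 0\<close> by (simp add: field_simps)
      from this[of "m + 1"] show ?thesis using that by simp
    qed
    moreover have "(2 * real k + 1 + 1) / 2 = real (Suc k)" "2 * real k + 1 + 1 = 2 * real k + 2"
      "(2 * real k + 1) / 2 = real k + 1 / 2" by (simp_all add: field_simps)
    ultimately show ?thesis
      unfolding central_coeff_Suc odd_harmonic_Suc
      by (metis (no_types, lifting) add_nonneg_pos mult_nonneg_nonneg of_nat_0_le_iff zero_le_numeral zero_less_one)
  qed
  show "(\<lambda>k. 1 / 2 * central_coeff k * x ^ k) sums (1 / 2 * (\<Sum>k. central_coeff k * x ^ k))" if "\<bar>x\<bar> < 1" for x
    unfolding mult.assoc by (intro sums_mult summable_sums summable_powser_le that central_coeff_bound)
  show "((\<lambda>y. - ln (1 - y) / 2) has_field_derivative 1 / 2 * (\<Sum>k. central_coeff k * x ^ k) / sqrt (1 - x)) (at x)"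
    if x: "0 \<le> x" "x < 1" for x
  proof -
    have "(\<Sum>k. central_coeff k * x ^ k) = 1 / sqrt (1 - x)"
      using central_coeff_sums[OF x] by (simp add: sums_iff)
    moreover have "((\<lambda>y. - ln (1 - y) / 2) has_field_derivative 1 / (2 * (1 - x))) (at x)"
      using x by (auto intro!: derivative_eq_intros simp: field_simps)
    moreover have "1 / 2 * (1 / s) / s = 1 / (2 * (s * s))" for s :: real by simp
    from this[of "sqrt (1 - x)"] have "1 / 2 * (1 / sqrt (1 - x)) / sqrt (1 - x) = 1 / (2 * (1 - x))"
      using x by simp
    ultimately show ?thesis by (simp only:)
  qed
qed (use assms central_coeff_odd_harmonic_bound in auto)

text \<open>The outer factor \<open>s\<close> makes the powers \<open>s^(2k+1)\<close>, whose
  derivatives cancel the denominators.\<close>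

lemma odd_powser_deriv:
  fixes c :: "nat \<Rightarrow> real"
  assumes s: "\<bar>s\<bar> < 1" and c: "\<And>k. \<bar>c k\<bar> \<le> real (Suc k)"
  shows "((\<lambda>s. s * (\<Sum>k. c k / (2 * real k + 1) * (s\<^sup>2) ^ k)) has_field_derivative (\<Sum>k. c k * (s\<^sup>2) ^ k)) (at s)"
proof -
  have s2: "\<bar>s\<^sup>2\<bar> < 1" using s by (simp add: abs_square_less_1)
  define e where "e k = c k / (2 * real k + 1)" for k
  have e: "\<bar>e k\<bar> \<le> real (Suc k)" for k
  proof -
    have "\<bar>e k\<bar> \<le> \<bar>c k\<bar> / 1" unfolding e_def abs_divide by (intro divide_left_mono) auto
    thus ?thesis using c[of k] by simp
  qed
  obtain f' where f': "((\<lambda>y. \<Sum>k. e k * y ^ k) has_field_derivative f') (at (s\<^sup>2))"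
    "(\<lambda>k. real k * e k * (s\<^sup>2) ^ k) sums (s\<^sup>2 * f')"
    using powser_deriv[OF s2 e] by blast
  have "((\<lambda>s. s\<^sup>2) has_field_derivative 2 * s) (at s)" by (auto intro!: derivative_eq_intros)
  from DERIV_mult[OF DERIV_ident DERIV_chain2[OF f'(1) this]]
  have "((\<lambda>s. s * (\<Sum>k. e k * (s\<^sup>2) ^ k)) has_field_derivative
      1 * (\<Sum>k. e k * (s\<^sup>2) ^ k) + f' * (2 * s) * s) (at s)" .
  moreover have "(\<lambda>k. e k * (s\<^sup>2) ^ k + 2 * (real k * e k * (s\<^sup>2) ^ k)) sums
      ((\<Sum>k. e k * (s\<^sup>2) ^ k) + 2 * (s\<^sup>2 * f'))"
    by (intro sums_add sums_mult f' summable_sums summable_powser_le e s2)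
  hence "(\<lambda>k. c k * (s\<^sup>2) ^ k) sums ((\<Sum>k. e k * (s\<^sup>2) ^ k) + 2 * (s\<^sup>2 * f'))"
  proof (rule sums_cong[THEN iffD1, rotated])
    fix k
    have "c k = e k * (2 * real k + 1)" unfolding e_def by (simp add: add_nonneg_eq_0_iff)
    thus "e k * (s\<^sup>2) ^ k + 2 * (real k * e k * (s\<^sup>2) ^ k) = c k * (s\<^sup>2) ^ k"
      by (simp add: algebra_simps)
  qed
  ultimately show ?thesis
    by (simp add: sums_iff e_def power2_eq_square mult_ac)
qed

text \<open>Only \<open>0 < x < 1\<close> and the limit at 0 are asked of \<open>E\<close>, because
  one closed form used below contains a division by \<open>x\<close>.\<close>

lemma odd_powser_unique:
  fixes c :: "nat \<Rightarrow> real"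
  assumes s: "0 < s" "s < 1" and c: "\<And>k. \<bar>c k\<bar> \<le> real (Suc k)"
    and C: "\<And>x. 0 < x \<Longrightarrow> x < 1 \<Longrightarrow> (\<lambda>k. c k * (x\<^sup>2) ^ k) sums C x"
    and E: "\<And>x. 0 < x \<Longrightarrow> x < 1 \<Longrightarrow> (E has_field_derivative C x) (at x)"
    and E0: "(E \<longlongrightarrow> 0) (at_right 0)"
  shows "(\<lambda>k. c k / (2 * real k + 1) * (s\<^sup>2) ^ k) sums (E s / s)"
proof -
  define f where "f = (\<lambda>s. s * (\<Sum>k. c k / (2 * real k + 1) * (s\<^sup>2) ^ k))"
  \<comment> \<open>Patched at 0, so that no value of \<open>E\<close> there enters.\<close>
  define F where "F = (\<lambda>s. if s = 0 then 0 else f s - E s)"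
  have df: "(f has_field_derivative (\<Sum>k. c k * (x\<^sup>2) ^ k)) (at x)" if "\<bar>x\<bar> < 1" for x
    unfolding f_def by (rule odd_powser_deriv[OF that c])
  have dF: "(F has_field_derivative 0) (at x)" if x: "0 < x" "x < 1" for x
  proof -
    have "((\<lambda>s. f s - E s) has_field_derivative 0) (at x)"
      using DERIV_diff[OF df[of x] E[OF x]] x sums_unique[OF C[OF x]] by simp
    moreover have "eventually (\<lambda>s. s \<in> {0<..}) (nhds x)"
      using x by (intro eventually_nhds_in_open) auto
    hence "eventually (\<lambda>s. F s = f s - E s) (nhds x)"
      by eventually_elim (auto simp: F_def)
    ultimately show ?thesis by (subst DERIV_cong_ev[OF refl _ refl])
  qed
  have "F s = F 0"
  proof (rule DERIV_isconst_end[where f = F and a = 0 and b = s])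
    show "continuous_on {0..s} F"
    proof (rule continuous_on_Icc_left)
      have "isCont F x" if "x \<in> {0<..s}" for x
        using dF[of x] that s by (auto intro: DERIV_isCont)
      thus "continuous_on {0<..s} F" by (intro continuous_at_imp_continuous_on) auto
      have "(f \<longlongrightarrow> f 0) (at 0)" using DERIV_isCont[OF df[of 0]] by (simp add: isCont_def)
      hence "(f \<longlongrightarrow> 0) (at_right 0)" by (simp add: f_def filterlim_at_split)
      from tendsto_diff[OF this E0] have "((\<lambda>s. f s - E s) \<longlongrightarrow> 0) (at_right 0)" by simp
      moreover have "eventually (\<lambda>s. f s - E s = F s) (at_right 0)"
        unfolding F_def by (auto simp: eventually_at intro!: exI[of _ 1])
      ultimately show "(F \<longlongrightarrow> F 0) (at_right 0)"
        using Lim_transform_eventually by (fastforce simp: F_def)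
    qed (use s in auto)
  qed (use dF s in auto)
  hence "f s = E s" using s by (simp add: F_def)
  hence "(\<Sum>k. c k / (2 * real k + 1) * (s\<^sup>2) ^ k) = E s / s"
    using s by (simp add: f_def field_simps)
  moreover have "summable (\<lambda>k. c k / (2 * real k + 1) * (s\<^sup>2) ^ k)"
  proof (rule summable_powser_le)
    show "\<bar>s\<^sup>2\<bar> < 1" using s by (simp add: abs_square_less_1)
    show "\<bar>c k / (2 * real k + 1)\<bar> \<le> real (Suc k)" for k
    proof -
      have "\<bar>c k / (2 * real k + 1)\<bar> \<le> \<bar>c k\<bar> / 1" unfolding abs_divide by (intro divide_left_mono) auto
      thus ?thesis using c[of k] by simp
    qed
  qed
  ultimately show ?thesis by (simp add: sums_iff)
qed


subsection \<open>Moments\<close>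

lemma sin_cos_bounds_Ioo:
  assumes "t \<in> {0<..<pi/2}"
  shows "0 < sin t" "sin t < 1" "0 < cos t" "0 < tan t" "0 < tan (t / 2)" "tan (t / 2) < 1"
proof -
  show "0 < sin t" "0 < cos t" using assms by (auto intro!: cos_gt_zero sin_gt_zero)
  have "sin t < sin (pi / 2)" using assms by (intro sin_monotone_2pi) auto
  thus "sin t < 1" by simp
  show "0 < tan t" "0 < tan (t / 2)" using assms by (auto intro!: tan_gt_zero)
  have "tan (t / 2) < tan (pi / 4)" using assms by (intro tan_monotone) auto
  thus "tan (t / 2) < 1" by (simp add: tan_45)
qed

lemma central_coeff_odd_harmonic_sin_sums:
  assumes t: "t \<in> {0<..<pi/2}"
  shows "(\<lambda>k. central_coeff k * odd_harmonic k * sin t ^ (2 * k)) sums (- ln (cos t) / cos t)"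
proof -
  note b = sin_cos_bounds_Ioo[OF t]
  have c: "1 - (sin t)\<^sup>2 = (cos t)\<^sup>2" by (simp add: cos_squared_eq)
  have "(sin t)\<^sup>2 < 1" using b by (simp add: power_less_one_iff)
  from central_coeff_odd_harmonic_sums[OF _ this] show ?thesis
    unfolding c using b by (simp add: ln_realpow power_mult)
qed

lemma central_coeff_arcsin_sin_sums:
  assumes t: "t \<in> {0<..<pi/2}"
  shows "(\<lambda>k. central_coeff k / (2 * real k + 1) * sin t ^ (2 * k)) sums (t / sin t)"
proof -
  note b = sin_cos_bounds_Ioo[OF t]
  have "(\<lambda>k. central_coeff k / (2 * real k + 1) * ((sin t)\<^sup>2) ^ k) sums (arcsin (sin t) / sin t)"
  proof (rule odd_powser_unique[where C = "\<lambda>x. 1 / sqrt (1 - x\<^sup>2)"])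
    fix x :: real assume x: "0 < x" "x < 1"
    hence "x\<^sup>2 < 1" by (simp add: power_less_one_iff)
    thus "(\<lambda>k. central_coeff k * (x\<^sup>2) ^ k) sums (1 / sqrt (1 - x\<^sup>2))"
      by (intro central_coeff_sums) auto
    show "(arcsin has_field_derivative 1 / sqrt (1 - x\<^sup>2)) (at x)"
      using x by (auto intro!: derivative_eq_intros simp: inverse_eq_divide)
  next
    have "isCont arcsin 0" by (rule isCont_arcsin) auto
    hence "(arcsin \<longlongrightarrow> 0) (at 0)" by (simp add: isCont_def)
    thus "(arcsin \<longlongrightarrow> 0) (at_right 0)" by (simp add: filterlim_at_split)
  qed (use b central_coeff_bound in auto)
  moreover have "arcsin (sin t) = t" using t by (intro arcsin_sin) auto
  ultimately show ?thesis by (simp add: power_mult)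
qed

text \<open>As \<open>odd_harmonic 0 = 0\<close>, the series starts at \<open>k = 1\<close>, and the
  shift to \<open>Suc k\<close> turns \<open>2 k - 1\<close> into \<open>2 k + 1\<close>. The
  generating function of \<open>central_coeff k * odd_harmonic k\<close>, divided by
  \<open>x^2\<close>, is then integrated.\<close>

lemma central_coeff_shifted_sin_sums:
  assumes t: "t \<in> {0<..<pi/2}"
  shows "(\<lambda>k. central_coeff k * odd_harmonic k / (2 * real k - 1) * sin t ^ (2 * k)) sums (cos t * ln (cos t) + t * sin t)"
proof -
  note b = sin_cos_bounds_Ioo[OF t]
  define c where "c k = central_coeff (Suc k) * odd_harmonic (Suc k)" for k
  \<comment> \<open>By parts, since \<open>- sqrt (1 - x^2) / x\<close> is a primitive of
    \<open>1 / (x^2 sqrt (1 - x^2))\<close>; the remaining integral is the arcsine.\<close>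
  define E where "E = (\<lambda>x. sqrt (1 - x\<^sup>2) * (ln (1 - x\<^sup>2) / 2) / x + arcsin x)"
  have "(\<lambda>k. c k / (2 * real k + 1) * ((sin t)\<^sup>2) ^ k) sums (E (sin t) / sin t)"
  proof (rule odd_powser_unique[where C = "\<lambda>x. - ln (1 - x\<^sup>2) / 2 / sqrt (1 - x\<^sup>2) / x\<^sup>2"])
    show "\<bar>c k\<bar> \<le> real (Suc k)" for k
    proof -
      have "c k \<le> 1 * real (Suc k)"
        using central_coeff_le_1[of "Suc k"] central_coeff_pos[of "Suc k"] odd_harmonic_le[of "Suc k"] odd_harmonic_nonneg[of "Suc k"]
        unfolding c_def by (intro mult_mono) auto
      moreover have "c k \<ge> 0"
        using central_coeff_pos[of "Suc k"] odd_harmonic_nonneg[of "Suc k"] by (simp add: c_def)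
      ultimately show ?thesis by simp
    qed
    fix x :: real assume x: "0 < x" "x < 1"
    hence x2: "x\<^sup>2 < 1" by (simp add: power_less_one_iff)
    hence "(\<lambda>k. central_coeff k * odd_harmonic k * (x\<^sup>2) ^ k) sums (- ln (1 - x\<^sup>2) / 2 / sqrt (1 - x\<^sup>2))"
      by (intro central_coeff_odd_harmonic_sums) auto
    hence "(\<lambda>k. c k * (x\<^sup>2) ^ Suc k) sums (- ln (1 - x\<^sup>2) / 2 / sqrt (1 - x\<^sup>2))"
      unfolding c_def by (subst sums_Suc_iff[where f = "\<lambda>k. central_coeff k * odd_harmonic k * (x\<^sup>2) ^ k"]) simp
    from sums_divide[OF this, of "x\<^sup>2"]
    show "(\<lambda>k. c k * (x\<^sup>2) ^ k) sums (- ln (1 - x\<^sup>2) / 2 / sqrt (1 - x\<^sup>2) / x\<^sup>2)"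
      using x by simp
    define q where "q = sqrt (1 - x\<^sup>2)"
    have q: "q > 0" "q\<^sup>2 = 1 - x\<^sup>2" using x2 by (auto simp: q_def)
    have dq: "((\<lambda>x. sqrt (1 - x\<^sup>2)) has_field_derivative - x / q) (at x)"
      using x2 by (auto intro!: derivative_eq_intros simp: q_def field_simps)
    have dl: "((\<lambda>x. ln (1 - x\<^sup>2) / 2) has_field_derivative - x / q\<^sup>2) (at x)"
      using x2 unfolding q by (auto intro!: derivative_eq_intros simp: field_simps)
    have da: "(arcsin has_field_derivative 1 / q) (at x)"
      using x by (auto intro!: derivative_eq_intros simp: q_def inverse_eq_divide)
    have nz: "x \<noteq> 0" using x by simp
    have "(E has_field_derivative
        ((- x / q * (ln (1 - x\<^sup>2) / 2) + - x / q\<^sup>2 * q) * x - q * (ln (1 - x\<^sup>2) / 2) * 1) / (x * x) + 1 / q) (at x)"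
      unfolding E_def
      by (rule DERIV_add[OF DERIV_divide[OF DERIV_mult[OF dq dl] DERIV_ident nz] da, folded q_def])
    moreover have "((- x / q * l + - x / q\<^sup>2 * q) * x - q * l * 1) / (x * x) + 1 / q = - l / q / x\<^sup>2" for l
    proof -
      have "((- x / q * l + - x / q\<^sup>2 * q) * x - q * l * 1) / (x * x) + 1 / q = - l * (x\<^sup>2 + q\<^sup>2) / q / x\<^sup>2"
        using x q(1) by (simp add: field_simps power2_eq_square)
      thus ?thesis unfolding q(2) by simp
    qed
    ultimately show "(E has_field_derivative - ln (1 - x\<^sup>2) / 2 / sqrt (1 - x\<^sup>2) / x\<^sup>2) (at x)"
      unfolding q_def[symmetric] by (simp only:) simp
  next
    have "isCont arcsin 0" by (rule isCont_arcsin) auto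
    hence "(arcsin \<longlongrightarrow> 0) (at 0)" by (simp add: isCont_def)
    hence "(arcsin \<longlongrightarrow> 0) (at_right 0)" by (simp add: filterlim_at_split)
    moreover have "((\<lambda>x::real. sqrt (1 - x\<^sup>2) * (ln (1 - x\<^sup>2) / 2) / x) \<longlongrightarrow> 0) (at_right 0)" by real_asymp
    ultimately show "(E \<longlongrightarrow> 0) (at_right 0)"
      unfolding E_def using tendsto_add by fastforce
  qed (use b in auto)
  from sums_mult[OF this, of "(sin t)\<^sup>2"]
  have "(\<lambda>k. c k / (2 * real k + 1) * ((sin t)\<^sup>2) ^ Suc k) sums (sin t * E (sin t))"
    using b by (simp add: mult_ac power2_eq_square)
  moreover have "c k / (2 * real k + 1) * ((sin t)\<^sup>2) ^ Suc k =
      central_coeff (Suc k) * odd_harmonic (Suc k) / (2 * real (Suc k) - 1) * sin t ^ (2 * Suc k)" for k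
    by (simp add: c_def power_mult power2_eq_square add.commute)
  ultimately have "(\<lambda>k. central_coeff (Suc k) * odd_harmonic (Suc k) / (2 * real (Suc k) - 1) * sin t ^ (2 * Suc k)) sums (sin t * E (sin t))"
    by simp
  hence "(\<lambda>k. central_coeff k * odd_harmonic k / (2 * real k - 1) * sin t ^ (2 * k)) sums (sin t * E (sin t))"
    by (subst (asm) sums_Suc_iff[where f = "\<lambda>k. central_coeff k * odd_harmonic k / (2 * real k - 1) * sin t ^ (2 * k)"]) simp
  moreover have "sin t * E (sin t) = cos t * ln (cos t) + t * sin t"
  proof -
    have c: "1 - (sin t)\<^sup>2 = (cos t)\<^sup>2" by (simp add: cos_squared_eq)
    have "arcsin (sin t) = t" using t by (intro arcsin_sin) auto
    thus ?thesis unfolding E_def c using b by (simp add: ln_realpow field_simps)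
  qed
  ultimately show ?thesis by simp
qed

lemma sin_power_deriv:
  "((\<lambda>t. sin t ^ (2 * k + 1)) has_field_derivative real (2 * k + 1) * sin t ^ (2 * k) * cos t) (at t within A)" for t :: real
  by (rule DERIV_cong[OF DERIV_power[OF has_field_derivative_at_within[OF DERIV_sin]]]) simp

text \<open>Wallis' integrals: differentiating \<open>sin^(2k+1) cos\<close> reproduces the
  recurrence of \<open>central_coeff\<close>.\<close>

lemma has_integral_sin_power:
  "((\<lambda>t. sin t ^ (2 * k)) has_integral pi / 2 * central_coeff k) {0..pi/2}"
proof (induction k)
  case 0
  show ?case using has_integral_const_real[of "1 :: real" 0 "pi / 2"] by simp
next
  case (Suc k)
  define A where "A = (\<lambda>t::real. sin t ^ (2 * k + 1) * cos t)"
  have "((\<lambda>t. (2 * real k + 1) * sin t ^ (2 * k) - (2 * real k + 2) * sin t ^ (2 * Suc k)) has_integral A (pi / 2) - A 0) {0..pi/2}"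
  proof (rule fundamental_theorem_of_calculus)
    fix t
    have "(A has_field_derivative (real (2 * k + 1) * sin t ^ (2 * k) * cos t) * cos t + - sin t * sin t ^ (2 * k + 1)) (at t within {0..pi/2})"
      unfolding A_def by (intro DERIV_mult sin_power_deriv) (auto intro!: derivative_eq_intros)
    moreover have "(real (2 * k + 1) * sin t ^ (2 * k) * cos t) * cos t + - sin t * sin t ^ (2 * k + 1) =
        (2 * real k + 1) * sin t ^ (2 * k) * (1 - (sin t)\<^sup>2) - (sin t)\<^sup>2 * sin t ^ (2 * k)"
      unfolding cos_squared_eq[symmetric] by (simp add: power2_eq_square mult_ac)
    moreover have "\<dots> = (2 * real k + 1) * sin t ^ (2 * k) - (2 * real k + 2) * sin t ^ (2 * Suc k)"
      by (simp add: power2_eq_square algebra_simps)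
    ultimately show "(A has_vector_derivative (2 * real k + 1) * sin t ^ (2 * k) - (2 * real k + 2) * sin t ^ (2 * Suc k)) (at t within {0..pi/2})"
      by (simp add: has_real_derivative_iff_has_vector_derivative)
  qed auto
  hence "((\<lambda>t. (2 * real k + 1) * sin t ^ (2 * k) - (2 * real k + 2) * sin t ^ (2 * Suc k)) has_integral 0) {0..pi/2}"
    by (simp add: A_def)
  from has_integral_mult_right[OF has_integral_diff[OF has_integral_mult_right[OF Suc.IH, of "2 * real k + 1"] this], of "1 / (2 * real k + 2)"]
  have "((\<lambda>t. 1 / (2 * real k + 2) * ((2 * real k + 2) * sin t ^ (2 * Suc k))) has_integral
      1 / (2 * real k + 2) * ((2 * real k + 1) * (pi / 2 * central_coeff k))) {0..pi/2}"
    by simp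
  moreover have "1 / p * (p * y) = y" if "p > 0" for p y :: real using that by simp
  moreover have "2 * real k + 2 > 0" by simp
  ultimately have "((\<lambda>t. sin t ^ (2 * Suc k)) has_integral
      1 / (2 * real k + 2) * ((2 * real k + 1) * (pi / 2 * central_coeff k))) {0..pi/2}"
    by (simp only:)
  thus ?case by (simp add: central_coeff_Suc mult_ac)
qed

lemma tan_half_deriv:
  assumes t: "t \<in> {0<..<pi/2}"
  shows "((\<lambda>t. ln (tan (t / 2))) has_field_derivative 1 / sin t) (at t)"
proof -
  have pos: "sin (t / 2) > 0" "cos (t / 2) > 0" using t by (auto intro!: cos_gt_zero sin_gt_zero)
  have "((\<lambda>t. tan (t / 2)) has_field_derivative inverse ((cos (t / 2))\<^sup>2) * (1 / 2)) (at t)"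
    by (rule DERIV_chain2[OF DERIV_tan]) (use pos in \<open>auto intro!: derivative_eq_intros\<close>)
  from DERIV_chain2[OF DERIV_ln_divide this] sin_cos_bounds_Ioo(5)[OF t]
  have "((\<lambda>t. ln (tan (t / 2))) has_field_derivative 1 / tan (t / 2) * (inverse ((cos (t / 2))\<^sup>2) * (1 / 2))) (at t)"
    by simp
  moreover have "1 / (S / C) * (inverse (C\<^sup>2) * (1 / 2)) = 1 / (2 * S * C)" if "S > 0" "C > 0" for S C :: real
    using that by (simp add: field_simps power2_eq_square)
  from this[OF pos] have "1 / tan (t / 2) * (inverse ((cos (t / 2))\<^sup>2) * (1 / 2)) = 1 / sin t"
    using sin_double[of "t / 2"] unfolding tan_def by (simp only:) simp
  ultimately show ?thesis by (simp only:)
qed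

text \<open>Since \<open>ln (tan (t/2))\<close> has derivative \<open>1 / sin t\<close> and vanishes
  at \<open>pi/2\<close>, integrating by parts leads back to Wallis' integrals without boundary
  terms.\<close>

lemma has_integral_sin_power_ln_tan_half:
  "((\<lambda>t. sin t ^ (2 * k) * cos t * (- ln (tan (t / 2)))) has_integral
     pi / 2 * (central_coeff k / (2 * real k + 1))) {0..pi/2}"
proof -
  \<comment> \<open>Grouping one \<open>sin t\<close> with the logarithm isolates a limit free of
    the symbolic exponent \<open>k\<close>.\<close>
  define A where "A = (\<lambda>t::real. sin t ^ (2 * k) * (sin t * ln (tan (t / 2))) / (2 * real k + 1))"
  have 1: "(A has_vector_derivative sin t ^ (2 * k) * cos t * ln (tan (t / 2)) + sin t ^ (2 * k) / (2 * real k + 1)) (at t)"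
    if t: "t \<in> {0<..<pi/2}" for t
  proof -
    have A: "A = (\<lambda>t. sin t ^ (2 * k + 1) * ln (tan (t / 2)) / (2 * real k + 1))"
      by (simp add: A_def fun_eq_iff mult_ac)
    have "(A has_field_derivative
       ((real (2 * k + 1) * sin t ^ (2 * k) * cos t) * ln (tan (t / 2)) + 1 / sin t * sin t ^ (2 * k + 1)) / (2 * real k + 1)) (at t)"
      unfolding A by (intro DERIV_cdivide DERIV_mult tan_half_deriv sin_power_deriv t)
    moreover have "1 / sin t * sin t ^ (2 * k + 1) = sin t ^ (2 * k)"
      using sin_cos_bounds_Ioo(1)[OF t] by simp
    moreover have "(m * s * c * l + s) / m = s * c * l + s / m" if "m > 0" for m s c l :: real
      using that by (simp add: add_divide_distrib)
    note gen = this
    have "real (2 * k + 1) = 2 * real k + 1" by simp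
    hence "(real (2 * k + 1) * s * c * l + s) / (2 * real k + 1) = s * c * l + s / (2 * real k + 1)" for s c l
      by (simp only:) (rule gen, simp)
    ultimately show ?thesis by (simp only: has_real_derivative_iff_has_vector_derivative)
  qed
  have 2: "continuous_on {0..pi/2} A"
  proof (rule continuous_on_Icc_left)
    have "cos (t / 2) > 0" "tan (t / 2) > 0" if "t \<in> {0<..pi/2}" for t
      using that by (auto intro!: cos_gt_zero tan_gt_zero)
    thus "continuous_on {0<..pi/2} A"
      unfolding A_def by (intro continuous_intros) (auto simp: less_imp_neq[symmetric] add_nonneg_eq_0_iff)
    have "((\<lambda>t::real. sin t * ln (tan (t / 2))) \<longlongrightarrow> 0) (at_right 0)" by real_asymp
    moreover have "((\<lambda>t::real. sin t ^ (2 * k)) \<longlongrightarrow> sin 0 ^ (2 * k)) (at_right 0)"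
      by (intro tendsto_intros)
    ultimately have "((\<lambda>t. sin t ^ (2 * k) * (sin t * ln (tan (t / 2))) / (2 * real k + 1)) \<longlongrightarrow> sin 0 ^ (2 * k) * 0 / (2 * real k + 1)) (at_right 0)"
      by (intro tendsto_intros) (auto simp: add_nonneg_eq_0_iff)
    thus "(A \<longlongrightarrow> A 0) (at_right 0)" by (simp add: A_def)
  qed auto
  have "((\<lambda>t. sin t ^ (2 * k) * cos t * ln (tan (t / 2)) + sin t ^ (2 * k) / (2 * real k + 1)) has_integral A (pi / 2) - A 0) {0..pi/2}"
    by (intro fundamental_theorem_of_calculus_interior 1 2) auto
  hence "((\<lambda>t. sin t ^ (2 * k) * cos t * ln (tan (t / 2)) + sin t ^ (2 * k) / (2 * real k + 1)) has_integral 0) {0..pi/2}"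
    by (simp add: A_def tan_45)
  from has_integral_diff[OF has_integral_divide[OF has_integral_sin_power[of k], of "2 * real k + 1"] this]
  show ?thesis by simp
qed

text \<open>The halves below and above \<open>pi/4\<close> are exchanged by \<open>pi/2 - t\<close>
  and cancel. Absolute integrability is recorded because \<open>|ln (tan t)|\<close> dominates later
  limits.\<close>

lemma ln_tan_integral:
  "((\<lambda>t. ln (tan t)) has_integral 0) {0<..<pi/2}"
  "(\<lambda>t. ln (tan t)) absolutely_integrable_on {0<..<pi/2}"
proof -
  have der: "(arctan has_field_derivative 1 / (1 + x\<^sup>2)) (at x)" for x
    by (auto intro!: derivative_eq_intros simp: inverse_eq_divide)
  have ai: "(\<lambda>x. ln x * c / (1 + x\<^sup>2)) absolutely_integrable_on {0<..<1}" for c :: real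
    using sq_int_mult[OF sq_int_logs(1) sq_int_logs(5)[of c]] .
  have r: "tan t \<in> {0<..<1} \<and> arctan (tan t) = t" if "t \<in> {0<..<pi/4}" for t
  proof -
    have "tan t > 0" "tan t < tan (pi / 4)" "arctan (tan t) = t"
      using that by (auto intro!: tan_gt_zero tan_monotone arctan_tan)
    thus ?thesis by (simp add: tan_45)
  qed
  have r1: "arctan x \<in> {0<..<pi/4} \<and> tan (arctan x) = x" if "x \<in> {0<..<1}" for x
    using that arctan_less_pi4_pos[of x] by (simp add: tan_arctan)
  have e1: "\<bar>1 / (1 + x\<^sup>2)\<bar> * ln (tan (arctan x)) = ln x * 1 / (1 + x\<^sup>2)" for x
    by (simp add: tan_arctan add_pos_nonneg)
  note A = has_integral_change_of_variables_Ioo[OF der r1 r e1 ai]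
  have der2: "((\<lambda>x. pi / 2 - arctan x) has_field_derivative - 1 / (1 + x\<^sup>2)) (at x)" for x
    by (auto intro!: derivative_eq_intros simp: inverse_eq_divide)
  have t2: "tan (pi / 2 - t) = inverse (tan t)" for t :: real
    by (simp add: tan_def sin_diff cos_diff)
  have r2: "tan (pi / 2 - t) \<in> {0<..<1} \<and> pi / 2 - arctan (tan (pi / 2 - t)) = t" if "t \<in> {pi/4<..<pi/2}" for t
    using r[of "pi / 2 - t"] that by simp
  have r3: "pi / 2 - arctan x \<in> {pi/4<..<pi/2} \<and> tan (pi / 2 - (pi / 2 - arctan x)) = x" if "x \<in> {0<..<1}" for x
    using r1[OF that] by simp
  have e2: "\<bar>- 1 / (1 + x\<^sup>2)\<bar> * ln (tan (pi / 2 - arctan x)) = ln x * (-1) / (1 + x\<^sup>2)" if "x \<in> {0<..<1}" for x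
    using that unfolding t2 by (simp add: tan_arctan add_pos_nonneg ln_inverse)
  note B = has_integral_change_of_variables_Ioo[OF der2 r3 r2 e2 ai]
  have "((\<lambda>t. ln (tan t)) has_integral
      integral {0<..<1} (\<lambda>x. ln x * 1 / (1 + x\<^sup>2)) + integral {0<..<1} (\<lambda>x. ln x * (-1) / (1 + x\<^sup>2))) {0<..<pi/2}"
    by (rule has_integral_Un_cofinite[OF A(1) B(1)]) (auto intro: finite_subset[of _ "{pi/4}"])
  thus "((\<lambda>t. ln (tan t)) has_integral 0) {0<..<pi/2}" by simp
  have A': "(\<lambda>t. ln (tan t)) absolutely_integrable_on ({0<..<pi/4} \<union> {pi/4<..<pi/2})"
    by (intro absolutely_integrable_Un A(2) B(2))
  have N1: "negligible {t \<in> {0<..<pi/4} \<union> {pi/4<..<pi/2} - {0<..<pi/2}. ln (tan t) \<noteq> 0}"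
    by (rule negligible_subset[of "{}"]) auto
  have N2: "negligible {t \<in> {0<..<pi/2} - ({0<..<pi/4} \<union> {pi/4<..<pi/2}). ln (tan t) \<noteq> 0}"
    by (rule negligible_subset[of "{pi/4}"]) auto
  show "(\<lambda>t. ln (tan t)) absolutely_integrable_on {0<..<pi/2}"
    using A' absolutely_integrable_spike_set_eq[OF N1 N2] by blast
qed

text \<open>Differentiating \<open>sin^(2k+1) cos ln tan\<close> gives the recurrence of
  \<open>central_coeff k * odd_harmonic k\<close>, with Wallis' integral as its inhomogeneous
  term.\<close>

lemma has_integral_sin_power_ln_tan:
  "((\<lambda>t. sin t ^ (2 * k) * ln (tan t)) has_integral pi / 2 * (central_coeff k * odd_harmonic k)) {0..pi/2}"
proof (induction k)
  case 0
  show ?case using ln_tan_integral(1) by (simp add: has_integral_Icc_iff_Ioo)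
next
  case (Suc k)
  define A where "A = (\<lambda>t::real. sin t ^ (2 * k) * (sin t * cos t * ln (tan t)))"
  define D where "D = (\<lambda>t. (2 * real k + 1) * (sin t ^ (2 * k) * ln (tan t)) + sin t ^ (2 * k)
      - (2 * real k + 2) * (sin t ^ (2 * Suc k) * ln (tan t)))"
  have 1: "(A has_vector_derivative D t) (at t)" if t: "t \<in> {0<..<pi/2}" for t
  proof -
    note b = sin_cos_bounds_Ioo[OF t]
    have A: "A = (\<lambda>t. sin t ^ (2 * k + 1) * cos t * ln (tan t))"
      by (simp add: A_def fun_eq_iff mult_ac)
    have "((\<lambda>t. ln (tan t)) has_field_derivative 1 / tan t * inverse ((cos t)\<^sup>2)) (at t)"
      by (rule DERIV_chain2[OF DERIV_ln_divide DERIV_tan]) (use b in auto)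
    hence "(A has_field_derivative
        ((real (2 * k + 1) * sin t ^ (2 * k) * cos t) * cos t + - sin t * sin t ^ (2 * k + 1)) * ln (tan t)
        + 1 / tan t * inverse ((cos t)\<^sup>2) * (sin t ^ (2 * k + 1) * cos t)) (at t)"
      unfolding A by (intro DERIV_mult sin_power_deriv) (auto intro!: derivative_eq_intros)
    moreover have "(real (2 * k + 1) * sin t ^ (2 * k) * cos t) * cos t + - sin t * sin t ^ (2 * k + 1) =
        (2 * real k + 1) * sin t ^ (2 * k) * (1 - (sin t)\<^sup>2) - (sin t)\<^sup>2 * sin t ^ (2 * k)"
      unfolding cos_squared_eq[symmetric] by (simp add: power2_eq_square mult_ac)
    moreover have "\<dots> = (2 * real k + 1) * sin t ^ (2 * k) - (2 * real k + 2) * sin t ^ (2 * Suc k)"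
      by (simp add: power2_eq_square algebra_simps)
    moreover have "1 / (S / C) * inverse (C\<^sup>2) * (S * P * C) = P" if "S > 0" "C > 0" for S C P :: real
      using that by (simp add: field_simps power2_eq_square)
    from this[OF b(1,3)] have "1 / tan t * inverse ((cos t)\<^sup>2) * (sin t ^ (2 * k + 1) * cos t) = sin t ^ (2 * k)"
      by (simp add: tan_def)
    moreover have "((2 * real k + 1) * P - (2 * real k + 2) * Q) * l + P = (2 * real k + 1) * (P * l) + P - (2 * real k + 2) * (Q * l)" for P Q l
      by (simp add: algebra_simps)
    ultimately show ?thesis by (simp only: has_real_derivative_iff_has_vector_derivative D_def)
  qed
  have 2: "continuous_on {0..pi/2} A"
  proof (rule continuous_on_IccI)
    have s: "((\<lambda>t::real. sin t ^ (2 * k)) \<longlongrightarrow> sin u ^ (2 * k)) (at u within U)" for u U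
      by (intro tendsto_intros)
    have "((\<lambda>t::real. sin t * cos t * ln (tan t)) \<longlongrightarrow> 0) (at_right 0)" by real_asymp
    from tendsto_mult[OF s this] show "(A \<longlongrightarrow> A 0) (at_right 0)" by (simp add: A_def)
    have "((\<lambda>t::real. sin t * cos t * ln (tan t)) \<longlongrightarrow> 0) (at_left (pi / 2))" by real_asymp
    from tendsto_mult[OF s this] show "(A \<longlongrightarrow> A (pi / 2)) (at_left (pi / 2))" by (simp add: A_def)
    show "(A \<longlongrightarrow> A t) (at t)" if "0 < t" "t < pi / 2" for t
      using 1[of t] that has_vector_derivative_continuous by (fastforce simp: continuous_within)
  qed auto
  have "(D has_integral A (pi / 2) - A 0) {0..pi/2}"
    by (intro fundamental_theorem_of_calculus_interior 1 2) auto
  hence "(D has_integral 0) {0..pi/2}" by (simp add: A_def)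
  from has_integral_mult_right[OF has_integral_diff[OF has_integral_add[OF
        has_integral_mult_right[OF Suc.IH, of "2 * real k + 1"] has_integral_sin_power[of k]] this], of "1 / (2 * real k + 2)"]
  have "((\<lambda>t. 1 / (2 * real k + 2) * ((2 * real k + 2) * (sin t ^ (2 * Suc k) * ln (tan t)))) has_integral
      1 / (2 * real k + 2) * ((2 * real k + 1) * (pi / 2 * (central_coeff k * odd_harmonic k)) + pi / 2 * central_coeff k)) {0..pi/2}"
    by (simp add: D_def)
  moreover have "1 / p * (p * y) = y" if "p > 0" for p y :: real using that by simp
  moreover have "2 * real k + 2 > 0" by simp
  ultimately have "((\<lambda>t. sin t ^ (2 * Suc k) * ln (tan t)) has_integral
      1 / (2 * real k + 2) * ((2 * real k + 1) * (pi / 2 * (central_coeff k * odd_harmonic k)) + pi / 2 * central_coeff k)) {0..pi/2}"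
    by (simp only:)
  also have "1 / (2 * real k + 2) * ((2 * real k + 1) * (pi / 2 * (central_coeff k * odd_harmonic k)) + pi / 2 * central_coeff k)
      = pi / 2 * (central_coeff (Suc k) * odd_harmonic (Suc k))"
  proof -
    have "1 / n * (m * (p * (b * h)) + p * b) = p * (m / n * b * (h + 1 / m))" if "m > 0" "n > 0" for m n p b h :: real
      using that by (simp add: field_simps)
    note gen = this
    show ?thesis unfolding central_coeff_Suc odd_harmonic_Suc by (rule gen) auto
  qed
  finally show ?case .
qed


subsection \<open>Summation\<close>

text \<open>Nonnegativity of \<open>p k\<close> places all partial sums between 0 and
  \<open>P\<close>, so a single \<open>h\<close> dominates although \<open>w\<close> may change
  sign.\<close>

lemma sums_integral_dominated:
  fixes p :: "nat \<Rightarrow> real \<Rightarrow> real" and w P h :: "real \<Rightarrow> real"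
  assumes int: "\<And>k. ((\<lambda>t. p k t * w t) has_integral I k) S"
    and nonneg: "\<And>k t. t \<in> S \<Longrightarrow> p k t \<ge> 0"
    and sums: "\<And>t. t \<in> S \<Longrightarrow> (\<lambda>k. p k t) sums P t"
    and bound: "\<And>t. t \<in> S \<Longrightarrow> P t * \<bar>w t\<bar> \<le> h t"
    and h: "h integrable_on S"
  shows "I sums integral S (\<lambda>t. P t * w t)"
proof -
  have part: "((\<lambda>t. (\<Sum>k<n. p k t) * w t) has_integral (\<Sum>k<n. I k)) S" for n
    unfolding sum_distrib_right by (intro has_integral_sum int) auto
  have "(\<lambda>n. integral S (\<lambda>t. (\<Sum>k<n. p k t) * w t)) \<longlonglongrightarrow> integral S (\<lambda>t. P t * w t)"
  proof (rule dominated_convergence(2)[OF _ h])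
    show "(\<lambda>t. (\<Sum>k<n. p k t) * w t) integrable_on S" for n
      using part by blast
    show "norm ((\<Sum>k<n. p k t) * w t) \<le> h t" if t: "t \<in> S" for n t
    proof -
      have "(\<Sum>k<n. p k t) \<le> P t"
        using sums_unique[OF sums[OF t]] sum_le_suminf[of "\<lambda>k. p k t" "{..<n}"] nonneg[OF t] sums[OF t]
        by (simp add: sums_iff)
      moreover have "(\<Sum>k<n. p k t) \<ge> 0" by (intro sum_nonneg nonneg t)
      ultimately have "norm ((\<Sum>k<n. p k t) * w t) \<le> P t * \<bar>w t\<bar>"
        by (simp add: abs_mult mult_right_mono)
      thus ?thesis using bound[OF t] by linarith
    qed
    show "(\<lambda>n. (\<Sum>k<n. p k t) * w t) \<longlonglongrightarrow> P t * w t" if t: "t \<in> S" for t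
      using sums[OF t] unfolding sums_def by (intro tendsto_mult tendsto_const)
  qed
  moreover have "integral S (\<lambda>t. (\<Sum>k<n. p k t) * w t) = (\<Sum>k<n. I k)" for n
    using part by (rule integral_unique)
  ultimately show ?thesis by (simp add: sums_def)
qed

text \<open>The bracket with \<open>odd_harmonic\<close> supplies the coefficients of the generating
  function \<open>P\<close>; the remaining factor \<open>central_coeff k / (2 k + 1)\<close> is the
  moment, whose \<open>pi / 2\<close> the prefactor \<open>2 / pi\<close> removes.\<close>

lemma sums_central_coeff_plus:
  "(\<lambda>k. (central_coeff k)\<^sup>2 / (2 * real k + 1) * (2 * odd_harmonic k + 1 / (2 * real k + 1))) sums
     (2 / pi * (9 * pi ^ 3 / 16 + 3 * pi * (ln 2)\<^sup>2 / 4 - 4 * ln 2 * catalan_constant - 24 * cal_G))"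
proof -
  let ?S = "{0<..<pi/2}"
  define e where "e k = central_coeff k * (2 * odd_harmonic k + 1 / (2 * real k + 1))" for k
  define F where "F = (\<lambda>t::real. - ln (tan (t / 2)) * (- 2 * ln (cos t) + t * cos t / sin t))"
  define P where "P = (\<lambda>t::real. 2 * (- ln (cos t) / cos t) + t / sin t)"
  have e: "e k \<ge> 0" for k
    using central_coeff_pos[of k] odd_harmonic_nonneg[of k] by (simp add: e_def)
  have PF: "P t * (cos t * (- ln (tan (t / 2)))) = F t" if "t \<in> ?S" for t
    using sin_cos_bounds_Ioo(1,3)[OF that] by (simp add: P_def F_def field_simps)
  have "(\<lambda>k. e k * (pi / 2 * (central_coeff k / (2 * real k + 1)))) sums
      integral ?S (\<lambda>t. P t * (cos t * (- ln (tan (t / 2)))))"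
  proof (rule sums_integral_dominated[where p = "\<lambda>k t. e k * sin t ^ (2 * k)" and h = "\<lambda>t. \<bar>F t\<bar>"])
    fix k
    have "((\<lambda>t. e k * (sin t ^ (2 * k) * cos t * (- ln (tan (t / 2))))) has_integral
        e k * (pi / 2 * (central_coeff k / (2 * real k + 1)))) ?S"
      using has_integral_sin_power_ln_tan_half[of k]
      by (intro has_integral_mult_right) (simp add: has_integral_Icc_iff_Ioo)
    thus "((\<lambda>t. e k * sin t ^ (2 * k) * (cos t * (- ln (tan (t / 2))))) has_integral
        e k * (pi / 2 * (central_coeff k / (2 * real k + 1)))) ?S"
      by (simp only: mult.assoc)
  next
    fix k and t :: real assume t: "t \<in> ?S"
    note b = sin_cos_bounds_Ioo[OF t]
    show "0 \<le> e k * sin t ^ (2 * k)" using e[of k] by simp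
    have "(\<lambda>k. 2 * (central_coeff k * odd_harmonic k * sin t ^ (2 * k)) +
        central_coeff k / (2 * real k + 1) * sin t ^ (2 * k)) sums P t"
      unfolding P_def
      by (intro sums_add sums_mult central_coeff_odd_harmonic_sin_sums central_coeff_arcsin_sin_sums t)
    thus "(\<lambda>k. e k * sin t ^ (2 * k)) sums P t"
      by (simp add: e_def algebra_simps)
    have "ln (tan (t / 2)) \<le> 0" "ln (cos t) \<le> 0" using b by auto
    moreover have "t > 0" using t by simp
    ultimately have "P t \<ge> 0" using b unfolding P_def by (intro add_nonneg_nonneg) (auto simp: divide_nonneg_pos divide_nonpos_pos)
    hence "P t * \<bar>cos t * (- ln (tan (t / 2)))\<bar> = \<bar>F t\<bar>"
      unfolding PF[OF t, symmetric] by (simp add: abs_mult)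
    thus "P t * \<bar>cos t * (- ln (tan (t / 2)))\<bar> \<le> \<bar>F t\<bar>" by simp
  next
    have "F absolutely_integrable_on ?S" using has_integral_ln_tan_half(2) unfolding F_def .
    thus "(\<lambda>t. \<bar>F t\<bar>) integrable_on ?S" by (simp add: absolutely_integrable_on_def)
  qed
  also have "integral ?S (\<lambda>t. P t * (cos t * (- ln (tan (t / 2))))) = integral ?S F"
    by (rule integral_cong) (rule PF)
  also have "integral ?S F = 9 * pi ^ 3 / 16 + 3 * pi * (ln 2)\<^sup>2 / 4 - 4 * ln 2 * catalan_constant - 24 * cal_G"
    using has_integral_ln_tan_half(1) unfolding F_def by (rule integral_unique)
  finally have "(\<lambda>k. 2 / pi * (e k * (pi / 2 * (central_coeff k / (2 * real k + 1))))) sums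
     (2 / pi * (9 * pi ^ 3 / 16 + 3 * pi * (ln 2)\<^sup>2 / 4 - 4 * ln 2 * catalan_constant - 24 * cal_G))"
    by (rule sums_mult)
  moreover have "2 / pi * (b * m * (pi / 2 * (b / p))) = b\<^sup>2 / p * m" for b m p :: real
    by (simp add: power2_eq_square)
  ultimately show ?thesis unfolding e_def by (simp only:)
qed

text \<open>\<open>central_coeff k * odd_harmonic k\<close> is used twice: as a moment of
  \<open>ln (tan t)\<close>, and, over \<open>2 k - 1\<close>, as coefficient of a generating
  function that stays below \<open>pi / 2\<close>.\<close>

lemma sums_central_coeff_minus:
  "(\<lambda>k. (central_coeff k * odd_harmonic k)\<^sup>2 / (2 * real k - 1)) sums
     (2 / pi * (2 * catalan_constant - pi\<^sup>2 / 24 - (ln 2)\<^sup>2))"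
proof -
  let ?S = "{0<..<pi/2}"
  define e where "e k = central_coeff k * odd_harmonic k / (2 * real k - 1)" for k
  define P where "P = (\<lambda>t::real. cos t * ln (cos t) + t * sin t)"
  \<comment> \<open>At \<open>k = 0\<close> the denominator is -1, but
    \<open>odd_harmonic 0 = 0\<close>.\<close>
  have e: "e k \<ge> 0" for k
    using central_coeff_pos[of k] odd_harmonic_nonneg[of k] by (cases k) (auto simp: e_def)
  have "(\<lambda>k. e k * (pi / 2 * (central_coeff k * odd_harmonic k))) sums integral ?S (\<lambda>t. P t * ln (tan t))"
  proof (rule sums_integral_dominated[where p = "\<lambda>k t. e k * sin t ^ (2 * k)" and h = "\<lambda>t. pi / 2 * \<bar>ln (tan t)\<bar>"])
    fix k
    have "((\<lambda>t. e k * (sin t ^ (2 * k) * ln (tan t))) has_integral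
        e k * (pi / 2 * (central_coeff k * odd_harmonic k))) ?S"
      using has_integral_sin_power_ln_tan[of k]
      by (intro has_integral_mult_right) (simp add: has_integral_Icc_iff_Ioo)
    thus "((\<lambda>t. e k * sin t ^ (2 * k) * ln (tan t)) has_integral
        e k * (pi / 2 * (central_coeff k * odd_harmonic k))) ?S"
      by (simp only: mult.assoc)
  next
    fix k and t :: real assume t: "t \<in> ?S"
    note b = sin_cos_bounds_Ioo[OF t]
    show "0 \<le> e k * sin t ^ (2 * k)" using e[of k] by simp
    show "(\<lambda>k. e k * sin t ^ (2 * k)) sums P t"
      unfolding P_def e_def by (rule central_coeff_shifted_sin_sums[OF t])
    have "cos t * ln (cos t) \<le> 0" using b by (intro mult_nonneg_nonpos) auto
    moreover have "t * sin t \<le> pi / 2 * 1" using t b by (intro mult_mono) auto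
    ultimately have "P t \<le> pi / 2" by (simp add: P_def)
    thus "P t * \<bar>ln (tan t)\<bar> \<le> pi / 2 * \<bar>ln (tan t)\<bar>" by (intro mult_right_mono) auto
  next
    show "(\<lambda>t. pi / 2 * \<bar>ln (tan t)\<bar>) integrable_on ?S"
      using ln_tan_integral(2) by (intro integrable_on_mult_right) (simp add: absolutely_integrable_on_def)
  qed
  also have "integral ?S (\<lambda>t. P t * ln (tan t)) = 2 * catalan_constant - pi\<^sup>2 / 24 - (ln 2)\<^sup>2"
    using has_integral_ln_tan_combination unfolding P_def
    by (intro integral_unique) (simp add: has_integral_Icc_iff_Ioo mult.commute)
  finally have "(\<lambda>k. 2 / pi * (e k * (pi / 2 * (central_coeff k * odd_harmonic k)))) sums
     (2 / pi * (2 * catalan_constant - pi\<^sup>2 / 24 - (ln 2)\<^sup>2))"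
    by (rule sums_mult)
  moreover have "2 / pi * (m / q * (pi / 2 * m)) = m\<^sup>2 / q" for m q :: real
    by (simp add: power2_eq_square)
  ultimately show ?thesis unfolding e_def by (simp only:)
qed

text \<open>Read off the moment integral: \<open>sin t ^ (2 * k)\<close> tends to 0 pointwise inside
  the interval, dominated by \<open>|ln (tan t)|\<close>.\<close>

lemma central_coeff_odd_harmonic_tendsto_0:
  "(\<lambda>k. central_coeff k * odd_harmonic k) \<longlonglongrightarrow> 0"
proof -
  let ?S = "{0<..<pi/2}"
  have int: "((\<lambda>t. sin t ^ (2 * k) * ln (tan t)) has_integral pi / 2 * (central_coeff k * odd_harmonic k)) ?S" for k
    using has_integral_sin_power_ln_tan[of k] by (simp add: has_integral_Icc_iff_Ioo)
  have "(\<lambda>k. integral ?S (\<lambda>t. sin t ^ (2 * k) * ln (tan t))) \<longlonglongrightarrow> integral ?S (\<lambda>t. 0)"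
  proof (rule dominated_convergence(2)[where h = "\<lambda>t. \<bar>ln (tan t)\<bar>"])
    show "(\<lambda>t. sin t ^ (2 * k) * ln (tan t)) integrable_on ?S" for k
      using int by blast
    show "(\<lambda>t. \<bar>ln (tan t)\<bar>) integrable_on ?S"
      using ln_tan_integral(2) by (simp add: absolutely_integrable_on_def)
    fix t :: real assume t: "t \<in> ?S"
    note b = sin_cos_bounds_Ioo[OF t]
    show "norm (sin t ^ (2 * k) * ln (tan t)) \<le> \<bar>ln (tan t)\<bar>" for k
      using b by (simp add: abs_mult power_abs mult_left_le_one_le power_le_one)
    have "(\<lambda>k. ((sin t)\<^sup>2) ^ k * ln (tan t)) \<longlonglongrightarrow> 0 * ln (tan t)"
      using b by (intro tendsto_mult tendsto_const LIMSEQ_power_zero) (simp add: power_less_one_iff)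
    thus "(\<lambda>k. sin t ^ (2 * k) * ln (tan t)) \<longlonglongrightarrow> 0" by (simp add: power_mult)
  qed
  hence "(\<lambda>k. pi / 2 * (central_coeff k * odd_harmonic k)) \<longlonglongrightarrow> 0"
    using int[THEN integral_unique] by simp
  from tendsto_mult[OF tendsto_const[of "2 / pi"] this] show ?thesis by simp
qed

text \<open>Let \<open>u n\<close> be the quantity squared in the last line. The recurrence of
  \<open>central_coeff\<close> gives \<open>u (n + 1) = central_coeff n * (odd_harmonic n + 1 / (2 n
  + 1))\<close>, while \<open>2 n / (2 n - 1) = 1 + 1 / (2 n - 1)\<close>. In
  \<open>u (n + 1)^2 - u n^2\<close> the squares of \<open>central_coeff n * odd_harmonic n\<close>
  cancel, and the three summands remain.\<close>

lemma telescope_partial_sums: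
  "(\<Sum>k<n. (central_coeff k * odd_harmonic k / (2 * real k - 1))\<^sup>2) =
     (\<Sum>k<n. (central_coeff k)\<^sup>2 / (2 * real k + 1) * (2 * odd_harmonic k + 1 / (2 * real k + 1)))
     - 2 * (\<Sum>k<n. (central_coeff k * odd_harmonic k)\<^sup>2 / (2 * real k - 1))
     - (2 * real n / (2 * real n - 1) * (central_coeff n * odd_harmonic n))\<^sup>2"
proof (induction n)
  case (Suc n)
  define b h p q where bhpq: "b = central_coeff n" "h = odd_harmonic n" "p = 2 * real n + 1" "q = 2 * real n - 1"
  have p: "p > 0" by (simp add: bhpq)
  \<comment> \<open>\<open>2 n - 1\<close> is odd, hence nonzero, also at
    \<open>n = 0\<close>.\<close>
  have "2 * n \<noteq> 1" by presburger
  hence "real (2 * n) \<noteq> real 1" using of_nat_eq_iff by blast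
  hence q: "q \<noteq> 0" by (simp add: bhpq)
  have n: "2 * real n / q = (q + 1) / q" by (simp add: bhpq)
  have "2 * real (Suc n) / (2 * real (Suc n) - 1) * central_coeff (Suc n) = b"
  proof -
    have gen: "m / p * (p / m * b) = b" if "m > 0" for m using that p by simp
    have c: "central_coeff (Suc n) = p / (2 * real n + 2) * b" by (simp only: central_coeff_Suc bhpq)
    have e: "2 * real (Suc n) = 2 * real n + 2" "2 * real n + 2 - 1 = p" by (simp_all add: bhpq)
    show ?thesis unfolding c e by (rule gen) simp
  qed
  moreover have "odd_harmonic (Suc n) = h + 1 / p" by (simp add: odd_harmonic_Suc bhpq)
  ultimately have last: "2 * real (Suc n) / (2 * real (Suc n) - 1) * (central_coeff (Suc n) * odd_harmonic (Suc n)) = b * (h + 1 / p)"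
    by (simp only: mult.assoc[symmetric])
  have "(b * h / q)\<^sup>2 - ((q + 1) / q * (b * h))\<^sup>2 = b\<^sup>2 / p * (2 * h + 1 / p) - 2 * ((b * h)\<^sup>2 / q) - (b * (h + 1 / p))\<^sup>2"
  proof -
    have "(b * h / q)\<^sup>2 - ((q + 1) / q * (b * h))\<^sup>2 = - (b * h)\<^sup>2 - 2 * ((b * h)\<^sup>2 / q)"
      using q by (simp add: field_simps power2_eq_square)
    also have "\<dots> = b\<^sup>2 / p * (2 * h + 1 / p) - 2 * ((b * h)\<^sup>2 / q) - (b * (h + 1 / p))\<^sup>2"
      using p by (simp add: field_simps power2_eq_square)
    finally show ?thesis .
  qed
  moreover have "v - 2 * w - y + x = v + c - 2 * (w + d) - e" if "x - y = c - 2 * d - e" for v w x y c d e :: real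
    using that by simp
  ultimately show ?case
    unfolding sum.lessThan_Suc last Suc.IH bhpq[symmetric] n by blast
qed simp

theorem theorem1:
  shows "(\<lambda>n. let k = Suc n in
            (1 / 16) ^ k * real ((2 * k) choose k) ^ 2 *
              (odd_harmonic k ^ 2 / (2 * real k - 1) ^ 2))
         sums
         (- (8 * catalan_constant / pi) - 8 * catalan_constant * ln 2 / pi
          - 48 * cal_G / pi + 9 * pi ^ 2 / 8 + pi / 6
          + 4 * (ln 2) ^ 2 / pi + 3 * (ln 2) ^ 2 / 2)"
proof -
  define a where "a = (\<lambda>k. (central_coeff k * odd_harmonic k / (2 * real k - 1))\<^sup>2)"
  have r: "(\<lambda>n. 2 * real n / (2 * real n - 1)) \<longlonglongrightarrow> 1" by real_asymp
  have "(\<lambda>n. (2 * real n / (2 * real n - 1) * (central_coeff n * odd_harmonic n))\<^sup>2) \<longlonglongrightarrow> (1 * 0)\<^sup>2"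
    by (intro tendsto_power tendsto_mult r central_coeff_odd_harmonic_tendsto_0)
  from tendsto_diff[OF tendsto_diff[OF sums_central_coeff_plus[unfolded sums_def] tendsto_mult[OF tendsto_const[of 2] sums_central_coeff_minus[unfolded sums_def]]] this]
  have "a sums (2 / pi * (9 * pi ^ 3 / 16 + 3 * pi * (ln 2)\<^sup>2 / 4 - 4 * ln 2 * catalan_constant - 24 * cal_G)
      - 2 * (2 / pi * (2 * catalan_constant - pi\<^sup>2 / 24 - (ln 2)\<^sup>2)))"
    unfolding sums_def a_def telescope_partial_sums by simp
  also have "2 / pi * (9 * pi ^ 3 / 16 + 3 * pi * (ln 2)\<^sup>2 / 4 - 4 * ln 2 * catalan_constant - 24 * cal_G)
      - 2 * (2 / pi * (2 * catalan_constant - pi\<^sup>2 / 24 - (ln 2)\<^sup>2)) =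
      - (8 * catalan_constant / pi) - 8 * catalan_constant * ln 2 / pi
          - 48 * cal_G / pi + 9 * pi ^ 2 / 8 + pi / 6
          + 4 * (ln 2) ^ 2 / pi + 3 * (ln 2) ^ 2 / 2"
    by (simp add: field_simps power2_eq_square power3_eq_cube)
  \<comment> \<open>The term at \<open>k = 0\<close> is 0, so dropping it leaves the sum
    unchanged.\<close>
  finally have "(\<lambda>n. a (Suc n)) sums \<dots>"
    by (subst sums_Suc_iff) (simp add: a_def)
  moreover have "a k = (1 / 16) ^ k * real ((2 * k) choose k) ^ 2 * (odd_harmonic k ^ 2 / (2 * real k - 1) ^ 2)" for k
  proof -
    have "(4 ^ k)\<^sup>2 = (16 :: real) ^ k" by (simp add: power2_eq_square flip: power_mult_distrib)
    thus ?thesis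
      by (simp add: a_def central_coeff_def power_divide power_mult_distrib)
  qed
  ultimately show ?thesis by (simp only: Let_def)
qed

end
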